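(* Let $\Bbbk$ be a field of characteristic zero and $n\ge1$. For any standard tableau $\mathsf T$ of $n$ boxes, $\varepsilon_{\mathsf T}=e_{\mathsf T}$ in $\Bbbk\mathfrak{S}_n$. That is, the canonical idempotents $\varepsilon_{\mathsf T}$ of the multiplicity-free family $\{\Bbbk\mathfrak{S}_n\mid n\ge0\}$ are Young's seminormal idempotents $e_{\mathsf T}$.
   Context: $\mathfrak{S}_n$ is the symmetric group on $\{1,\dots,n\}$, with $\mathfrak{S}_{n-1}\subset\mathfrak{S}_n$ the subgroup fixing $n$, and $\Bbbk\mathfrak{S}_0=\Bbbk$. Permutations act on the right: $i^{\sigma\tau}=(i^\sigma)^\tau$. Modules are right modules. A tableau of $n$ boxes of shape $\lambda\vdash n$ is a filling of the Young diagram of $\lambda$ with $1,\dots,n$, each used once; it is standard if entries increase along rows and down columns. For a standard tableau $\mathsf T$ of $n$ boxes, $\overline{\mathsf T}$ is the standard tableau of $n-1$ boxes obtained by removing the box containing $n$. Young symmetrizers: let $\mathsf R(\mathsf T)$ and $\mathsf C(\mathsf T)$ be the subgroups of $\mathfrak{S}_n$ stabilizing the rows, respectively the columns, of $\mathsf T$, and put $$\mathsf y_{\mathsf T}=\frac1{h(\lambda)}\sum_{v\in\mathsf R(\mathsf T)}v\sum_{w\in\mathsf C(\mathsf T)}\operatorname{sgn}(w)\,w,\qquad h(\lambda)=\frac{n!}{n(\lambda)},$$ where $\lambda$ is the shape of $\mathsf T$ and $n(\lambda)$ is the number of standard tableaux of shape $\lambda$. The irreducible right $\Bbbk\mathfrak{S}_n$-module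 indexed by $\lambda\vdash n$ is $S^\lambda=\mathsf y_{\mathsf T}\Bbbk\mathfrak{S}_n$ for any standard tableau $\mathsf T$ of shape $\lambda$ (its isomorphism type depends only on $\lambda$). Seminormal idempotents: $e_{\mathsf T}=1$ if $n=1$, and $e_{\mathsf T}=e_{\overline{\mathsf T}}\cdot\mathsf y_{\mathsf T}\cdot e_{\overline{\mathsf T}}$ if $n>1$. Canonical idempotents: for $\lambda\vdash k$, let $\varepsilon(\lambda)\in Z(\Bbbk\mathfrak{S}_k)$ be the primitive central idempotent acting as the identity on $S^\lambda$ and as zero on $S^\mu$ for $\lambda\ne\mu\vdash k$. For a standard tableau $\mathsf T$ of $n$ boxes, let $\lambda_k\vdash k$ be the shape of the subtableau of $\mathsf T$ formed by the boxes containing $1,\dots,k$, and set $\varepsilon_{\mathsf T}=\varepsilon(\lambda_1)\varepsilon(\lambda_2)\cdots\varepsilon(\lambda_n)\in\Bbbk\mathfrak{S}_n$, where $\Bbbk\mathfrak{S}_1\subset\cdots\subset\Bbbk\mathfrak{S}_n$. (Here standard tableaux of $n$ boxes are identified with length-$n$ paths $\lambda_0=\varnothing\to\lambda_1\to\cdots\to\lambda_n$ in the branching graph of the family.) *)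

theory Defs
  imports "HOL-Library.Poly_Mapping" "HOL-Combinatorics.Permutations"
begin

typedef finperm = "{p :: nat \<Rightarrow> nat. permutation p}"
  morphisms app_perm Abs_finperm
  using permutation_id by blast

setup_lifting type_definition_finperm

text \<open>
  Convolution in \<^theory>\<open>HOL-Library.Poly_Mapping\<close> is based on an additively written monoid of
  keys, so the group of permutations is written additively although it is not commutative.
  Permutations act on the right: \<open>\<sigma> + \<tau>\<close> is the product applying first \<open>\<sigma>\<close>, then \<open>\<tau>\<close>.
\<close>

instantiation finperm :: group_add
begin

lift_definition zero_finperm :: finperm is id
  by simp

lift_definition plus_finperm :: "finperm \<Rightarrow> finperm \<Rightarrow> finperm" is "\<lambda>\<sigma> \<tau>. \<tau> \<circ> \<sigma>"
  by (simp add: permutation_compose)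

lift_definition uminus_finperm :: "finperm \<Rightarrow> finperm" is inv
  by (simp add: permutation_inverse)

definition minus_finperm :: "finperm \<Rightarrow> finperm \<Rightarrow> finperm" where
  "minus_finperm \<sigma> \<tau> = \<sigma> + - \<tau>"

instance
  by standard (transfer; auto simp: permutation_inverse_works o_assoc minus_finperm_def)+

end

definition sym_group :: "nat \<Rightarrow> finperm set" where
  "sym_group n = {\<sigma>. app_perm \<sigma> permutes {1..n}}"

text \<open>
  All the group algebras live inside the group algebra of the finitely supported permutations,
  which makes the inclusions between them set inclusions.
\<close>

type_synonym 'k group_alg = "finperm \<Rightarrow>\<^sub>0 'k"

definition sym_alg :: "nat \<Rightarrow> 'k::field_char_0 group_alg set" where
  "sym_alg n = {x. Poly_Mapping.keys x \<subseteq> sym_group n}"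

definition sym_alg_center :: "nat \<Rightarrow> 'k::field_char_0 group_alg set" where
  "sym_alg_center n = {z \<in> sym_alg n. \<forall>x \<in> sym_alg n. z * x = x * z}"

abbreviation basis_elem :: "finperm \<Rightarrow> 'k::field_char_0 group_alg" where
  "basis_elem \<sigma> \<equiv> Poly_Mapping.single \<sigma> 1"

abbreviation scalar :: "'k \<Rightarrow> 'k::field_char_0 group_alg" where
  "scalar c \<equiv> Poly_Mapping.single 0 c"

definition partition_of :: "nat list \<Rightarrow> nat \<Rightarrow> bool" (infix "\<turnstile>p" 50) where
  "lam \<turnstile>p n \<longleftrightarrow> sorted_wrt (\<ge>) lam \<and> 0 \<notin> set lam \<and> sum_list lam = n"

text \<open>A tableau is the list of its rows, from top to bottom.\<close>

type_synonym tableau = "nat list list"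

definition shape :: "tableau \<Rightarrow> nat list" where
  "shape T = map length T"

definition is_tableau :: "nat \<Rightarrow> tableau \<Rightarrow> bool" where
  "is_tableau n T \<longleftrightarrow> shape T \<turnstile>p n \<and> distinct (concat T) \<and> set (concat T) = {1..n}"

definition standard :: "nat \<Rightarrow> tableau \<Rightarrow> bool" where
  "standard n T \<longleftrightarrow> is_tableau n T \<and>
     (\<forall>i < length T. \<forall>j < length (T ! i). \<forall>j' < j. T ! i ! j' < T ! i ! j) \<and>
     (\<forall>i < length T. \<forall>j < length (T ! i). \<forall>i' < i. T ! i' ! j < T ! i ! j)"

definition num_standard :: "nat list \<Rightarrow> nat" where
  "num_standard lam = card {T. standard (sum_list lam) T \<and> shape T = lam}"

definition keep_boxes :: "(nat \<Rightarrow> bool) \<Rightarrow> tableau \<Rightarrow> tableau" where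
  "keep_boxes P T = filter (\<lambda>row. row \<noteq> []) (map (filter P) T)"

definition remove_box :: "nat \<Rightarrow> tableau \<Rightarrow> tableau" where
  "remove_box m T = keep_boxes (\<lambda>x. x \<noteq> m) T"

definition subtableau :: "nat \<Rightarrow> tableau \<Rightarrow> tableau" where
  "subtableau k T = keep_boxes (\<lambda>x. x \<le> k) T"

definition column :: "tableau \<Rightarrow> nat \<Rightarrow> nat set" where
  "column T j = {T ! i ! j | i. i < length T \<and> j < length (T ! i)}"

definition row_stabilizer :: "nat \<Rightarrow> tableau \<Rightarrow> finperm set" where
  "row_stabilizer n T = {\<sigma> \<in> sym_group n. \<forall>row \<in> set T. app_perm \<sigma> ` set row = set row}"

definition column_stabilizer :: "nat \<Rightarrow> tableau \<Rightarrow> finperm set" where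
  "column_stabilizer n T = {\<sigma> \<in> sym_group n. \<forall>j. app_perm \<sigma> ` column T j = column T j}"

definition h_const :: "nat \<Rightarrow> nat list \<Rightarrow> 'k::field_char_0" where
  "h_const n lam = fact n / of_nat (num_standard lam)"

definition young_symmetrizer :: "nat \<Rightarrow> tableau \<Rightarrow> 'k::field_char_0 group_alg" where
  "young_symmetrizer n T =
     scalar (1 / h_const n (shape T))
     * (\<Sum>v \<in> row_stabilizer n T. basis_elem v)
     * (\<Sum>w \<in> column_stabilizer n T. of_int (sign (app_perm w)) * basis_elem w)"

text \<open>The value for \<open>n = 0\<close> is a dummy; seminormal idempotents start at \<open>n = 1\<close>.\<close>

fun seminormal :: "nat \<Rightarrow> tableau \<Rightarrow> 'k::field_char_0 group_alg" where
  "seminormal 0 T = 1"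
| "seminormal (Suc 0) T = 1"
| "seminormal (Suc (Suc m)) T =
     (let e = seminormal (Suc m) (remove_box (Suc (Suc m)) T)
      in e * young_symmetrizer (Suc (Suc m)) T * e)"

definition specht :: "nat \<Rightarrow> tableau \<Rightarrow> 'k::field_char_0 group_alg set" where
  "specht n T = {young_symmetrizer n T * a | a. a \<in> sym_alg n}"

definition central_idempotent :: "nat \<Rightarrow> 'k::field_char_0 group_alg \<Rightarrow> bool" where
  "central_idempotent n z \<longleftrightarrow> z \<in> sym_alg_center n \<and> z * z = z"

definition primitive_central_idempotent :: "nat \<Rightarrow> 'k::field_char_0 group_alg \<Rightarrow> bool" where
  "primitive_central_idempotent n z \<longleftrightarrow> central_idempotent n z \<and> z \<noteq> 0 \<and>
     (\<forall>x y. central_idempotent n x \<and> central_idempotent n y \<and> x * y = 0 \<and> z = x + y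
        \<longrightarrow> x = 0 \<or> y = 0)"

text \<open>
  The irreducible module indexed by \<open>mu\<close> is \<open>specht n S\<close> for any standard tableau \<open>S\<close> of shape
  \<open>mu\<close>; all these choices are isomorphic, so the conditions below are imposed on each of them.
\<close>

definition is_canonical_central :: "nat \<Rightarrow> nat list \<Rightarrow> 'k::field_char_0 group_alg \<Rightarrow> bool" where
  "is_canonical_central n lam z \<longleftrightarrow> primitive_central_idempotent n z \<and>
     (\<forall>S. standard n S \<and> shape S = lam \<longrightarrow> (\<forall>x \<in> specht n S. x * z = x)) \<and>
     (\<forall>mu S. mu \<turnstile>p n \<and> mu \<noteq> lam \<and> standard n S \<and> shape S = mu \<longrightarrow>
        (\<forall>x \<in> specht n S. x * z = 0))"

definition canonical_central :: "nat \<Rightarrow> nat list \<Rightarrow> 'k::field_char_0 group_alg" where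
  "canonical_central n lam = (THE z. is_canonical_central n lam z)"

definition canonical_idempotent :: "nat \<Rightarrow> tableau \<Rightarrow> 'k::field_char_0 group_alg" where
  "canonical_idempotent n T =
     prod_list (map (\<lambda>k. canonical_central k (shape (subtableau k T))) [1..<Suc n])"

end

theory Submission
  imports Defs Complex_Main "HOL-Library.Multiset"
begin

text \<open>
  Why the two families agree.  Both are indexed by paths in Young's lattice.  A seminormal idempotent is
  built by the recursion \<open>e * y * e\<close>, where \<open>e\<close> belongs to the tableau without its largest entry and
  \<open>y\<close> is the Young symmetrizer; a canonical idempotent is \<open>\<epsilon> * \<epsilon>(\<lambda>)\<close>, where \<open>\<epsilon>\<close> belongs to the shorter
  tableau.  If the seminormal idempotents of each size are orthogonal with sum \<open>1\<close>, and if
  \<open>\<epsilon>(\<lambda>)\<close> is the sum of those of shape \<open>\<lambda>\<close>, then \<open>e * \<epsilon>(\<lambda>)\<close> keeps exactly the paths of shape \<open>\<lambda>\<close> that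
  extend the shorter path.  There is one such path, so the two recursions coincide
  (\<open>path_idem_extend\<close>).

  The work lies in the two hypotheses, and it needs no representation theory beyond von Neumann's lemma
  (\<open>sandwich_young\<close>, \<open>shapes_differ\<close>): for row sums \<open>a\<close> and signed column sums \<open>b\<close>, the space
  \<open>a A b\<close> is a line when the two tableaux have the same shape, and one of \<open>a A b'\<close>, \<open>a' A b\<close>
  vanishes when their shapes differ.  Hence \<open>(a b)\<^sup>2 = \<kappa> a b\<close>, where \<open>\<kappa> \<noteq> 0\<close> because \<open>a b a\<close> is
  self-adjoint with integer coefficients.  That \<open>\<kappa>\<close> is the constant \<open>n! / n(\<lambda>)\<close> of the definition comes
  out only at the end, so the recursion is first studied with \<open>y = a b / \<kappa>\<close>, under the name
  \<open>path_idem\<close>.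

  The induction goes from \<open>n\<close> to \<open>n + 1\<close>.  The idempotent of a path \<open>S\<close> is killed by \<open>b\<close> on the left or
  by \<open>a\<close> on the right for every other tableau \<open>T\<close> (\<open>path_idem_triangular\<close>), because the shapes differ
  where the two paths first part.  Inserting \<open>1\<close>, written as the sum of the idempotents of size
  \<open>n\<close>, into \<open>y * y\<close> therefore leaves \<open>y * e * y = y\<close> (\<open>young_idem_absorb\<close>), and this makes the
  elements \<open>e * y * e\<close> orthogonal idempotents.  The same identity yields matrix units between idempotents
  of equal shape (\<open>path_idem_corner\<close>).  By the count of pairs of standard tableaux of equal shape
  (\<open>card_same_shape_pairs\<close>) there are as many matrix units as permutations, so they span, and the
  idempotents of size \<open>n + 1\<close> sum to \<open>1\<close> (\<open>path_system_Suc\<close>).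

  Finally the trace of left multiplication by one idempotent is \<open>(n + 1)! / \<kappa>\<close>, and it is also
  the number of standard tableaux of its shape (\<open>kappa_eq_h_const\<close>), which identifies \<open>\<kappa>\<close>.  The sum of the
  idempotents of shape \<open>\<lambda>\<close> is central because the corners between different shapes vanish, and primitive
  because the matrix units link equal shapes; it acts on the Specht modules as \<open>\<epsilon>(\<lambda>)\<close> should, and
  this action determines it (\<open>canonical_central_eq\<close>).
\<close>

section \<open>The group algebra\<close>

lemma app_perm_zero [simp]: "app_perm 0 = id"
  by transfer simp

lemma app_perm_plus [simp]: "app_perm (\<sigma> + \<tau>) = app_perm \<tau> \<circ> app_perm \<sigma>"
  by transfer simp

lemma app_perm_uminus [simp]: "app_perm (- \<sigma>) = inv (app_perm \<sigma>)"
  by transfer simp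

lemma permutation_app_perm [simp]: "permutation (app_perm \<sigma>)"
  using app_perm by simp

lemma bij_app_perm [simp]: "bij (app_perm \<sigma>)"
  by (simp add: permutation_bijective)

lemma app_perm_inv_cancel [simp]:
  "app_perm \<sigma> (inv (app_perm \<sigma>) x) = x" "inv (app_perm \<sigma>) (app_perm \<sigma> x) = x"
  by (simp_all add: bij_is_surj surj_f_inv_f bij_is_inj)

lemma app_perm_eq_iff [simp]: "app_perm \<sigma> x = app_perm \<sigma> y \<longleftrightarrow> x = y"
  by (metis app_perm_inv_cancel(2))

lemma sym_group_zero [simp]: "0 \<in> sym_group n"
  by (simp add: sym_group_def permutes_id)

lemma sym_group_plus [intro]: "\<sigma> \<in> sym_group n \<Longrightarrow> \<tau> \<in> sym_group n \<Longrightarrow> \<sigma> + \<tau> \<in> sym_group n"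
  by (simp add: sym_group_def permutes_compose)

lemma sym_group_uminus [simp]: "- \<sigma> \<in> sym_group n \<longleftrightarrow> \<sigma> \<in> sym_group n"
proof -
  have "\<sigma> \<in> sym_group n \<Longrightarrow> - \<sigma> \<in> sym_group n" for \<sigma>
    by (simp add: sym_group_def permutes_inv)
  from this[of \<sigma>] this[of "-\<sigma>"] show ?thesis by auto
qed

lemma sym_group_mono: "m \<le> n \<Longrightarrow> sym_group m \<subseteq> sym_group n"
  unfolding sym_group_def by (auto intro: permutes_subset)

lemma sym_group_app_mem: "\<sigma> \<in> sym_group n \<Longrightarrow> app_perm \<sigma> x \<in> {1..n} \<longleftrightarrow> x \<in> {1..n}"
  unfolding sym_group_def by (metis mem_Collect_eq permutes_in_image)

lemma bij_betw_app_perm: "bij_betw app_perm (sym_group n) {p. p permutes {1..n}}"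
proof (rule bij_betw_imageI)
  show "inj_on app_perm (sym_group n)" by (meson app_perm_inject inj_onI)
  have "p \<in> app_perm ` sym_group n" if "p permutes {1..n}" for p
  proof
    have "permutation p" using that permutation_permutes by blast
    then show "p = app_perm (Abs_finperm p)" by (simp add: Abs_finperm_inverse)
    then show "Abs_finperm p \<in> sym_group n" using that by (simp add: sym_group_def)
  qed
  then show "app_perm ` sym_group n = {p. p permutes {1..n}}"
    by (auto simp: sym_group_def)
qed

lemma finite_sym_group [simp]: "finite (sym_group n)"
  using bij_betw_finite[OF bij_betw_app_perm] finite_permutations by blast

lemma card_sym_group: "card (sym_group n) = fact n"
  using bij_betw_same_card[OF bij_betw_app_perm, of n] by (simp add: card_permutations)

lemma finperm_eq_zeroI:
  assumes "\<sigma> \<in> sym_group n" and "\<And>x. x \<in> {1..n} \<Longrightarrow> app_perm \<sigma> x = x"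
  shows "\<sigma> = 0"
proof -
  have "app_perm \<sigma> x = x" for x
    using assms unfolding sym_group_def by (cases "x \<in> {1..n}") (auto simp: permutes_def)
  then have "app_perm \<sigma> = app_perm 0" by auto
  then show ?thesis by (simp only: app_perm_inject)
qed

text \<open>On \<open>sym_alg n\<close>, left multiplication by \<open>x\<close> has trace \<open>n! * tau x\<close>; this is why \<open>tau\<close> is a trace form.\<close>

abbreviation tau :: "'k::field_char_0 group_alg \<Rightarrow> 'k" where
  "tau x \<equiv> Poly_Mapping.lookup x 0"

lemma lookup_single_mult:
  "Poly_Mapping.lookup (Poly_Mapping.single g c * x) k = c * Poly_Mapping.lookup x (- g + k)"
  for x :: "'k::field_char_0 group_alg"
proof -
  have *: "(k = g + q) = (q = - g + k)" for q
    by (metis add.assoc add.left_neutral left_minus right_minus)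
  show ?thesis
    unfolding lookup_mult lookup_single when_mult by (simp add: *)
qed

lemma lookup_mult_single:
  "Poly_Mapping.lookup (x * Poly_Mapping.single g c) k = Poly_Mapping.lookup x (k - g) * c"
  for x :: "'k::field_char_0 group_alg"
proof -
  have *: "(k = l + g) = (l = k - g)" for l
    by (metis add_diff_cancel diff_add_cancel)
  have "(\<Sum>q. (c when g = q) when k = l + q) = (c when l = k - g)" for l
  proof -
    have "(\<Sum>q. (c when g = q) when k = l + q) = (\<Sum>q. (c when k = l + q) when g = q)"
      by (simp add: when_commute)
    then show ?thesis by (simp add: *)
  qed
  then show ?thesis
    unfolding lookup_mult lookup_single by (simp add: mult_when)
qed

lemma lookup_scalar_mult [simp]: "Poly_Mapping.lookup (scalar c * x) g = c * Poly_Mapping.lookup x g"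
  by (simp add: lookup_single_mult)

lemma scalar_commute: "x * scalar c = scalar c * x"
  by (rule poly_mapping_eqI) (simp add: lookup_mult_single mult.commute)

lemma scalar_left_commute: "x * (scalar c * y) = scalar c * (x * y)"
  by (metis mult.assoc scalar_commute)

lemma scalar_mult_assoc: "scalar c * (scalar d * x) = scalar (c * d) * x"
  by (simp add: mult_single flip: mult.assoc)

lemma scalar_one [simp]: "scalar 1 = 1"
  by (rule single_one)

lemma scalar_sum: "scalar (sum f I) = (\<Sum>i\<in>I. scalar (f i))"
  by (induction I rule: infinite_finite_induct) (simp_all add: single_add)

lemma basis_mult: "basis_elem g * basis_elem h = basis_elem (g + h)"
  by (simp add: mult_single)

lemma scalar_cancel_left: "c \<noteq> 0 \<Longrightarrow> scalar c * x = scalar c * y \<Longrightarrow> x = y"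
  by (metis left_inverse mult_1 scalar_mult_assoc scalar_one)

lemma tau_mult: "tau (x * y) = (\<Sum>g\<in>Poly_Mapping.keys y. Poly_Mapping.lookup x (- g) * Poly_Mapping.lookup y g)"
proof -
  have "y = (\<Sum>g\<in>Poly_Mapping.keys y. Poly_Mapping.single g (Poly_Mapping.lookup y g))"
    by (rule poly_mapping_eqI)
      (simp add: lookup_sum lookup_single when_def in_keys_iff)
  then have "x * y = (\<Sum>g\<in>Poly_Mapping.keys y. x * Poly_Mapping.single g (Poly_Mapping.lookup y g))"
    by (metis sum_distrib_left)
  then show ?thesis by (simp add: lookup_sum lookup_mult_single)
qed

lemma sym_alg_expand:
  assumes "x \<in> sym_alg n"
  shows "x = (\<Sum>g\<in>sym_group n. scalar (Poly_Mapping.lookup x g) * basis_elem g)"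
  using assms
  by (intro poly_mapping_eqI)
    (auto simp: lookup_sum lookup_single when_def sym_alg_def subset_iff in_keys_iff
      if_distrib[of "\<lambda>c. _ * c"] cong: if_cong)

lemma sym_alg_0 [simp]: "0 \<in> sym_alg n"
  by (simp add: sym_alg_def)

lemma sym_alg_1 [simp]: "1 \<in> sym_alg n"
  by (simp add: sym_alg_def)

lemma sym_alg_add [intro]: "x \<in> sym_alg n \<Longrightarrow> y \<in> sym_alg n \<Longrightarrow> x + y \<in> sym_alg n"
  unfolding sym_alg_def using keys_add[of x y] by auto

lemma sym_alg_mult [intro]: "x \<in> sym_alg n \<Longrightarrow> y \<in> sym_alg n \<Longrightarrow> x * y \<in> sym_alg n"
  unfolding sym_alg_def using keys_mult[of x y] by blast

lemma sym_alg_basis [intro]: "g \<in> sym_group n \<Longrightarrow> basis_elem g \<in> sym_alg n"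
  by (simp add: sym_alg_def)

lemma sym_alg_scalar [simp]: "scalar c \<in> sym_alg n"
  by (simp add: sym_alg_def)

lemma sym_alg_sum [intro]: "(\<And>i. i \<in> I \<Longrightarrow> f i \<in> sym_alg n) \<Longrightarrow> sum f I \<in> sym_alg n"
  by (induction I rule: infinite_finite_induct) auto

lemma sym_alg_mono: "m \<le> n \<Longrightarrow> x \<in> sym_alg m \<Longrightarrow> x \<in> sym_alg n"
  unfolding sym_alg_def using sym_group_mono[of m n] by blast

lemma tau_commute: "tau (x * y) = tau (y * x)"
proof -
  have "tau (x * y) = (\<Sum>g\<in>Poly_Mapping.keys y. Poly_Mapping.lookup x (- g) * Poly_Mapping.lookup y g)"
    by (rule tau_mult)
  also have "\<dots> = (\<Sum>g\<in>uminus ` Poly_Mapping.keys y. Poly_Mapping.lookup x g * Poly_Mapping.lookup y (- g))"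
    by (subst sum.reindex) (auto simp: inj_on_def)
  also have "\<dots> = (\<Sum>g\<in>Poly_Mapping.keys x. Poly_Mapping.lookup x g * Poly_Mapping.lookup y (- g))"
  proof (rule sum.mono_neutral_cong)
    fix g assume "g \<in> Poly_Mapping.keys x - uminus ` Poly_Mapping.keys y"
    then have "- g \<notin> Poly_Mapping.keys y" by (metis DiffD2 image_eqI minus_minus)
    then show "Poly_Mapping.lookup x g * Poly_Mapping.lookup y (- g) = 0"
      by (simp add: in_keys_iff)
  qed (auto simp: in_keys_iff)
  also have "\<dots> = tau (y * x)"
    by (simp add: tau_mult mult.commute)
  finally show ?thesis .
qed

lemma lookup_eq_tau: "Poly_Mapping.lookup x g = tau (basis_elem (- g) * x)"
  by (simp add: lookup_single_mult)

lemma tau_sum_basis: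
  assumes "x \<in> sym_alg n"
  shows "tau (y * x) = (\<Sum>g\<in>sym_group n. tau (y * basis_elem g) * Poly_Mapping.lookup x g)"
proof -
  have "tau (y * x) = tau (\<Sum>g\<in>sym_group n. scalar (Poly_Mapping.lookup x g) * (y * basis_elem g))"
    by (subst sym_alg_expand[OF assms])
      (simp only: sum_distrib_left scalar_left_commute)
  then show ?thesis by (simp only: lookup_sum lookup_scalar_mult mult.commute)
qed

text \<open>The map \<open>x \<mapsto> p * x * q\<close> is linear, so it has rank at most one, with an explicit coefficient
  functional, as soon as it has this form on permutations.\<close>

lemma sandwich_extend:
  assumes x: "x \<in> sym_alg n"
    and basis: "\<And>g. g \<in> sym_group n \<Longrightarrow> p * basis_elem g * q = scalar (tau (r * basis_elem g)) * w"
  shows "p * x * q = scalar (tau (r * x)) * w"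
proof -
  have "p * x * q = (\<Sum>g\<in>sym_group n. scalar (Poly_Mapping.lookup x g) * (p * basis_elem g * q))"
    by (subst sym_alg_expand[OF x])
      (simp only: sum_distrib_left sum_distrib_right scalar_left_commute mult.assoc)
  also have "\<dots> = (\<Sum>g\<in>sym_group n. scalar (tau (r * basis_elem g) * Poly_Mapping.lookup x g) * w)"
    by (intro sum.cong) (simp_all only: basis scalar_mult_assoc mult.commute)
  also have "\<dots> = scalar (tau (r * x)) * w"
    by (simp only: tau_sum_basis[OF x] scalar_sum sum_distrib_right)
  finally show ?thesis .
qed

lemma sandwich_zero:
  assumes x: "x \<in> sym_alg n"
    and basis: "\<And>g. g \<in> sym_group n \<Longrightarrow> p * basis_elem g * q = 0"
  shows "p * x * q = 0"
  using sandwich_extend[OF x, of p q 0 0] basis by simp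

section \<open>The standard involution\<close>

text \<open>Inversion extends to an anti-automorphism for which \<open>tau (x * star x)\<close> is the sum of the squares of
  the coefficients of \<open>x\<close>.\<close>

definition star :: "'k::field_char_0 group_alg \<Rightarrow> 'k group_alg" where
  "star x = Poly_Mapping.map_key uminus x"

lemma lookup_star [simp]: "Poly_Mapping.lookup (star x) g = Poly_Mapping.lookup x (- g)"
  unfolding star_def by (subst map_key.rep_eq) (simp_all add: inj_def)

lemma star_mult: "star (x * y) = star y * star x"
proof (rule poly_mapping_eqI)
  fix k
  have "Poly_Mapping.lookup (star (x * y)) k = tau (basis_elem k * x * y)"
    by (simp add: lookup_eq_tau[of "x * y"] mult.assoc)
  also have "\<dots> = (\<Sum>g\<in>Poly_Mapping.keys y. Poly_Mapping.lookup x (- k - g) * Poly_Mapping.lookup y g)"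
    by (simp add: tau_mult lookup_single_mult)
  also have "\<dots> = (\<Sum>g\<in>Poly_Mapping.keys y. Poly_Mapping.lookup (star x) (g + k) * Poly_Mapping.lookup y g)"
    by (simp add: minus_add)
  finally have 1: "Poly_Mapping.lookup (star (x * y)) k = \<dots>" .
  have "Poly_Mapping.lookup (star y * star x) k = tau ((basis_elem (- k) * star y) * star x)"
    by (simp add: lookup_eq_tau[of "star y * star x"] mult.assoc)
  also have "\<dots> = tau (star x * basis_elem (- k) * star y)"
    by (subst tau_commute) (simp add: mult.assoc)
  also have "\<dots> = (\<Sum>g\<in>Poly_Mapping.keys (star y). Poly_Mapping.lookup (star x) (- g + k) * Poly_Mapping.lookup y (- g))"
    by (simp add: tau_mult lookup_mult_single)
  also have "Poly_Mapping.keys (star y) = uminus ` Poly_Mapping.keys y"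
    by (auto simp: in_keys_iff image_iff) (metis in_keys_iff minus_minus)
  also have "(\<Sum>g\<in>\<dots>. Poly_Mapping.lookup (star x) (- g + k) * Poly_Mapping.lookup y (- g))
     = (\<Sum>g\<in>Poly_Mapping.keys y. Poly_Mapping.lookup (star x) (g + k) * Poly_Mapping.lookup y g)"
    by (subst sum.reindex) (auto simp: inj_on_def)
  finally show "Poly_Mapping.lookup (star (x * y)) k = Poly_Mapping.lookup (star y * star x) k"
    using 1 by simp
qed

lemma star_zero [simp]: "star 0 = 0"
  by (rule poly_mapping_eqI) simp

lemma star_basis [simp]: "star (basis_elem g) = basis_elem (- g)"
  by (rule poly_mapping_eqI) (auto simp: lookup_single when_def)

text \<open>The coefficients lie in a field without an order; a sum of squares can be estimated only because it is
  the image of a sum of squares of integers.\<close>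

lemma self_adjoint_square_zero:
  assumes int: "\<And>g. Poly_Mapping.lookup x g \<in> \<int>" and adj: "star x = x" and sq: "x * x = 0"
  shows "x = 0"
proof -
  obtain m where m: "\<And>g. Poly_Mapping.lookup x g = of_int (m g)"
    using int unfolding Ints_def image_iff by metis
  have "Poly_Mapping.lookup x (- g) = Poly_Mapping.lookup x g" for g
    by (metis adj lookup_star)
  then have "tau (x * x) = (\<Sum>g\<in>Poly_Mapping.keys x. of_int (m g) * of_int (m g))"
    by (simp add: tau_mult m)
  then have "(of_int (\<Sum>g\<in>Poly_Mapping.keys x. m g * m g) :: 'a) = 0"
    using sq by simp
  then have "(\<Sum>g\<in>Poly_Mapping.keys x. m g * m g) = 0"
    by (simp only: of_int_eq_0_iff)
  then have "\<forall>g\<in>Poly_Mapping.keys x. m g * m g = 0"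
    by (subst (asm) sum_nonneg_eq_0_iff) auto
  then have "Poly_Mapping.keys x = {}"
    using m by (auto simp: in_keys_iff simp del: keys_eq_empty)
  then show ?thesis by simp
qed

definition integer_coeffs :: "'k::field_char_0 group_alg \<Rightarrow> bool" where
  "integer_coeffs x \<longleftrightarrow> (\<forall>g. Poly_Mapping.lookup x g \<in> \<int>)"

lemma integer_coeffs_mult: "integer_coeffs x \<Longrightarrow> integer_coeffs y \<Longrightarrow> integer_coeffs (x * y)"
  unfolding integer_coeffs_def
  by (subst lookup_eq_tau, subst mult.assoc[symmetric], subst tau_mult)
    (auto intro!: Ints_sum Ints_mult simp: lookup_single_mult)

section \<open>Stabilizer sums\<close>

definition fiber_stab :: "nat \<Rightarrow> (nat \<Rightarrow> nat) \<Rightarrow> finperm set" where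
  "fiber_stab n f = {\<sigma> \<in> sym_group n. \<forall>x\<in>{1..n}. f (app_perm \<sigma> x) = f x}"

text \<open>The row sum and the signed column sum of a tableau are the sums of a \<open>\<plusminus>1\<close>-valued character over the
  stabilizer of a labelling of \<open>{1..n}\<close>, by row numbers and by column numbers.  One proof then serves both.\<close>

definition sign_character :: "(finperm \<Rightarrow> int) \<Rightarrow> bool" where
  "sign_character \<chi> \<longleftrightarrow> (\<forall>\<sigma> \<tau>. \<chi> (\<sigma> + \<tau>) = \<chi> \<sigma> * \<chi> \<tau>) \<and> (\<forall>\<sigma>. \<chi> \<sigma> * \<chi> \<sigma> = 1)"

definition twisted_sum :: "(finperm \<Rightarrow> int) \<Rightarrow> nat \<Rightarrow> (nat \<Rightarrow> nat) \<Rightarrow> 'k::field_char_0 group_alg" where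
  "twisted_sum \<chi> n f = (\<Sum>\<sigma>\<in>fiber_stab n f. Poly_Mapping.single \<sigma> (of_int (\<chi> \<sigma>)))"

definition perm_sign :: "finperm \<Rightarrow> int" where
  "perm_sign \<sigma> = sign (app_perm \<sigma>)"

abbreviation row_sum :: "nat \<Rightarrow> (nat \<Rightarrow> nat) \<Rightarrow> 'k::field_char_0 group_alg" where
  "row_sum \<equiv> twisted_sum (\<lambda>_. 1)"

abbreviation col_sum :: "nat \<Rightarrow> (nat \<Rightarrow> nat) \<Rightarrow> 'k::field_char_0 group_alg" where
  "col_sum \<equiv> twisted_sum perm_sign"

lemma sign_character_one: "sign_character (\<lambda>_. 1)"
  by (simp add: sign_character_def)

lemma sign_character_perm_sign: "sign_character perm_sign"
  by (simp add: sign_character_def perm_sign_def sign_compose mult.commute)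

lemma sign_character_zero: "sign_character \<chi> \<Longrightarrow> \<chi> 0 = 1"
  unfolding sign_character_def by (metis add.right_neutral)

lemma sign_character_uminus: "sign_character \<chi> \<Longrightarrow> \<chi> (- \<sigma>) = \<chi> \<sigma>"
  unfolding sign_character_def
  by (metis add.right_neutral left_minus mult.assoc mult.commute mult_1)

lemma fiber_stab_subset: "fiber_stab n f \<subseteq> sym_group n"
  by (auto simp: fiber_stab_def)

lemma finite_fiber_stab [simp]: "finite (fiber_stab n f)"
  using finite_subset[OF fiber_stab_subset] by simp

lemma fiber_stab_zero [simp]: "0 \<in> fiber_stab n f"
  by (simp add: fiber_stab_def)

lemma fiber_stab_plus: "\<sigma> \<in> fiber_stab n f \<Longrightarrow> \<tau> \<in> fiber_stab n f \<Longrightarrow> \<sigma> + \<tau> \<in> fiber_stab n f"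
  unfolding fiber_stab_def using sym_group_app_mem by auto

lemma fiber_stab_uminus: "\<sigma> \<in> fiber_stab n f \<Longrightarrow> - \<sigma> \<in> fiber_stab n f"
proof -
  assume \<sigma>: "\<sigma> \<in> fiber_stab n f"
  have "f (inv (app_perm \<sigma>) x) = f x" if "x \<in> {1..n}" for x
  proof -
    have "inv (app_perm \<sigma>) x \<in> {1..n}"
      using \<sigma> that sym_group_app_mem[of "- \<sigma>" n x] by (auto simp: fiber_stab_def)
    then have "f (app_perm \<sigma> (inv (app_perm \<sigma>) x)) = f (inv (app_perm \<sigma>) x)"
      using \<sigma> unfolding fiber_stab_def by blast
    then show ?thesis by simp
  qed
  then show ?thesis using \<sigma> by (auto simp: fiber_stab_def)
qed

lemma fiber_stab_plus_iff:
  assumes "\<tau> \<in> fiber_stab n f"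
  shows "\<sigma> - \<tau> \<in> fiber_stab n f \<longleftrightarrow> \<sigma> \<in> fiber_stab n f"
    and "- \<tau> + \<sigma> \<in> fiber_stab n f \<longleftrightarrow> \<sigma> \<in> fiber_stab n f"
  using assms fiber_stab_plus[of _ n f] fiber_stab_uminus[of _ n f]
  by (metis diff_add_cancel diff_conv_add_uminus, metis add_minus_cancel)

lemma lookup_twisted_sum:
  "Poly_Mapping.lookup (twisted_sum \<chi> n f) g = (if g \<in> fiber_stab n f then of_int (\<chi> g) else 0)"
  by (simp add: twisted_sum_def lookup_sum lookup_single when_def)

lemma twisted_sum_sym_alg [simp]: "twisted_sum \<chi> n f \<in> sym_alg n"
  by (auto simp: sym_alg_def in_keys_iff lookup_twisted_sum fiber_stab_def split: if_splits)

lemma twisted_sum_right: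
  assumes "sign_character \<chi>" and "\<tau> \<in> fiber_stab n f"
  shows "twisted_sum \<chi> n f * basis_elem \<tau> = scalar (of_int (\<chi> \<tau>)) * twisted_sum \<chi> n f"
proof (rule poly_mapping_eqI)
  fix k
  have "\<chi> (k - \<tau>) = \<chi> \<tau> * \<chi> k"
    using assms(1) sign_character_uminus[OF assms(1), of \<tau>]
    by (metis diff_conv_add_uminus mult.commute sign_character_def)
  then show "Poly_Mapping.lookup (twisted_sum \<chi> n f * basis_elem \<tau>) k =
      Poly_Mapping.lookup (scalar (of_int (\<chi> \<tau>)) * twisted_sum \<chi> n f) k"
    unfolding lookup_scalar_mult
    by (simp add: lookup_mult_single lookup_twisted_sum fiber_stab_plus_iff[OF assms(2)])
qed

lemma star_twisted_sum:
  assumes "sign_character \<chi>"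
  shows "star (twisted_sum \<chi> n f) = twisted_sum \<chi> n f"
proof (rule poly_mapping_eqI)
  fix k
  have "- k \<in> fiber_stab n f \<longleftrightarrow> k \<in> fiber_stab n f"
    using fiber_stab_uminus[of k] fiber_stab_uminus[of "- k"] by auto
  then show "Poly_Mapping.lookup (star (twisted_sum \<chi> n f)) k = Poly_Mapping.lookup (twisted_sum \<chi> n f) k"
    by (simp add: lookup_twisted_sum sign_character_uminus[OF assms])
qed

lemma twisted_sum_left:
  assumes "sign_character \<chi>" and "\<tau> \<in> fiber_stab n f"
  shows "basis_elem \<tau> * twisted_sum \<chi> n f = scalar (of_int (\<chi> \<tau>)) * twisted_sum \<chi> n f"
proof -
  have "basis_elem \<tau> * twisted_sum \<chi> n f = star (twisted_sum \<chi> n f * basis_elem (- \<tau>))"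
    by (simp add: star_mult star_twisted_sum[OF assms(1)])
  also have "\<dots> = star (scalar (of_int (\<chi> \<tau>)) * twisted_sum \<chi> n f)"
    by (simp only: twisted_sum_right[OF assms(1) fiber_stab_uminus[OF assms(2)]] sign_character_uminus[OF assms(1)])
  also have "\<dots> = scalar (of_int (\<chi> \<tau>)) * twisted_sum \<chi> n f"
    by (rule poly_mapping_eqI, simp only: lookup_star lookup_scalar_mult)
       (metis lookup_star star_twisted_sum[OF assms(1)])
  finally show ?thesis .
qed

text \<open>Each element of the smaller stabilizer is absorbed up to its sign, and the two signs cancel.\<close>

lemma twisted_sum_absorb:
  assumes \<chi>: "sign_character \<chi>" and sub: "fiber_stab m f' \<subseteq> fiber_stab n f"
  shows "(twisted_sum \<chi> n f :: 'k::field_char_0 group_alg) * twisted_sum \<chi> m f' = scalar (of_nat (card (fiber_stab m f'))) * twisted_sum \<chi> n f"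
    and "(twisted_sum \<chi> m f' :: 'k group_alg) * twisted_sum \<chi> n f = scalar (of_nat (card (fiber_stab m f'))) * twisted_sum \<chi> n f"
proof -
  have sq: "(of_int (\<chi> \<sigma>) :: 'k) * of_int (\<chi> \<sigma>) = 1" for \<sigma>
    using \<chi> by (metis of_int_1 of_int_mult sign_character_def)
  have expand: "(twisted_sum \<chi> m f' :: 'k group_alg) =
      (\<Sum>\<sigma>\<in>fiber_stab m f'. scalar (of_int (\<chi> \<sigma>)) * basis_elem \<sigma>)"
    by (simp add: twisted_sum_def mult_single del: single_of_int)
  have "(twisted_sum \<chi> n f :: 'k group_alg) * twisted_sum \<chi> m f' =
      (\<Sum>\<sigma>\<in>fiber_stab m f'. scalar (of_int (\<chi> \<sigma>)) * (twisted_sum \<chi> n f * basis_elem \<sigma>))"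
    by (simp only: expand sum_distrib_left scalar_left_commute)
  also have "\<dots> = (\<Sum>\<sigma>\<in>fiber_stab m f'. twisted_sum \<chi> n f)"
    using sub by (intro sum.cong refl)
      (simp only: twisted_sum_right[OF \<chi>] subset_iff scalar_mult_assoc sq scalar_one mult_1)
  finally show 1: "(twisted_sum \<chi> n f :: 'k group_alg) * twisted_sum \<chi> m f' =
      scalar (of_nat (card (fiber_stab m f'))) * twisted_sum \<chi> n f" by simp
  have "(twisted_sum \<chi> m f' :: 'k group_alg) * twisted_sum \<chi> n f = star (twisted_sum \<chi> n f * twisted_sum \<chi> m f')"
    by (simp add: star_mult star_twisted_sum[OF \<chi>])
  also have "\<dots> = scalar (of_nat (card (fiber_stab m f'))) * twisted_sum \<chi> n f"
    unfolding 1
    by (rule poly_mapping_eqI, simp only: lookup_star lookup_scalar_mult)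
       (metis lookup_star star_twisted_sum[OF \<chi>])
  finally show "(twisted_sum \<chi> m f' :: 'k group_alg) * twisted_sum \<chi> n f =
      scalar (of_nat (card (fiber_stab m f'))) * twisted_sum \<chi> n f" .
qed

text \<open>A permutation carrying one labelling to the other conjugates the two stabilizers into each other.\<close>

lemma twisted_sum_conjugate:
  assumes \<chi>: "sign_character \<chi>" and \<sigma>: "\<sigma> \<in> sym_group n"
    and f: "\<And>x. x \<in> {1..n} \<Longrightarrow> f' x = f (app_perm \<sigma> x)"
  shows "twisted_sum \<chi> n f' * basis_elem \<sigma> = basis_elem \<sigma> * twisted_sum \<chi> n f"
proof (rule poly_mapping_eqI)
  fix k
  let ?u = "k - \<sigma>" and ?v = "- \<sigma> + k"
  have uv: "?u = \<sigma> + ?v - \<sigma>" by simp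
  have mem: "?u \<in> sym_group n \<longleftrightarrow> ?v \<in> sym_group n"
  proof
    assume "?u \<in> sym_group n"
    from sym_group_plus[OF sym_group_plus[OF _ this] \<sigma>, of "- \<sigma>"]
    have "- \<sigma> + ?u + \<sigma> \<in> sym_group n" using \<sigma> by simp
    then show "?v \<in> sym_group n" by (simp add: add.assoc)
  next
    assume "?v \<in> sym_group n"
    from sym_group_plus[OF sym_group_plus[OF \<sigma> this], of "- \<sigma>"]
    have "\<sigma> + ?v + - \<sigma> \<in> sym_group n" using \<sigma> by simp
    then show "?u \<in> sym_group n" by simp
  qed
  have "(\<forall>x\<in>{1..n}. f' (app_perm ?u x) = f' x) \<longleftrightarrow> (\<forall>y\<in>{1..n}. f (app_perm ?v y) = f y)"
    if v: "?v \<in> sym_group n"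
  proof -
    have u: "?u \<in> sym_group n" using v mem by simp
    have comp: "app_perm \<sigma> (app_perm ?u x) = app_perm ?v (app_perm \<sigma> x)" for x
    proof -
      have "?u + \<sigma> = \<sigma> + ?v" by simp
      then have "app_perm (?u + \<sigma>) x = app_perm (\<sigma> + ?v) x" by (rule arg_cong)
      then show ?thesis unfolding app_perm_plus comp_def .
    qed
    have "f' (app_perm ?u x) = f' x \<longleftrightarrow> f (app_perm ?v (app_perm \<sigma> x)) = f (app_perm \<sigma> x)"
      if "x \<in> {1..n}" for x
      using f[OF that] f[of "app_perm ?u x"] sym_group_app_mem[OF u] that comp by simp
    then have "(\<forall>x\<in>{1..n}. f' (app_perm ?u x) = f' x) \<longleftrightarrow>
        (\<forall>x\<in>{1..n}. f (app_perm ?v (app_perm \<sigma> x)) = f (app_perm \<sigma> x))" by auto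
    also have "\<dots> \<longleftrightarrow> (\<forall>y\<in>app_perm \<sigma> ` {1..n}. f (app_perm ?v y) = f y)" by simp
    also have "app_perm \<sigma> ` {1..n} = {1..n}"
      using \<sigma> permutes_image by (auto simp: sym_group_def)
    finally show ?thesis .
  qed
  then have "?u \<in> fiber_stab n f' \<longleftrightarrow> ?v \<in> fiber_stab n f"
    using mem by (auto simp: fiber_stab_def)
  moreover have "\<chi> ?u = \<chi> ?v"
  proof -
    have "\<chi> ?u = \<chi> k * \<chi> \<sigma>" "\<chi> ?v = \<chi> \<sigma> * \<chi> k"
      using \<chi> sign_character_uminus[OF \<chi>] unfolding sign_character_def diff_conv_add_uminus by metis+
    then show ?thesis by simp
  qed
  ultimately show "Poly_Mapping.lookup (twisted_sum \<chi> n f' * basis_elem \<sigma>) k =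
      Poly_Mapping.lookup (basis_elem \<sigma> * twisted_sum \<chi> n f) k"
    by (simp add: lookup_mult_single lookup_single_mult lookup_twisted_sum)
qed

lemma integer_coeffs_twisted_sum: "integer_coeffs (twisted_sum \<chi> n f)"
  by (simp add: integer_coeffs_def lookup_twisted_sum)

lemma tau_twisted_sum: "sign_character \<chi> \<Longrightarrow> tau (twisted_sum \<chi> n f) = 1"
  by (simp add: lookup_twisted_sum sign_character_zero)

section \<open>Fillings and von Neumann's sandwich lemma\<close>

text \<open>A tableau is treated as a pair of labellings that maps \<open>{1..n}\<close> bijectively onto a Young diagram; \<open>lam\<close>
  gives the row lengths.  This makes it easy to replace the column labels alone.\<close>

definition filling :: "nat \<Rightarrow> (nat \<Rightarrow> nat) \<Rightarrow> (nat \<Rightarrow> nat) \<Rightarrow> (nat \<Rightarrow> nat) \<Rightarrow> bool" where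
  "filling n r c lam \<longleftrightarrow> bij_betw (\<lambda>x. (r x, c x)) {1..n} {(i, j). j < lam i}"

definition young_elem :: "nat \<Rightarrow> (nat \<Rightarrow> nat) \<Rightarrow> (nat \<Rightarrow> nat) \<Rightarrow> 'k::field_char_0 group_alg" where
  "young_elem n r c = row_sum n r * col_sum n c"

lemma young_elem_sym_alg [simp]: "young_elem n r c \<in> sym_alg n"
  by (auto simp: young_elem_def)

text \<open>The transposition of \<open>x\<close> and \<open>y\<close> is absorbed by the row sum, while its conjugate under \<open>g\<close> changes the
  sign of the column sum, so the product equals its own negative.\<close>

lemma collision_zero:
  assumes g: "g \<in> sym_group n" and xy: "x \<in> {1..n}" "y \<in> {1..n}" "x \<noteq> y" "r x = r y"
    and c: "c (app_perm g x) = c (app_perm g y)"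
  shows "row_sum n r * basis_elem g * col_sum n c = (0 :: 'k::field_char_0 group_alg)"
proof -
  define swap where "swap = (\<lambda>u v. Abs_finperm (transpose u v))"
  have app_swap [simp]: "app_perm (swap u v) = transpose u v" for u v
    by (simp add: swap_def Abs_finperm_inverse permutation_swap_id)
  have swap_stab: "swap u v \<in> fiber_stab n f" if "u \<in> {1..n}" "v \<in> {1..n}" "f u = f v" for u v f
    using that by (auto simp: fiber_stab_def sym_group_def permutes_swap_id transpose_def)
  let ?t = "swap x y" and ?t' = "swap (app_perm g x) (app_perm g y)"
  have "app_perm (?t + g) z = app_perm (g + ?t') z" for z
    by (auto simp: transpose_def)
  then have "app_perm (?t + g) = app_perm (g + ?t')" by (rule ext)
  then have conj: "basis_elem ?t * basis_elem g = (basis_elem g * basis_elem ?t' :: 'k group_alg)"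
    by (simp only: app_perm_inject basis_mult)
  have t: "?t \<in> fiber_stab n r" and t': "?t' \<in> fiber_stab n c"
    using xy c sym_group_app_mem[OF g] by (metis swap_stab)+
  have perm_sign: "perm_sign ?t' = - 1" using xy unfolding perm_sign_def app_swap sign_swap_id by (simp only: app_perm_eq_iff if_False)
  have b: "basis_elem ?t' * col_sum n c = scalar (- 1) * (col_sum n c :: 'k group_alg)"
    by (simp only: twisted_sum_left[OF sign_character_perm_sign t'] perm_sign of_int_minus of_int_1)
  have a: "row_sum n r * basis_elem ?t = (row_sum n r :: 'k group_alg)"
    by (simp only: twisted_sum_right[OF sign_character_one t] of_int_1 scalar_one mult_1)
  let ?z = "row_sum n r * basis_elem g * col_sum n c :: 'k group_alg"
  have "?z = row_sum n r * basis_elem ?t * basis_elem g * col_sum n c"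
    by (simp only: a)
  also have "\<dots> = row_sum n r * basis_elem g * (basis_elem ?t' * col_sum n c)"
  proof -
    have "row_sum n r * basis_elem ?t * basis_elem g * col_sum n c =
        row_sum n r * (basis_elem ?t * basis_elem g) * (col_sum n c :: 'k group_alg)"
      by (simp only: mult.assoc)
    then show ?thesis by (simp only: conj mult.assoc)
  qed
  also have "\<dots> = scalar (- 1) * ?z"
    by (simp only: b scalar_left_commute)
  finally have "Poly_Mapping.lookup ?z k = - Poly_Mapping.lookup ?z k" for k
    by (metis lookup_scalar_mult mult_minus1)
  then have "Poly_Mapping.lookup ?z k = 0" for k
    by (metis add_eq_0_iff double_zero mult_2 mult_eq_0_iff zero_neq_numeral)
  then show ?thesis by (intro poly_mapping_eqI) simp
qed

lemma filling_image: "filling n r c lam \<Longrightarrow> (\<lambda>x. (r x, c x)) ` {1..n} = {(i, j). j < lam i}"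
  unfolding filling_def by (rule bij_betw_imp_surj_on)

lemma filling_inj:
  assumes "filling n r c lam" "x \<in> {1..n}" "y \<in> {1..n}" "r x = r y" "c x = c y"
  shows "x = y"
  by (rule inj_onD[OF bij_betw_imp_inj_on[OF assms(1)[unfolded filling_def]]])
    (simp only: assms(2-5))+

lemma filling_less:
  assumes "filling n r c lam" "x \<in> {1..n}"
  shows "c x < lam (r x)"
proof -
  have "(r x, c x) \<in> {(i, j). j < lam i}"
    unfolding filling_image[OF assms(1), symmetric] using assms(2) by (rule imageI)
  then show ?thesis by simp
qed

lemma filling_surj:
  assumes "filling n r c lam" "j < lam i"
  shows "\<exists>x\<in>{1..n}. r x = i \<and> c x = j"
proof -
  have "(i, j) \<in> (\<lambda>x. (r x, c x)) ` {1..n}"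
    by (subst filling_image[OF assms(1)]) (simp add: assms(2))
  then obtain x where "(i, j) = (r x, c x)" "x \<in> {1..n}" by (rule imageE)
  then show ?thesis by (intro bexI[of _ x]) simp_all
qed

lemma filling_card_cell:
  assumes fill: "filling n r c lam"
  shows "card {x \<in> {1..n}. r x = i \<and> c x < m} = min (lam i) m"
proof -
  have "bij_betw c {x \<in> {1..n}. r x = i \<and> c x < m} {..<min (lam i) m}"
  proof (rule bij_betw_imageI)
    show "inj_on c {x \<in> {1..n}. r x = i \<and> c x < m}"
      by (rule inj_onI) (rule filling_inj[OF fill], simp_all)
    show "c ` {x \<in> {1..n}. r x = i \<and> c x < m} = {..<min (lam i) m}"
    proof (intro equalityI subsetI)
      fix j assume "j \<in> c ` {x \<in> {1..n}. r x = i \<and> c x < m}"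
      then obtain x where "x \<in> {1..n}" "r x = i" "c x = j" "j < m" by blast
      then show "j \<in> {..<min (lam i) m}" using filling_less[OF fill, of x] by simp
    next
      fix j assume j: "j \<in> {..<min (lam i) m}"
      then have "j < lam i" "j < m" by simp_all
      then obtain x where "x \<in> {1..n}" "r x = i" "c x = j" "c x < m"
        using filling_surj[OF fill, of j i] by metis
      then show "j \<in> c ` {x \<in> {1..n}. r x = i \<and> c x < m}" by blast
    qed
  qed
  from bij_betw_same_card[OF this] show ?thesis by simp
qed

lemma card_fibers:
  assumes "finite A"
  shows "card {x \<in> A. P x} = (\<Sum>i\<in>r ` A. card {x \<in> A. r x = i \<and> P x})"
proof -
  have "card {x \<in> A. P x} = (\<Sum>i\<in>r ` A. card {x \<in> {x \<in> A. P x}. r x = i})"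
    using sum.group[of "{x \<in> A. P x}" "r ` A" r "\<lambda>_. 1::nat"] assms
    by (simp add: image_mono)
  also have "\<dots> = (\<Sum>i\<in>r ` A. card {x \<in> A. r x = i \<and> P x})"
    by (intro sum.cong refl arg_cong[where f = card]) blast
  finally show ?thesis .
qed

text \<open>Column labels without repetition inside row \<open>i\<close> put at most \<open>min (lam i) m\<close> labels below \<open>m\<close> into that row,
  and the labels of the filling attain this bound.\<close>

lemma relabelling_card_cell_le:
  assumes fill: "filling n r c lam" and inj: "inj_on (\<lambda>x. (r x, c' x)) {1..n}"
  shows "card {x \<in> {1..n}. r x = i \<and> c' x < m} \<le> card {x \<in> {1..n}. r x = i \<and> c x < m}"
proof -
  have "card {x \<in> {1..n}. r x = i \<and> c' x < m} \<le> card {..<m}"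
  proof (rule card_inj_on_le[of c'])
    show "inj_on c' {x \<in> {1..n}. r x = i \<and> c' x < m}"
      by (rule inj_onI) (rule inj_onD[OF inj], simp_all)
  qed auto
  moreover have "card {x \<in> {1..n}. r x = i \<and> c' x < m} \<le> lam i"
  proof -
    have "c x < Suc (Max (c ` {1..n}))" if "x \<in> {1..n}" for x
      using that by (simp add: less_Suc_eq_le)
    then have "card {x \<in> {1..n}. r x = i \<and> c' x < m} \<le> card {x \<in> {1..n}. r x = i \<and> c x < Suc (Max (c ` {1..n}))}"
      by (intro card_mono) auto
    then show ?thesis unfolding filling_card_cell[OF fill] by simp
  qed
  ultimately show ?thesis unfolding filling_card_cell[OF fill] by simp
qed

lemma relabelling_card_le:
  assumes fill: "filling n r c lam" and inj: "inj_on (\<lambda>x. (r x, c' x)) {1..n}"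
  shows "card {x \<in> {1..n}. c' x < m} \<le> card {x \<in> {1..n}. c x < m}"
proof -
  note fib = card_fibers[OF finite_atLeastAtMost, where r = r]
  show ?thesis unfolding fib[of 1 n "\<lambda>x. c' x < m"] fib[of 1 n "\<lambda>x. c x < m"]
    by (intro sum_mono relabelling_card_cell_le[OF assms])
qed

text \<open>The bounds for the single rows add up to the prescribed totals, so all of them are attained.  Then row \<open>i\<close>
  carries exactly the labels below \<open>lam i\<close>.\<close>

lemma relabelling_filling:
  assumes fill: "filling n r c lam" and inj: "inj_on (\<lambda>x. (r x, c' x)) {1..n}"
    and eq: "\<And>m. card {x \<in> {1..n}. c' x < m} = card {x \<in> {1..n}. c x < m}"
  shows "filling n r c' lam"
proof -
  have fib: "card {x \<in> {1..n}. d x < m} = (\<Sum>i\<in>r ` {1..n}. card {x \<in> {1..n}. r x = i \<and> d x < m})"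
    for d :: "nat \<Rightarrow> nat" and m by (rule card_fibers) simp
  have cell: "card {x \<in> {1..n}. r x = i \<and> c' x < m} = min (lam i) m" if i: "i \<in> r ` {1..n}" for i m
  proof (rule ccontr)
    assume ne: "\<not> ?thesis"
    have "(\<Sum>i\<in>r ` {1..n}. card {x \<in> {1..n}. r x = i \<and> c' x < m}) < (\<Sum>i\<in>r ` {1..n}. card {x \<in> {1..n}. r x = i \<and> c x < m})"
    proof (rule sum_strict_mono_ex1)
      have "card {x \<in> {1..n}. r x = i \<and> c' x < m} < card {x \<in> {1..n}. r x = i \<and> c x < m}"
        using relabelling_card_cell_le[OF fill inj, of i m] ne
        unfolding filling_card_cell[OF fill] by (rule le_neq_implies_less)
      then show "\<exists>i\<in>r ` {1..n}. card {x \<in> {1..n}. r x = i \<and> c' x < m} < card {x \<in> {1..n}. r x = i \<and> c x < m}"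
        using i by (rule bexI)
    qed (use relabelling_card_cell_le[OF fill inj] in auto)
    then show False using eq[of m] unfolding fib by simp
  qed
  have sub: "(\<lambda>x. (r x, c' x)) ` {1..n} \<subseteq> {(i, j). j < lam i}"
  proof
    fix p assume "p \<in> (\<lambda>x. (r x, c' x)) ` {1..n}"
    then obtain x where x: "x \<in> {1..n}" "p = (r x, c' x)" by blast
    \<comment> \<open>The count in row \<open>r x\<close> jumps at the label \<open>c' x\<close>, and \<open>min (lam (r x))\<close> jumps only below \<open>lam (r x)\<close>.\<close>
    have "card {y \<in> {1..n}. r y = r x \<and> c' y < c' x} < card {y \<in> {1..n}. r y = r x \<and> c' y < Suc (c' x)}"
      using x by (intro psubset_card_mono) auto
    then have "min (lam (r x)) (c' x) < min (lam (r x)) (Suc (c' x))"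
      using cell x by simp
    then have "c' x < lam (r x)" by linarith
    then show "p \<in> {(i, j). j < lam i}" using x by simp
  qed
  have "card ((\<lambda>x. (r x, c' x)) ` {1..n}) = card {(i, j). j < lam i}"
    unfolding card_image[OF inj] using fill unfolding filling_def by (rule bij_betw_same_card)
  moreover have "finite {(i, j). j < lam i}"
    unfolding filling_image[OF fill, symmetric] by simp
  ultimately have "(\<lambda>x. (r x, c' x)) ` {1..n} = {(i, j). j < lam i}"
    using sub by (simp add: card_subset_eq)
  then show ?thesis unfolding filling_def by (rule bij_betw_imageI[OF inj])
qed

lemma fillings_conjugate:
  assumes "filling n r c lam" "filling n r' c' lam"
  obtains \<sigma> where "\<sigma> \<in> sym_group n" "\<And>x. x \<in> {1..n} \<Longrightarrow> r (app_perm \<sigma> x) = r' x"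
    "\<And>x. x \<in> {1..n} \<Longrightarrow> c (app_perm \<sigma> x) = c' x"
proof -
  let ?f = "\<lambda>x. (r x, c x)" and ?f' = "\<lambda>x. (r' x, c' x)"
  define g where "g = inv_into {1..n} ?f \<circ> ?f'"
  have g: "bij_betw g {1..n} {1..n}"
    unfolding g_def
    by (rule bij_betw_trans[OF assms(2)[unfolded filling_def] bij_betw_inv_into[OF assms(1)[unfolded filling_def]]])
  define p where "p x = (if x \<in> {1..n} then g x else x)" for x
  have "bij_betw p {1..n} {1..n}"
    using g by (rule bij_betw_cong[THEN iffD1, rotated]) (simp add: p_def)
  then have "p permutes {1..n}"
    by (rule bij_imp_permutes) (simp only: p_def if_False)
  then have "p \<in> app_perm ` sym_group n"
    using bij_betw_app_perm[of n] by (simp add: bij_betw_def)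
  then obtain \<sigma> where \<sigma>: "\<sigma> \<in> sym_group n" "p = app_perm \<sigma>" by blast
  have "?f (app_perm \<sigma> x) = ?f' x" if "x \<in> {1..n}" for x
  proof -
    have "?f' x \<in> ?f ` {1..n}"
      using that unfolding filling_image[OF assms(1)] filling_image[OF assms(2), symmetric] by blast
    from f_inv_into_f[OF this] show ?thesis using that by (simp add: \<sigma>(2)[symmetric] p_def g_def)
  qed
  then show ?thesis using that[OF \<sigma>(1)] by simp
qed

lemma card_comp_perm:
  assumes "g \<in> sym_group n"
  shows "card {x \<in> {1..n}. P (app_perm g x)} = card {x \<in> {1..n}. P x}"
proof (rule bij_betw_same_card[of "app_perm g"], rule bij_betw_imageI)
  show "inj_on (app_perm g) {x \<in> {1..n}. P (app_perm g x)}" by (auto simp: inj_on_def)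
  have "y \<in> app_perm g ` {x \<in> {1..n}. P (app_perm g x)}" if "y \<in> {1..n}" "P y" for y
    using that sym_group_app_mem[of "- g" n y] assms
    by (intro image_eqI[of _ _ "app_perm (- g) y"]) simp_all
  then show "app_perm g ` {x \<in> {1..n}. P (app_perm g x)} = {x \<in> {1..n}. P x}"
    using sym_group_app_mem[OF assms] by blast
qed

text \<open>Only the identity preserves both the row and the column of every entry.\<close>

lemma tau_young_elem:
  assumes "filling n r c lam"
  shows "tau (young_elem n r c) = 1"
proof -
  have triv: "g = 0" if "g \<in> fiber_stab n r" "g \<in> fiber_stab n c" for g
  proof (rule finperm_eq_zeroI[of g n])
    show "g \<in> sym_group n" using that by (simp add: fiber_stab_def)
    fix x assume x: "x \<in> {1..n}"
    then have "app_perm g x \<in> {1..n}" using sym_group_app_mem \<open>g \<in> sym_group n\<close> by blast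
    moreover have "(r (app_perm g x), c (app_perm g x)) = (r x, c x)"
      using that x by (simp add: fiber_stab_def)
    ultimately show "app_perm g x = x"
      using x filling_inj[OF assms, of "app_perm g x" x] by simp
  qed
  have "(tau (young_elem n r c) :: 'a) = (\<Sum>g\<in>Poly_Mapping.keys (col_sum n c :: 'a group_alg).
      Poly_Mapping.lookup (row_sum n r) (- g) * Poly_Mapping.lookup (col_sum n c) g)"
    by (simp only: young_elem_def tau_mult)
  also have "\<dots> = (\<Sum>g\<in>{0}. Poly_Mapping.lookup (row_sum n r) (- g) * Poly_Mapping.lookup (col_sum n c) g)"
  proof (rule sum.mono_neutral_right)
    show "{0} \<subseteq> Poly_Mapping.keys (col_sum n c :: 'a group_alg)"
      by (simp add: in_keys_iff tau_twisted_sum[OF sign_character_perm_sign])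
    show "\<forall>g\<in>Poly_Mapping.keys (col_sum n c :: 'a group_alg) - {0}.
      Poly_Mapping.lookup (row_sum n r) (- g) * Poly_Mapping.lookup (col_sum n c) g = (0 :: 'a)"
    proof
      fix g assume "g \<in> Poly_Mapping.keys (col_sum n c :: 'a group_alg) - {0}"
      then have "- g \<notin> fiber_stab n r \<or> g \<notin> fiber_stab n c"
        using triv[of g] fiber_stab_uminus[of "- g" n r] by auto
      then show "Poly_Mapping.lookup (row_sum n r) (- g) * Poly_Mapping.lookup (col_sum n c) g = (0 :: 'a)"
        by (auto simp: lookup_twisted_sum)
    qed
  qed simp
  also have "\<dots> = 1"
    by (simp add: tau_twisted_sum sign_character_perm_sign sign_character_one)
  finally show ?thesis .
qed

text \<open>For a permutation \<open>g\<close> either a row of the filling meets a column of its translate twice, and a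
  transposition makes the product vanish, or \<open>g\<close> factors into a row and a column permutation.\<close>

lemma sandwich_young:
  assumes fill: "filling n r c lam" and x: "x \<in> sym_alg n"
  shows "row_sum n r * x * col_sum n c =
    (scalar (tau (col_sum n c * row_sum n r * x)) * young_elem n r c :: 'k::field_char_0 group_alg)"
proof (rule sandwich_extend[OF x])
  fix g assume g: "g \<in> sym_group n"
  let ?z = "row_sum n r * basis_elem g * col_sum n c :: 'k group_alg"
  have "\<exists>s. ?z = scalar s * young_elem n r c"
  proof (cases "inj_on (\<lambda>x. (r x, c (app_perm g x))) {1..n}")
    case False
    then obtain x y where "x \<in> {1..n}" "y \<in> {1..n}" "x \<noteq> y" "r x = r y"
      "c (app_perm g x) = c (app_perm g y)" by (auto simp: inj_on_def)
    then have "?z = 0" by (rule collision_zero[OF g])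
    then show ?thesis by (metis mult_zero_left single_zero)
  next
    case True
    have "filling n r (\<lambda>x. c (app_perm g x)) lam"
      using card_comp_perm[OF g] by (intro relabelling_filling[OF fill True])
    from fillings_conjugate[OF fill this] obtain v where v: "v \<in> sym_group n"
      "\<And>x. x \<in> {1..n} \<Longrightarrow> r (app_perm v x) = r x"
      "\<And>x. x \<in> {1..n} \<Longrightarrow> c (app_perm v x) = c (app_perm g x)" by blast
    have v_stab: "v \<in> fiber_stab n r" using v by (simp add: fiber_stab_def)
    have "c (app_perm (- v + g) x) = c x" if "x \<in> {1..n}" for x
      using v(3)[of "app_perm (- v) x"] sym_group_app_mem[of "- v" n x] v(1) that by simp
    then have w_stab: "- v + g \<in> fiber_stab n c"
      using sym_group_plus[of "- v" n g] v g by (simp add: fiber_stab_def)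
    have "?z = row_sum n r * (basis_elem v * basis_elem (- v + g)) * col_sum n c"
      by (simp only: basis_mult add_minus_cancel)
    also have "\<dots> = (row_sum n r * basis_elem v) * (basis_elem (- v + g) * col_sum n c)"
      by (simp only: mult.assoc)
    also have "\<dots> = scalar (of_int (perm_sign (- v + g))) * young_elem n r c"
      by (simp only: twisted_sum_right[OF sign_character_one v_stab]
        twisted_sum_left[OF sign_character_perm_sign w_stab] of_int_1 scalar_one mult_1
        scalar_left_commute young_elem_def)
    finally show ?thesis by blast
  qed
  then obtain s where s: "?z = scalar s * young_elem n r c" by blast
  have "tau ?z = s" by (simp only: s lookup_scalar_mult tau_young_elem[OF fill] mult_1_right)
  moreover have "tau ?z = tau (col_sum n c * row_sum n r * basis_elem g)"
    by (subst tau_commute) (simp only: mult.assoc)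
  ultimately show "?z = scalar (tau (col_sum n c * row_sum n r * basis_elem g)) * young_elem n r c"
    using s by metis
qed

text \<open>Since the rows weakly decrease, \<open>m < lam i\<close> holds exactly when column \<open>m\<close> has more than \<open>i\<close> entries.\<close>

lemma column_sizes_determine_shape:
  fixes lam mu :: "nat \<Rightarrow> nat"
  assumes fill: "filling n r c lam" "filling n r' c' mu" and anti: "antimono lam" "antimono mu"
    and eq: "\<And>m. card {x \<in> {1..n}. c x < m} = card {x \<in> {1..n}. c' x < m}"
  shows "lam = mu"
proof -
  have col: "m < lam i \<longleftrightarrow> i < card {x \<in> {1..n}. c x = m}"
    if fill: "filling n r c lam" and anti: "antimono lam" for n r c lam m i
  proof -
    have "r ` {x \<in> {1..n}. c x = m} = {i. m < lam i}"
    proof (intro equalityI subsetI)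
      fix i assume "i \<in> r ` {x \<in> {1..n}. c x = m}"
      then show "i \<in> {i. m < lam i}" using filling_less[OF fill] by blast
    next
      fix i assume "i \<in> {i. m < lam i}"
      then show "i \<in> r ` {x \<in> {1..n}. c x = m}" using filling_surj[OF fill] by blast
    qed
    moreover have "inj_on r {x \<in> {1..n}. c x = m}"
      by (rule inj_onI) (rule filling_inj[OF fill], simp_all)
    ultimately have bij: "bij_betw r {x \<in> {1..n}. c x = m} {i. m < lam i}" by (simp add: bij_betw_def)
    have card: "card {i. m < lam i} = card {x \<in> {1..n}. c x = m}"
      using bij_betw_same_card[OF bij] by simp
    have fin: "finite {i. m < lam i}"
      using bij_betw_finite[OF bij] by simp
    have down: "j < lam i'" if "j < lam i" "i' \<le> i" for i i' j
      using antimonoD[OF anti that(2)] that(1) by simp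
    show ?thesis
    proof
      assume "m < lam i"
      then have "{..i} \<subseteq> {i. m < lam i}" using down by auto
      from card_mono[OF fin this] show "i < card {x \<in> {1..n}. c x = m}" unfolding card by simp
    next
      assume *: "i < card {x \<in> {1..n}. c x = m}"
      show "m < lam i"
      proof (rule ccontr)
        assume n: "\<not> m < lam i"
        have "{i. m < lam i} \<subseteq> {..<i}"
        proof
          fix j assume "j \<in> {i. m < lam i}"
          then have "\<not> i \<le> j" using down[of m j i] n by auto
          then show "j \<in> {..<i}" by simp
        qed
        from card_mono[OF _ this] show False using * unfolding card by simp
      qed
    qed
  qed
  have split: "card {x \<in> {1..n}. d x = m} = card {x \<in> {1..n}. d x < Suc m} - card {x \<in> {1..n}. d x < m}" for d :: "nat \<Rightarrow> nat" and m
  proof -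
    have eq: "{x \<in> {1..n}. d x = m} = {x \<in> {1..n}. d x < Suc m} - {x \<in> {1..n}. d x < m}" by auto
    show ?thesis unfolding eq by (rule card_Diff_subset) auto
  qed
  have "m < lam i \<longleftrightarrow> m < mu i" for m i
    unfolding col[OF fill(1) anti(1)] col[OF fill(2) anti(2)] split eq ..
  then have "lam i = mu i" for i by (metis linorder_neqE_nat less_irrefl_nat)
  then show ?thesis by auto
qed

text \<open>A nonzero product bounds the number of entries in the first \<open>m\<close> columns of one tableau by that of the other
  (\<open>relabelling_card_le\<close>).  If both alternatives failed, all these numbers, and so the shapes, would agree.\<close>

lemma shapes_differ:
  assumes fill: "filling n r c lam" "filling n r' c' mu" and anti: "antimono lam" "antimono mu"
    and ne: "lam \<noteq> mu"
  shows "(\<forall>x\<in>sym_alg n. row_sum n r * x * col_sum n c' = (0 :: 'k::field_char_0 group_alg) \<and>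
            col_sum n c' * x * row_sum n r = (0 :: 'k group_alg)) \<or>
         (\<forall>x\<in>sym_alg n. row_sum n r' * x * col_sum n c = (0 :: 'k group_alg) \<and>
            col_sum n c * x * row_sum n r' = (0 :: 'k group_alg))"
proof -
  have *: "(\<forall>x\<in>sym_alg n. row_sum n r * x * col_sum n c' = (0 :: 'k group_alg) \<and>
            col_sum n c' * x * row_sum n r = (0 :: 'k group_alg)) \<or>
        (\<forall>m. card {x \<in> {1..n}. c' x < m} \<le> card {x \<in> {1..n}. c x < m})"
    if fill: "filling n r c lam" for r c c' lam
  proof (cases "\<exists>g\<in>sym_group n. inj_on (\<lambda>x. (r x, c' (app_perm g x))) {1..n}")
    case True
    then obtain g where g: "g \<in> sym_group n" "inj_on (\<lambda>x. (r x, c' (app_perm g x))) {1..n}" by blast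
    have "card {x \<in> {1..n}. c' x < m} \<le> card {x \<in> {1..n}. c x < m}" for m
      using relabelling_card_le[OF fill g(2), of m] unfolding card_comp_perm[OF g(1), of "\<lambda>y. c' y < m"] .
    then show ?thesis by blast
  next
    case False
    have 0: "row_sum n r * basis_elem g * col_sum n c' = (0 :: 'k group_alg)" if g: "g \<in> sym_group n" for g
    proof -
      obtain x y where "x \<in> {1..n}" "y \<in> {1..n}" "x \<noteq> y" "r x = r y"
        "c' (app_perm g x) = c' (app_perm g y)" using False g by (auto simp: inj_on_def)
      then show ?thesis by (rule collision_zero[OF g])
    qed
    have "col_sum n c' * basis_elem g * row_sum n r = (0 :: 'k group_alg)" if g: "g \<in> sym_group n" for g
    proof -
      have "col_sum n c' * basis_elem g * row_sum n r =
          star (row_sum n r * basis_elem (- g) * col_sum n c' :: 'k group_alg)"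
        by (simp add: star_mult star_twisted_sum sign_character_perm_sign sign_character_one mult.assoc)
      then show ?thesis using 0[of "- g"] g by simp
    qed
    then show ?thesis using sandwich_zero 0 by blast
  qed
  have "\<not> ((\<forall>m. card {x \<in> {1..n}. c' x < m} \<le> card {x \<in> {1..n}. c x < m}) \<and>
      (\<forall>m. card {x \<in> {1..n}. c x < m} \<le> card {x \<in> {1..n}. c' x < m}))"
  proof
    assume le: "(\<forall>m. card {x \<in> {1..n}. c' x < m} \<le> card {x \<in> {1..n}. c x < m}) \<and>
      (\<forall>m. card {x \<in> {1..n}. c x < m} \<le> card {x \<in> {1..n}. c' x < m})"
    have "card {x \<in> {1..n}. c x < m} = card {x \<in> {1..n}. c' x < m}" for m
      using le[THEN conjunct1, THEN spec] le[THEN conjunct2, THEN spec] by (intro order.antisym)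
    from column_sizes_determine_shape[OF fill anti this] ne show False by contradiction
  qed
  then show ?thesis using *[OF fill(1), of c'] *[OF fill(2), of c] by satx
qed

definition kappa :: "nat \<Rightarrow> (nat \<Rightarrow> nat) \<Rightarrow> (nat \<Rightarrow> nat) \<Rightarrow> 'k::field_char_0" where
  "kappa n r c = tau (young_elem n r c * young_elem n r c)"

lemma young_elem_square:
  assumes fill: "filling n r c lam"
  shows "young_elem n r c * young_elem n r c = scalar (kappa n r c) * (young_elem n r c :: 'k::field_char_0 group_alg)"
proof -
  have "young_elem n r c * young_elem n r c = row_sum n r * (col_sum n c * row_sum n r) * (col_sum n c :: 'k group_alg)"
    by (simp only: young_elem_def mult.assoc)
  also have "\<dots> = scalar (tau (col_sum n c * row_sum n r * (col_sum n c * row_sum n r))) * young_elem n r c"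
    by (rule sandwich_young[OF fill]) auto
  also have "tau (col_sum n c * row_sum n r * (col_sum n c * row_sum n r)) = (kappa n r c :: 'k)"
    unfolding kappa_def young_elem_def
    by (subst (2) mult.assoc, subst tau_commute) (simp only: mult.assoc)
  finally show ?thesis .
qed

text \<open>For the row sum \<open>a\<close> and the column sum \<open>b\<close>, the square of \<open>a * b * a\<close> is a positive integer times
  \<open>kappa\<close> times \<open>a * b * a\<close>.  Since \<open>a * b * a\<close> is self-adjoint and nonzero, \<open>kappa\<close> cannot vanish.\<close>

lemma kappa_nonzero:
  assumes fill: "filling n r c lam"
  shows "kappa n r c \<noteq> (0 :: 'k::field_char_0)"
proof
  assume 0: "kappa n r c = (0 :: 'k)"
  let ?a = "row_sum n r :: 'k group_alg" and ?b = "col_sum n c :: 'k group_alg"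
  let ?N = "of_nat (card (fiber_stab n r)) :: 'k"
  have N: "?N \<noteq> 0" using fiber_stab_zero[of n r] by (auto simp del: fiber_stab_zero)
  have aa: "?a * ?a = scalar ?N * ?a" by (rule twisted_sum_absorb[OF sign_character_one order.refl])
  have abab: "?a * ?b * ?a * ?b = 0"
    using young_elem_square[OF fill, where ?'k = 'k] 0 by (simp add: young_elem_def mult.assoc)
  have "(?a * ?b * ?a) * (?a * ?b * ?a) = ?a * ?b * (?a * ?a) * ?b * ?a"
    by (simp only: mult.assoc)
  also have "\<dots> = scalar ?N * (?a * ?b * ?a * ?b * ?a)"
    by (simp only: aa scalar_left_commute mult.assoc)
  finally have sq: "(?a * ?b * ?a) * (?a * ?b * ?a) = 0" by (simp add: abab)
  have int: "integer_coeffs (?a * ?b * ?a)" by (intro integer_coeffs_mult integer_coeffs_twisted_sum)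
  have "star (?a * ?b * ?a) = ?a * ?b * ?a"
    by (simp only: star_mult star_twisted_sum sign_character_perm_sign sign_character_one mult.assoc)
  from self_adjoint_square_zero[OF _ this sq] int have "?a * ?b * ?a = 0"
    by (simp only: integer_coeffs_def)
  then have "tau (?a * ?b * ?a) = 0" by simp
  moreover have "tau (?a * ?b * ?a) = tau (?a * ?a * ?b)"
    unfolding mult.assoc[of ?a ?a ?b] by (rule tau_commute)
  moreover have "?a * ?a * ?b = scalar ?N * young_elem n r c"
    unfolding aa young_elem_def by (rule mult.assoc)
  then have "tau (?a * ?a * ?b) = ?N"
    by (simp only: lookup_scalar_mult tau_young_elem[OF fill] mult_1_right)
  ultimately show False using N by metis
qed

lemma young_elem_conjugate:
  assumes \<sigma>: "\<sigma> \<in> sym_group n"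
    and "\<And>x. x \<in> {1..n} \<Longrightarrow> r (app_perm \<sigma> x) = r' x" "\<And>x. x \<in> {1..n} \<Longrightarrow> c (app_perm \<sigma> x) = c' x"
  shows "young_elem n r' c' * basis_elem \<sigma> = basis_elem \<sigma> * (young_elem n r c :: 'k::field_char_0 group_alg)"
proof -
  have r: "row_sum n r' * basis_elem \<sigma> = basis_elem \<sigma> * (row_sum n r :: 'k group_alg)"
    using assms by (intro twisted_sum_conjugate[OF sign_character_one]) auto
  have c: "col_sum n c' * basis_elem \<sigma> = basis_elem \<sigma> * (col_sum n c :: 'k group_alg)"
    using assms by (intro twisted_sum_conjugate[OF sign_character_perm_sign]) auto
  have "young_elem n r' c' * basis_elem \<sigma> = row_sum n r' * (col_sum n c' * basis_elem \<sigma> :: 'k group_alg)"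
    by (simp only: young_elem_def mult.assoc)
  also have "\<dots> = (row_sum n r' * basis_elem \<sigma>) * col_sum n c"
    by (simp only: c mult.assoc)
  also have "\<dots> = basis_elem \<sigma> * young_elem n r c"
    by (simp only: r young_elem_def mult.assoc)
  finally show ?thesis .
qed

section \<open>Tableaux as fillings\<close>

text \<open>Row lengths are extended by zero to all rows, so that adding and removing a box are function updates.\<close>

definition row_lengths :: "nat list \<Rightarrow> nat \<Rightarrow> nat" where
  "row_lengths lam i = (if i < length lam then lam ! i else 0)"

definition row_of :: "tableau \<Rightarrow> nat \<Rightarrow> nat" where
  "row_of T x = (THE i. i < length T \<and> x \<in> set (T ! i))"

definition col_of :: "tableau \<Rightarrow> nat \<Rightarrow> nat" where
  "col_of T x = (THE j. j < length (T ! row_of T x) \<and> T ! row_of T x ! j = x)"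

lemma row_lengths_shape: "row_lengths (shape T) i = (if i < length T then length (T ! i) else 0)"
  by (simp add: row_lengths_def shape_def)

lemma row_lengths_inject:
  assumes "0 \<notin> set lam" "0 \<notin> set mu" and eq: "row_lengths lam = row_lengths mu"
  shows "lam = mu"
proof -
  have pos: "i < length nu \<longleftrightarrow> row_lengths nu i \<noteq> 0" if "0 \<notin> set nu" for nu i
    using that nth_mem[of i nu] unfolding row_lengths_def by metis
  have "i < length lam \<longleftrightarrow> i < length mu" for i
    by (simp only: pos[OF assms(1)] pos[OF assms(2)] eq)
  from this[of "length lam"] this[of "length mu"] have "length lam = length mu" by simp
  moreover have "lam ! i = mu ! i" if "i < length lam" "i < length mu" for i
    using fun_cong[OF eq, of i] that by (simp add: row_lengths_def)
  ultimately show ?thesis by (simp add: nth_equalityI)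
qed

lemma is_tableau_row_nonempty:
  assumes "is_tableau n T" "i < length T"
  shows "T ! i \<noteq> []"
proof
  assume "T ! i = []"
  then have "0 \<in> set (shape T)" using assms(2) by (metis length_0_conv length_map nth_map nth_mem shape_def)
  then show False using assms(1) by (simp add: is_tableau_def partition_of_def)
qed

lemma is_tableau_antimono:
  assumes "is_tableau n T"
  shows "antimono (row_lengths (shape T))"
proof (rule antimonoI)
  fix i j :: nat assume "i \<le> j"
  show "row_lengths (shape T) j \<le> row_lengths (shape T) i"
  proof (cases "i < j \<and> j < length T")
    case True
    then show ?thesis using assms
      by (auto simp: is_tableau_def partition_of_def row_lengths_def shape_def sorted_wrt_iff_nth_less)
  next
    case False
    then show ?thesis using \<open>i \<le> j\<close> by (auto simp: row_lengths_def shape_def)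
  qed
qed

lemma is_tableau_entry_mem:
  "is_tableau n T \<Longrightarrow> i < length T \<Longrightarrow> j < length (T ! i) \<Longrightarrow> T ! i ! j \<in> {1..n}"
  unfolding is_tableau_def by (metis UN_I nth_mem set_concat)

lemma is_tableau_row_distinct:
  assumes "is_tableau n T" "i < length T"
  shows "distinct (T ! i)"
  using assms unfolding is_tableau_def distinct_concat_iff by (meson nth_mem)

lemma is_tableau_row_unique:
  assumes T: "is_tableau n T" and "i < length T" "i' < length T" "x \<in> set (T ! i)" "x \<in> set (T ! i')"
  shows "i = i'"
proof -
  have "removeAll [] T = T"
    using is_tableau_row_nonempty[OF T] by (metis in_set_conv_nth removeAll_id)
  then have "distinct T" and
    disj: "\<forall>ys zs. ys \<in> set T \<and> zs \<in> set T \<and> ys \<noteq> zs \<longrightarrow> set ys \<inter> set zs = {}"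
    using T unfolding is_tableau_def distinct_concat_iff by simp_all
  have "T ! i = T ! i'"
    using disj assms(2-5) nth_mem[of i T] nth_mem[of i' T] by blast
  then show ?thesis using \<open>distinct T\<close> assms(2,3) by (simp add: nth_eq_iff_index_eq)
qed

lemma row_of_entry:
  assumes "is_tableau n T" "i < length T" "x \<in> set (T ! i)"
  shows "row_of T x = i"
  unfolding row_of_def
  by (rule the_equality) (use assms is_tableau_row_unique[OF assms(1)] in blast)+

lemma col_of_entry:
  assumes "is_tableau n T" "i < length T" "j < length (T ! i)"
  shows "col_of T (T ! i ! j) = j"
proof -
  have "row_of T (T ! i ! j) = i" using row_of_entry[OF assms(1,2)] assms(3) by simp
  then show ?thesis
    unfolding col_of_def
    using is_tableau_row_distinct[OF assms(1,2)] assms(3)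
    by (intro the_equality) (auto simp: nth_eq_iff_index_eq)
qed

lemma entry_cases:
  assumes "is_tableau n T" "x \<in> {1..n}"
  obtains i j where "i < length T" "j < length (T ! i)" "x = T ! i ! j" "row_of T x = i" "col_of T x = j"
proof -
  have "x \<in> set (concat T)" using assms by (simp add: is_tableau_def)
  then obtain i j where ij: "i < length T" "j < length (T ! i)" "x = T ! i ! j"
    by (metis (no_types, lifting) UN_E in_set_conv_nth set_concat)
  then show ?thesis
    using that[OF ij] row_of_entry[OF assms(1) ij(1), of x] col_of_entry[OF assms(1) ij(1,2)] by simp
qed

lemma tableau_filling:
  assumes T: "is_tableau n T"
  shows "filling n (row_of T) (col_of T) (row_lengths (shape T))"
  unfolding filling_def
proof (rule bij_betw_imageI)
  show "inj_on (\<lambda>x. (row_of T x, col_of T x)) {1..n}"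
  proof (rule inj_onI)
    fix x y assume "x \<in> {1..n}" "y \<in> {1..n}" "(row_of T x, col_of T x) = (row_of T y, col_of T y)"
    then show "x = y" by (metis entry_cases[OF T] prod.inject)
  qed
  show "(\<lambda>x. (row_of T x, col_of T x)) ` {1..n} = {(i, j). j < row_lengths (shape T) i}"
  proof (intro equalityI subsetI)
    fix p assume "p \<in> (\<lambda>x. (row_of T x, col_of T x)) ` {1..n}"
    then obtain x where x: "x \<in> {1..n}" "p = (row_of T x, col_of T x)" by blast
    from entry_cases[OF T x(1)] show "p \<in> {(i, j). j < row_lengths (shape T) i}"
      by (metis (mono_tags, lifting) case_prodI mem_Collect_eq row_lengths_shape x(2))
  next
    fix p assume "p \<in> {(i, j). j < row_lengths (shape T) i}"
    then obtain i j where p: "p = (i, j)" "j < row_lengths (shape T) i" by blast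
    then have ij: "i < length T" "j < length (T ! i)" by (auto simp: row_lengths_shape split: if_splits)
    have "p = (row_of T (T ! i ! j), col_of T (T ! i ! j))"
      using p row_of_entry[OF T ij(1), of "T ! i ! j"] col_of_entry[OF T ij] ij by simp
    then show "p \<in> (\<lambda>x. (row_of T x, col_of T x)) ` {1..n}"
      using is_tableau_entry_mem[OF T ij] by (rule image_eqI)
  qed
qed

lemma fiber_stab_iff:
  assumes \<sigma>: "\<sigma> \<in> sym_group n"
  shows "\<sigma> \<in> fiber_stab n f \<longleftrightarrow> (\<forall>i. app_perm \<sigma> ` {x \<in> {1..n}. f x = i} = {x \<in> {1..n}. f x = i})"
proof
  assume s: "\<sigma> \<in> fiber_stab n f"
  show "\<forall>i. app_perm \<sigma> ` {x \<in> {1..n}. f x = i} = {x \<in> {1..n}. f x = i}"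
  proof
    fix i
    have "app_perm \<sigma> ` {x \<in> {1..n}. f x = i} \<subseteq> {x \<in> {1..n}. f x = i}"
      using s sym_group_app_mem[OF \<sigma>] unfolding fiber_stab_def by blast
    then show "app_perm \<sigma> ` {x \<in> {1..n}. f x = i} = {x \<in> {1..n}. f x = i}"
      by (intro endo_inj_surj) (auto simp: inj_on_def)
  qed
next
  assume *: "\<forall>i. app_perm \<sigma> ` {x \<in> {1..n}. f x = i} = {x \<in> {1..n}. f x = i}"
  have "f (app_perm \<sigma> x) = f x" if "x \<in> {1..n}" for x
    using *[THEN spec, of "f x"] that by blast
  then show "\<sigma> \<in> fiber_stab n f" using \<sigma> by (simp add: fiber_stab_def)
qed

lemma row_stabilizer_eq:
  assumes T: "is_tableau n T"
  shows "row_stabilizer n T = fiber_stab n (row_of T)"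
proof -
  have row: "{x \<in> {1..n}. row_of T x = i} = (if i < length T then set (T ! i) else {})" for i
  proof (intro equalityI subsetI)
    fix x assume "x \<in> {x \<in> {1..n}. row_of T x = i}"
    then have "x \<in> {1..n}" "row_of T x = i" by auto
    from entry_cases[OF T this(1)] this(2) obtain j where "i < length T" "j < length (T ! i)" "x = T ! i ! j"
      by metis
    then show "x \<in> (if i < length T then set (T ! i) else {})" by simp
  next
    fix x assume "x \<in> (if i < length T then set (T ! i) else {})"
    then have x: "i < length T" "x \<in> set (T ! i)" by (auto split: if_splits)
    then obtain j where "j < length (T ! i)" "x = T ! i ! j" by (metis in_set_conv_nth)
    then show "x \<in> {x \<in> {1..n}. row_of T x = i}"
      using row_of_entry[OF T x] is_tableau_entry_mem[OF T x(1)] by blast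
  qed
  have rows: "(\<forall>row\<in>set T. app_perm \<sigma> ` set row = set row) \<longleftrightarrow>
      (\<forall>i. app_perm \<sigma> ` {x \<in> {1..n}. row_of T x = i} = {x \<in> {1..n}. row_of T x = i})" for \<sigma>
  proof
    assume *: "\<forall>row\<in>set T. app_perm \<sigma> ` set row = set row"
    show "\<forall>i. app_perm \<sigma> ` {x \<in> {1..n}. row_of T x = i} = {x \<in> {1..n}. row_of T x = i}"
      unfolding row using * by (simp add: all_set_conv_all_nth)
  next
    assume *: "\<forall>i. app_perm \<sigma> ` {x \<in> {1..n}. row_of T x = i} = {x \<in> {1..n}. row_of T x = i}"
    have "app_perm \<sigma> ` set (T ! i) = set (T ! i)" if "i < length T" for i
      using *[THEN spec, of i] unfolding row if_P[OF that] .
    then show "\<forall>row\<in>set T. app_perm \<sigma> ` set row = set row"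
      by (simp add: all_set_conv_all_nth)
  qed
  show ?thesis
  proof (rule set_eqI)
    fix \<sigma>
    show "\<sigma> \<in> row_stabilizer n T \<longleftrightarrow> \<sigma> \<in> fiber_stab n (row_of T)"
      unfolding row_stabilizer_def mem_Collect_eq rows
      using fiber_stab_iff[of \<sigma> n "row_of T"] subsetD[OF fiber_stab_subset, of \<sigma> n "row_of T"] by satx
  qed
qed

lemma column_stabilizer_eq:
  assumes T: "is_tableau n T"
  shows "column_stabilizer n T = fiber_stab n (col_of T)"
proof -
  have col: "column T j = {x \<in> {1..n}. col_of T x = j}" for j
  proof (intro equalityI subsetI)
    fix x assume "x \<in> column T j"
    then obtain i where "i < length T" "j < length (T ! i)" "x = T ! i ! j" unfolding column_def by blast
    then show "x \<in> {x \<in> {1..n}. col_of T x = j}"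
      using is_tableau_entry_mem[OF T] col_of_entry[OF T] by auto
  next
    fix x assume "x \<in> {x \<in> {1..n}. col_of T x = j}"
    then have "x \<in> {1..n}" "col_of T x = j" by auto
    from entry_cases[OF T this(1)] this(2) show "x \<in> column T j"
      unfolding column_def by blast
  qed
  show ?thesis
  proof (rule set_eqI)
    fix \<sigma>
    show "\<sigma> \<in> column_stabilizer n T \<longleftrightarrow> \<sigma> \<in> fiber_stab n (col_of T)"
      unfolding column_stabilizer_def mem_Collect_eq col
      using fiber_stab_iff[of \<sigma> n "col_of T"] subsetD[OF fiber_stab_subset, of \<sigma> n "col_of T"] by satx
  qed
qed

abbreviation tab_elem :: "nat \<Rightarrow> tableau \<Rightarrow> 'k::field_char_0 group_alg" where
  "tab_elem n T \<equiv> young_elem n (row_of T) (col_of T)"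

lemma young_symmetrizer_eq:
  assumes T: "is_tableau n T"
  shows "young_symmetrizer n T = scalar (1 / h_const n (shape T)) * (tab_elem n T :: 'k::field_char_0 group_alg)"
proof -
  have "(\<Sum>v\<in>row_stabilizer n T. basis_elem v) = (row_sum n (row_of T) :: 'k group_alg)"
    by (simp add: row_stabilizer_eq[OF T] twisted_sum_def)
  moreover have "(\<Sum>w\<in>column_stabilizer n T. of_int (sign (app_perm w)) * basis_elem w) =
      (col_sum n (col_of T) :: 'k group_alg)"
    by (simp add: column_stabilizer_eq[OF T] twisted_sum_def perm_sign_def mult_single flip: single_of_int)
  ultimately show ?thesis
    unfolding young_symmetrizer_def young_elem_def by (simp only: mult.assoc)
qed

section \<open>Adding and removing the largest entry\<close>

definition addable :: "(nat \<Rightarrow> nat) \<Rightarrow> nat \<Rightarrow> bool" where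
  "addable \<mu> i \<longleftrightarrow> i = 0 \<or> \<mu> i < \<mu> (i - 1)"

definition removable :: "(nat \<Rightarrow> nat) \<Rightarrow> nat \<Rightarrow> bool" where
  "removable \<mu> i \<longleftrightarrow> \<mu> (Suc i) < \<mu> i"

definition add_box :: "nat \<Rightarrow> nat \<Rightarrow> tableau \<Rightarrow> tableau" where
  "add_box m i U = (if i < length U then U[i := U ! i @ [m]] else U @ [[m]])"

lemma row_lengths_less_iff:
  "j < row_lengths (shape T) i \<longleftrightarrow> i < length T \<and> j < length (T ! i)"
  by (simp add: row_lengths_shape)

text \<open>In this form the conditions are easy to follow when a box is added: the row lengths undergo a function update
  and the multiset of entries gains one element.\<close>

lemma is_tableau_iff:
  "is_tableau n T \<longleftrightarrow> antimono (row_lengths (shape T)) \<and> [] \<notin> set T \<and> mset (concat T) = mset_set {1..n}"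
proof (intro iffI conjI)
  assume T: "is_tableau n T"
  show "antimono (row_lengths (shape T))" by (rule is_tableau_antimono[OF T])
  show "[] \<notin> set T" using is_tableau_row_nonempty[OF T] by (metis in_set_conv_nth)
  show "mset (concat T) = mset_set {1..n}"
    using T unfolding is_tableau_def by (metis mset_set_set)
next
  assume *: "antimono (row_lengths (shape T)) \<and> [] \<notin> set T \<and> mset (concat T) = mset_set {1..n}"
  have set: "set (concat T) = {1..n}"
    using * by (metis finite_atLeastAtMost finite_set_mset_mset_set set_mset_mset)
  have len: "length (concat T) = n"
    using * by (metis card_atLeastAtMost diff_Suc_1 size_mset size_mset_set)
  have "distinct (concat T)"
    by (rule card_distinct) (simp only: set len card_atLeastAtMost diff_Suc_1)
  moreover have "sum_list (shape T) = n"
    using len by (simp add: shape_def length_concat)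
  moreover have "0 \<notin> set (shape T)" using * by (auto simp: shape_def)
  moreover have "sorted_wrt (\<ge>) (shape T)"
    unfolding sorted_wrt_iff_nth_less
  proof (intro allI impI)
    fix i j assume "i < j" "j < length (shape T)"
    moreover have "row_lengths (shape T) j \<le> row_lengths (shape T) i"
      by (rule antimonoD[OF conjunct1[OF *] less_imp_le[OF \<open>i < j\<close>]])
    ultimately show "shape T ! j \<le> shape T ! i" by (simp add: row_lengths_def)
  qed
  ultimately show "is_tableau n T" using set by (simp add: is_tableau_def partition_of_def)
qed

lemma standard_iff:
  "standard n T \<longleftrightarrow> is_tableau n T \<and>
     (\<forall>i j j'. j < row_lengths (shape T) i \<and> j' < j \<longrightarrow> T ! i ! j' < T ! i ! j) \<and>
     (\<forall>i i' j. j < row_lengths (shape T) i \<and> i' < i \<longrightarrow> T ! i' ! j < T ! i ! j)"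
  unfolding standard_def row_lengths_less_iff by (intro arg_cong2[where f = "(\<and>)"] refl; meson)

lemma standard_tableau: "standard n T \<Longrightarrow> is_tableau n T"
  by (simp add: standard_def)

lemma row_lengths_add_box:
  assumes "i \<le> length U"
  shows "row_lengths (shape (add_box m i U)) = (row_lengths (shape U))(i := Suc (row_lengths (shape U) i))"
  using assms by (auto simp: add_box_def row_lengths_shape nth_list_update nth_append)

lemma add_box_new:
  assumes "i \<le> length U"
  shows "add_box m i U ! i ! row_lengths (shape U) i = m"
  using assms by (auto simp: add_box_def row_lengths_shape nth_append)

lemma add_box_old:
  assumes "b < row_lengths (shape U) a"
  shows "add_box m i U ! a ! b = U ! a ! b"
  using assms by (auto simp: add_box_def row_lengths_shape nth_append nth_list_update split: if_splits)

lemma mset_concat_add_box: "mset (concat (add_box m i U)) = add_mset m (mset (concat U))"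
proof (cases "i < length U")
  case True
  have "mset (concat U) = mset (concat (take i U @ U ! i # drop (Suc i) U))"
    using id_take_nth_drop[OF True] by simp
  then show ?thesis using True by (simp add: add_box_def upd_conv_take_nth_drop)
qed (simp add: add_box_def)

lemma remove_add_box:
  assumes "i \<le> length U" "m \<notin> set (concat U)" "[] \<notin> set U"
  shows "remove_box m (add_box m i U) = U"
proof -
  have m: "filter (\<lambda>x. x \<noteq> m) row = row" if "row \<in> set U" for row
    using assms(2) that by (intro filter_True) auto
  then have map: "map (filter (\<lambda>x. x \<noteq> m)) U = U" by (intro map_idI)
  have fil: "filter (\<lambda>row. row \<noteq> []) U = U" using assms(3) by (intro filter_True) auto
  show ?thesis
  proof (cases "i < length U")
    case True
    then show ?thesis
      using m[OF nth_mem[OF True]] by (simp add: remove_box_def keep_boxes_def add_box_def map_update map fil)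
  next
    case False
    then show ?thesis by (simp add: remove_box_def keep_boxes_def add_box_def map fil)
  qed
qed

lemma antimono_add:
  assumes "antimono \<mu>" "addable \<mu> i"
  shows "antimono (\<mu>(i := Suc (\<mu> i)))"
proof (rule antimonoI)
  fix a b :: nat assume ab: "a \<le> b"
  have "\<mu> b \<le> \<mu> a" using assms(1) ab by (rule antimonoD)
  moreover have "Suc (\<mu> i) \<le> \<mu> a" if "a < i"
  proof -
    have "\<mu> (i - 1) \<le> \<mu> a" by (rule antimonoD[OF assms(1)]) (use that in simp)
    then show ?thesis using assms(2) that by (auto simp: addable_def)
  qed
  ultimately show "(\<mu>(i := Suc (\<mu> i))) b \<le> (\<mu>(i := Suc (\<mu> i))) a"
    using ab by auto
qed

lemma antimono_remove:
  assumes "antimono \<mu>" "removable \<mu> i"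
  shows "antimono (\<mu>(i := \<mu> i - 1))"
proof (rule antimonoI)
  fix a b :: nat assume ab: "a \<le> b"
  have "\<mu> b \<le> \<mu> a" using assms(1) ab by (rule antimonoD)
  moreover have "\<mu> b \<le> \<mu> i - 1" if "i < b"
  proof -
    have "\<mu> b \<le> \<mu> (Suc i)" by (rule antimonoD[OF assms(1)]) (use that in simp)
    then show ?thesis using assms(2) by (auto simp: removable_def)
  qed
  ultimately show "(\<mu>(i := \<mu> i - 1)) b \<le> (\<mu>(i := \<mu> i - 1)) a"
    using ab by auto
qed

lemma addable_le_length:
  assumes "addable (row_lengths (shape U)) i"
  shows "i \<le> length U"
proof (cases "i = 0")
  case False
  then have "0 < row_lengths (shape U) (i - 1)" using assms by (auto simp: addable_def)
  then have "i - 1 < length U" by (simp only: row_lengths_less_iff)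
  then show ?thesis by linarith
qed simp

lemma mset_set_Suc: "mset_set {1..Suc n} = add_mset (Suc n) (mset_set {1..n})"
proof -
  have "{1..Suc n} = insert (Suc n) {1..n}" by auto
  then show ?thesis by simp
qed

lemma standard_add_box:
  assumes U: "standard n U" and add: "addable (row_lengths (shape U)) i"
  shows "standard (Suc n) (add_box (Suc n) i U)"
    and "remove_box (Suc n) (add_box (Suc n) i U) = U"
proof -
  let ?T = "add_box (Suc n) i U" and ?\<mu> = "row_lengths (shape U)"
  have i: "i \<le> length U" by (rule addable_le_length[OF add])
  have tab: "is_tableau n U" by (rule standard_tableau[OF U])
  then have U': "antimono ?\<mu>" "[] \<notin> set U" "mset (concat U) = mset_set {1..n}"
    by (simp_all add: is_tableau_iff)
  have rl: "row_lengths (shape ?T) = ?\<mu>(i := Suc (?\<mu> i))" by (rule row_lengths_add_box[OF i])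
  have "set (concat U) = {1..n}" using tab by (simp add: is_tableau_def)
  then show "remove_box (Suc n) ?T = U"
    by (intro remove_add_box i U'(2)) simp
  have "is_tableau (Suc n) ?T"
    unfolding is_tableau_iff rl mset_concat_add_box U'(3) mset_set_Suc
  proof (intro conjI refl)
    show "antimono (?\<mu>(i := Suc (?\<mu> i)))" by (rule antimono_add[OF U'(1) add])
    show "[] \<notin> set ?T" using U'(2) set_update_subset_insert[of U i "U ! i @ [Suc n]"]
      by (auto simp: add_box_def)
  qed
  moreover have old: "U ! a ! b < Suc n" if "b < ?\<mu> a" for a b
    using is_tableau_entry_mem[OF tab, of a b] that by (simp add: row_lengths_less_iff less_Suc_eq_le)
  moreover have "?T ! a ! b' < ?T ! a ! b" if "b < row_lengths (shape ?T) a" "b' < b" for a b b'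
  proof (cases "b < ?\<mu> a")
    case True
    then show ?thesis using U that by (simp add: add_box_old standard_iff)
  next
    case False
    then have "a = i" "b = ?\<mu> i" using that(1) unfolding rl by (auto split: if_splits)
    then show ?thesis using that(2) old[of b' a] by (simp add: add_box_new[OF i] add_box_old)
  qed
  moreover have "?T ! a' ! b < ?T ! a ! b" if "b < row_lengths (shape ?T) a" "a' < a" for a a' b
  proof (cases "b < ?\<mu> a")
    case True
    moreover have "?\<mu> a \<le> ?\<mu> a'" by (rule antimonoD[OF U'(1)]) (use that(2) in simp)
    ultimately show ?thesis using U that by (simp add: add_box_old standard_iff)
  next
    case False
    then have ab: "a = i" "b = ?\<mu> i" using that(1) unfolding rl by (auto split: if_splits)
    have "?\<mu> (i - 1) \<le> ?\<mu> a'" by (rule antimonoD[OF U'(1)]) (use that(2) ab in simp)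
    then have "b < ?\<mu> a'" using ab add that(2) by (auto simp: addable_def)
    then show ?thesis using ab old[of b a'] by (simp add: add_box_new[OF i] add_box_old)
  qed
  ultimately show "standard (Suc n) ?T" unfolding standard_iff by blast
qed

text \<open>The largest entry ends its row, and the next row is too short to reach below it.\<close>

lemma standard_remove_box:
  assumes T: "standard (Suc n) T"
  obtains i where "standard n (remove_box (Suc n) T)"
    "addable (row_lengths (shape (remove_box (Suc n) T))) i"
    "T = add_box (Suc n) i (remove_box (Suc n) T)"
proof -
  let ?\<nu> = "row_lengths (shape T)"
  have tab: "is_tableau (Suc n) T" by (rule standard_tableau[OF T])
  then have T': "antimono ?\<nu>" "[] \<notin> set T" "mset (concat T) = mset_set {1..Suc n}"
    unfolding is_tableau_iff by blast+
  from entry_cases[OF tab, of "Suc n"] obtain i j where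
    ij: "i < length T" "j < length (T ! i)" "T ! i ! j = Suc n" by (metis atLeastAtMost_iff le_add1 order.refl plus_1_eq_Suc)
  have le: "T ! a ! b \<le> Suc n" if "b < ?\<nu> a" for a b
    using is_tableau_entry_mem[OF tab, of a b] that by (simp add: row_lengths_less_iff)
  have len_i: "?\<nu> i = length (T ! i)" using ij by (simp add: row_lengths_shape)
  have last: "length (T ! i) = Suc j"
  proof (rule ccontr)
    assume "length (T ! i) \<noteq> Suc j"
    then have "Suc j < ?\<nu> i" using ij len_i by simp
    moreover from this have "T ! i ! j < T ! i ! Suc j" using T unfolding standard_iff by blast
    ultimately show False using le[of "Suc j" i] ij by simp
  qed
  have below: "?\<nu> (Suc i) \<le> j"
  proof (rule ccontr)
    assume "\<not> ?\<nu> (Suc i) \<le> j"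
    then have j: "j < ?\<nu> (Suc i)" by simp
    then have "T ! i ! j < T ! Suc i ! j" using T unfolding standard_iff by blast
    then show False using le[OF j] ij by simp
  qed
  have split: "T ! i = butlast (T ! i) @ [Suc n]"
    using ij last by (metis append_butlast_last_id diff_Suc_1 last_conv_nth length_0_conv nat.distinct(1))
  \<comment> \<open>For \<open>j = 0\<close> the row of the largest entry consists of that entry and has to disappear altogether.\<close>
  define U where "U = (if j = 0 then butlast T else T[i := butlast (T ! i)])"
  have "T = add_box (Suc n) i U \<and> i \<le> length U \<and> [] \<notin> set U"
  proof (cases "j = 0")
    case True
    have "\<not> Suc i < length T"
      using below True is_tableau_row_nonempty[OF tab, of "Suc i"] by (auto simp: row_lengths_shape)
    then have len: "length T = Suc i" using ij by simp
    have "T ! i = [Suc n]" using split last True by (metis append_self_conv2 length_0_conv length_butlast diff_Suc_1)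
    then have "T = butlast T @ [[Suc n]]" using len
      by (metis append_butlast_last_id diff_Suc_1 last_conv_nth length_0_conv nat.distinct(1))
    moreover have "[] \<notin> set (butlast T)" using T'(2) in_set_butlastD by fastforce
    ultimately show ?thesis using True len by (simp add: U_def add_box_def)
  next
    case False
    have "U[i := U ! i @ [Suc n]] = T"
      using False ij split by (simp add: U_def)
    moreover have "butlast (T ! i) \<noteq> []" using last False by (metis length_butlast length_0_conv diff_Suc_1)
    then have "[] \<notin> set U"
      using T'(2) set_update_subset_insert[of T i "butlast (T ! i)"] False by (auto simp: U_def)
    ultimately show ?thesis using False ij by (simp add: add_box_def U_def)
  qed
  then have TU: "T = add_box (Suc n) i U" and i: "i \<le> length U" and ne: "[] \<notin> set U" by auto
  let ?\<mu> = "row_lengths (shape U)"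
  have rl: "?\<nu> = ?\<mu>(i := Suc (?\<mu> i))" using row_lengths_add_box[OF i] TU by metis
  then have \<mu>: "?\<mu> = ?\<nu>(i := ?\<nu> i - 1)" by (auto simp: fun_eq_iff)
  have anti: "antimono ?\<mu>"
    unfolding \<mu> by (rule antimono_remove[OF T'(1)]) (use below last len_i in \<open>simp add: removable_def\<close>)
  have "add_mset (Suc n) (mset (concat U)) = add_mset (Suc n) (mset_set {1..n})"
    using T'(3) TU mset_concat_add_box[of "Suc n" i U] mset_set_Suc[of n] by metis
  then have mset: "mset (concat U) = mset_set {1..n}" by simp
  have tabU: "is_tableau n U" using anti ne mset by (simp add: is_tableau_iff)
  have le_rl: "?\<mu> a \<le> ?\<nu> a" for a by (simp add: rl)
  have entry: "T ! a ! b = U ! a ! b" if "b < ?\<mu> a" for a b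
    using add_box_old[OF that, of "Suc n" i] TU by simp
  have "standard n U"
    unfolding standard_iff
  proof (intro conjI allI impI tabU)
    fix a b b' assume "b < ?\<mu> a \<and> b' < b"
    then show "U ! a ! b' < U ! a ! b"
      using T entry[of b a] entry[of b' a] le_rl[of a] unfolding standard_iff by (metis less_le_trans less_trans)
  next
    fix a a' b assume *: "b < ?\<mu> a \<and> a' < a"
    moreover have "?\<mu> a \<le> ?\<mu> a'" by (rule antimonoD[OF anti]) (use * in simp)
    ultimately show "U ! a' ! b < U ! a ! b"
      using T entry[of b a] entry[of b a'] le_rl[of a] unfolding standard_iff by (metis less_le_trans)
  qed
  moreover have "addable ?\<mu> i"
  proof (cases "i = 0")
    case False
    have "?\<nu> i \<le> ?\<nu> (i - 1)" by (rule antimonoD[OF T'(1)]) simp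
    then show ?thesis using False by (auto simp: rl addable_def split: if_splits)
  qed (simp add: addable_def)
  moreover have "Suc n \<notin> set (concat U)"
    using tabU by (simp add: is_tableau_def)
  then have "remove_box (Suc n) T = U"
    unfolding TU by (intro remove_add_box i ne)
  ultimately show ?thesis using that[of i] TU by simp
qed

lemma standard_0_iff: "standard 0 T \<longleftrightarrow> T = []"
proof
  assume T: "standard 0 T"
  then have "set (concat T) = {}" "[] \<notin> set T"
    using standard_tableau[OF T] by (auto simp: is_tableau_iff is_tableau_def)
  then show "T = []" by (cases T) auto
qed (simp add: standard_def is_tableau_def partition_of_def shape_def)

lemma standard_Suc_eq:
  assumes T: "standard (Suc n) T" and S: "standard (Suc n) S"
    and bar: "remove_box (Suc n) T = remove_box (Suc n) S" and sh: "shape T = shape S"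
  shows "T = S"
proof -
  let ?U = "remove_box (Suc n) S"
  from standard_remove_box[OF T] bar obtain i where
    i: "addable (row_lengths (shape ?U)) i" "T = add_box (Suc n) i ?U" by metis
  from standard_remove_box[OF S] obtain i' where
    i': "addable (row_lengths (shape ?U)) i'" "S = add_box (Suc n) i' ?U" by metis
  have "(row_lengths (shape ?U))(i := Suc (row_lengths (shape ?U) i)) =
      (row_lengths (shape ?U))(i' := Suc (row_lengths (shape ?U) i'))"
    using row_lengths_add_box[OF addable_le_length[OF i(1)], of "Suc n"]
      row_lengths_add_box[OF addable_le_length[OF i'(1)], of "Suc n"] sh i(2)[symmetric] i'(2)[symmetric] by metis
  then have "i = i'" by (metis fun_upd_apply n_not_Suc_n)
  then show ?thesis using i i' by simp
qed

lemma finite_standard [simp]: "finite {T. standard n T}"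
proof (induction n)
  case (Suc n)
  have "{T. standard (Suc n) T} \<subseteq> (\<Union>U\<in>{U. standard n U}. (\<lambda>i. add_box (Suc n) i U) ` {..length U})"
  proof
    fix T assume "T \<in> {T. standard (Suc n) T}"
    then have T: "standard (Suc n) T" by simp
    from standard_remove_box[OF T] obtain i where i: "standard n (remove_box (Suc n) T)"
      "addable (row_lengths (shape (remove_box (Suc n) T))) i"
      "T = add_box (Suc n) i (remove_box (Suc n) T)" by blast
    then show "T \<in> (\<Union>U\<in>{U. standard n U}. (\<lambda>i. add_box (Suc n) i U) ` {..length U})"
      using addable_le_length[OF i(2)] by blast
  qed
  then show ?case by (rule finite_subset) (use Suc in simp)
qed (simp add: standard_0_iff)

lemma position_remove_box:
  assumes T: "standard (Suc n) T" and x: "x \<in> {1..n}"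
  shows "row_of T x = row_of (remove_box (Suc n) T) x" "col_of T x = col_of (remove_box (Suc n) T) x"
proof -
  let ?U = "remove_box (Suc n) T"
  from standard_remove_box[OF T] obtain i where i: "standard n ?U"
    "addable (row_lengths (shape ?U)) i" "T = add_box (Suc n) i ?U" by blast
  from entry_cases[OF standard_tableau[OF i(1)] x] obtain a b where
    ab: "a < length ?U" "b < length (?U ! a)" "x = ?U ! a ! b" "row_of ?U x = a" "col_of ?U x = b" by metis
  then have b: "b < row_lengths (shape ?U) a" by (simp add: row_lengths_less_iff)
  have "b < row_lengths (shape T) a"
    using b row_lengths_add_box[OF addable_le_length[OF i(2)], of "Suc n"] i(3)[symmetric]
    by (auto simp: less_Suc_eq)
  then have ab': "a < length T" "b < length (T ! a)" by (simp_all add: row_lengths_less_iff)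
  have "T ! a ! b = x" using add_box_old[OF b, of "Suc n" i] i(3)[symmetric] ab(3) by simp
  then show "row_of T x = row_of ?U x" "col_of T x = col_of ?U x"
    using row_of_entry[OF standard_tableau[OF T] ab'(1), of x] nth_mem[OF ab'(2)]
      col_of_entry[OF standard_tableau[OF T] ab'] ab(4,5) by simp_all
qed

lemma keep_boxes_keep_boxes: "keep_boxes P (keep_boxes Q T) = keep_boxes (\<lambda>x. Q x \<and> P x) T"
proof -
  have "filter Q row = [] \<Longrightarrow> filter (\<lambda>x. Q x \<and> P x) row = []" for row
    by (induction row) (auto split: if_splits)
  then show ?thesis unfolding keep_boxes_def by (induction T) auto
qed

lemma subtableau_remove_box: "k \<le> n \<Longrightarrow> subtableau k (remove_box (Suc n) T) = subtableau k T"
proof -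
  assume "k \<le> n"
  then have "(\<lambda>x. x \<noteq> Suc n \<and> x \<le> k) = (\<lambda>x. x \<le> k)" by auto
  then show ?thesis unfolding subtableau_def remove_box_def keep_boxes_keep_boxes by simp
qed

lemma subtableau_self:
  assumes "standard n T"
  shows "subtableau n T = T"
proof -
  have tab: "is_tableau n T" by (rule standard_tableau[OF assms])
  then have set: "set (concat T) = {1..n}" by (simp add: is_tableau_def)
  have "filter (\<lambda>x. x \<le> n) row = row" if "row \<in> set T" for row
    using set that by (intro filter_True) auto
  then have "map (filter (\<lambda>x. x \<le> n)) T = T" by (rule map_idI)
  moreover have "filter (\<lambda>row. row \<noteq> []) T = T"
    using tab by (intro filter_True) (auto simp: is_tableau_iff)
  ultimately show ?thesis by (simp add: subtableau_def keep_boxes_def)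
qed

section \<open>Counting pairs of standard tableaux\<close>

definition tableaux_with :: "nat \<Rightarrow> (nat \<Rightarrow> nat) \<Rightarrow> tableau set" where
  "tableaux_with n \<mu> = {T. standard n T \<and> row_lengths (shape T) = \<mu>}"

definition diagram :: "(nat \<Rightarrow> nat) \<Rightarrow> bool" where
  "diagram \<mu> \<longleftrightarrow> antimono \<mu> \<and> finite {i. \<mu> i \<noteq> 0}"

abbreviation incr :: "nat \<Rightarrow> (nat \<Rightarrow> nat) \<Rightarrow> nat \<Rightarrow> nat" where
  "incr i \<mu> \<equiv> \<mu>(i := Suc (\<mu> i))"

abbreviation decr :: "nat \<Rightarrow> (nat \<Rightarrow> nat) \<Rightarrow> nat \<Rightarrow> nat" where
  "decr i \<mu> \<equiv> \<mu>(i := \<mu> i - 1)"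

lemma finite_tableaux_with [simp]: "finite (tableaux_with n \<mu>)"
  unfolding tableaux_with_def by (rule finite_subset[OF _ finite_standard[of n]]) blast

lemma tableau_diagram: "is_tableau n T \<Longrightarrow> diagram (row_lengths (shape T))"
proof -
  assume T: "is_tableau n T"
  have "{i. row_lengths (shape T) i \<noteq> 0} \<subseteq> {..<length T}" by (auto simp: row_lengths_shape)
  then have "finite {i. row_lengths (shape T) i \<noteq> 0}" by (rule finite_subset) simp
  then show ?thesis using is_tableau_antimono[OF T] by (simp add: diagram_def)
qed

lemma finite_removable: "diagram \<mu> \<Longrightarrow> finite {i. removable \<mu> i}"
  by (rule finite_subset[of _ "{i. \<mu> i \<noteq> 0}"]) (auto simp: diagram_def removable_def)

text \<open>A row end that can be removed makes room for a box in the row below it, and a box can always be added to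
  the first row.\<close>

lemma addable_eq: "{i. addable \<mu> i} = insert 0 (Suc ` {i. removable \<mu> i})"
proof (intro equalityI subsetI)
  fix i assume "i \<in> {i. addable \<mu> i}"
  then show "i \<in> insert 0 (Suc ` {i. removable \<mu> i})"
    by (cases i) (auto simp: addable_def removable_def)
qed (auto simp: addable_def removable_def)

lemma card_addable: "diagram \<mu> \<Longrightarrow> card {i. addable \<mu> i} = Suc (card {i. removable \<mu> i})"
  unfolding addable_eq by (subst card_insert_disjoint) (auto simp: finite_removable card_image)

lemma finite_addable: "diagram \<mu> \<Longrightarrow> finite {i. addable \<mu> i}"
  unfolding addable_eq by (simp add: finite_removable)

lemma diagram_incr: "diagram \<mu> \<Longrightarrow> addable \<mu> i \<Longrightarrow> diagram (incr i \<mu>)"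
proof -
  assume *: "diagram \<mu>" "addable \<mu> i"
  have "{j. incr i \<mu> j \<noteq> 0} \<subseteq> insert i {j. \<mu> j \<noteq> 0}" by auto
  then have "finite {j. incr i \<mu> j \<noteq> 0}" by (rule finite_subset) (use * in \<open>simp add: diagram_def\<close>)
  then show ?thesis using * antimono_add[of \<mu> i] by (simp add: diagram_def)
qed

lemma diagram_decr: "diagram \<mu> \<Longrightarrow> removable \<mu> i \<Longrightarrow> diagram (decr i \<mu>)"
proof -
  assume *: "diagram \<mu>" "removable \<mu> i"
  have "{j. decr i \<mu> j \<noteq> 0} \<subseteq> {j. \<mu> j \<noteq> 0}" by auto
  then have "finite {j. decr i \<mu> j \<noteq> 0}" by (rule finite_subset) (use * in \<open>simp add: diagram_def\<close>)
  then show ?thesis using * antimono_remove[of \<mu> i] by (simp add: diagram_def)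
qed

lemma removable_incr: "antimono \<mu> \<Longrightarrow> removable (incr i \<mu>) i"
  using antimonoD[of \<mu> i "Suc i"] by (simp add: removable_def)

lemma addable_decr: "antimono \<mu> \<Longrightarrow> removable \<mu> i \<Longrightarrow> addable (decr i \<mu>) i"
  using antimonoD[of \<mu> "i - 1" i] by (auto simp: removable_def addable_def)

lemma incr_decr: "removable \<mu> i \<Longrightarrow> incr i (decr i \<mu>) = \<mu>"
  by (auto simp: removable_def)

lemma add_remove_commute:
  assumes "i \<noteq> j"
  shows "addable \<mu> i \<and> removable (incr i \<mu>) j \<longleftrightarrow> removable \<mu> j \<and> addable (decr j \<mu>) i"
  using assms by (cases i) (auto simp: addable_def removable_def)

lemma tableaux_with_Suc:
  assumes \<mu>: "diagram \<mu>"
  shows "card (tableaux_with (Suc n) \<mu>) = (\<Sum>i\<in>{i. removable \<mu> i}. card (tableaux_with n (decr i \<mu>)))"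
proof -
  have anti: "antimono \<mu>" using \<mu> by (simp add: diagram_def)
  let ?A = "\<lambda>i. add_box (Suc n) i ` tableaux_with n (decr i \<mu>)"
  have U: "addable (row_lengths (shape U)) i" "standard n U"
    if "U \<in> tableaux_with n (decr i \<mu>)" "removable \<mu> i" for U i
    using that addable_decr[OF anti] by (auto simp: tableaux_with_def)
  have "tableaux_with (Suc n) \<mu> = (\<Union>i\<in>{i. removable \<mu> i}. ?A i)"
  proof (intro equalityI subsetI)
    fix T assume "T \<in> tableaux_with (Suc n) \<mu>"
    then have T: "standard (Suc n) T" and sh: "row_lengths (shape T) = \<mu>" by (simp_all add: tableaux_with_def)
    from standard_remove_box[OF T] obtain i where i: "standard n (remove_box (Suc n) T)"
      "addable (row_lengths (shape (remove_box (Suc n) T))) i"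
      "T = add_box (Suc n) i (remove_box (Suc n) T)" by blast
    let ?U = "remove_box (Suc n) T"
    have eq: "\<mu> = incr i (row_lengths (shape ?U))"
      using row_lengths_add_box[OF addable_le_length[OF i(2)], of "Suc n"] i(3) sh by metis
    have "removable \<mu> i"
      unfolding eq by (rule removable_incr[OF is_tableau_antimono[OF standard_tableau[OF i(1)]]])
    moreover have "decr i \<mu> = row_lengths (shape ?U)" unfolding eq by simp
    ultimately show "T \<in> (\<Union>i\<in>{i. removable \<mu> i}. ?A i)"
      using i(1,3) by (auto simp: tableaux_with_def)
  next
    fix T assume "T \<in> (\<Union>i\<in>{i. removable \<mu> i}. ?A i)"
    then obtain i U where i: "removable \<mu> i" "U \<in> tableaux_with n (decr i \<mu>)" "T = add_box (Suc n) i U" by blast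
    have "row_lengths (shape T) = incr i (decr i \<mu>)"
      using row_lengths_add_box[OF addable_le_length[OF U(1)[OF i(2,1)]], of "Suc n"] i(2,3)
      by (simp add: tableaux_with_def)
    then show "T \<in> tableaux_with (Suc n) \<mu>"
      using standard_add_box(1)[OF U(2,1)[OF i(2,1)]] i(3) incr_decr[OF i(1)] by (simp add: tableaux_with_def)
  qed
  moreover have "card (\<Union>i\<in>{i. removable \<mu> i}. ?A i) = (\<Sum>i\<in>{i. removable \<mu> i}. card (?A i))"
  proof (rule card_UN_disjoint)
    show "\<forall>i\<in>{i. removable \<mu> i}. \<forall>j\<in>{i. removable \<mu> i}. i \<noteq> j \<longrightarrow> ?A i \<inter> ?A j = {}"
    proof (intro ballI impI, rule ccontr)
      fix i j assume ij: "i \<in> {i. removable \<mu> i}" "j \<in> {i. removable \<mu> i}" "i \<noteq> j" "?A i \<inter> ?A j \<noteq> {}"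
      then obtain V W where V: "V \<in> tableaux_with n (decr i \<mu>)" and W: "W \<in> tableaux_with n (decr j \<mu>)"
        and eq: "add_box (Suc n) i V = add_box (Suc n) j W" by blast
      have "V = W"
        using standard_add_box(2)[OF U(2,1)[OF V]] standard_add_box(2)[OF U(2,1)[OF W]] ij eq by simp
      then have "decr i \<mu> = decr j \<mu>" using V W by (simp add: tableaux_with_def)
      then have "decr i \<mu> i = \<mu> i" using ij(3) by (metis fun_upd_other)
      then show False using ij(1) by (simp add: removable_def)
    qed
  qed (simp_all add: finite_removable[OF \<mu>])
  moreover have "card (?A i) = card (tableaux_with n (decr i \<mu>))" if "removable \<mu> i" for i
  proof (rule card_image, rule inj_onI)
    fix V W assume "V \<in> tableaux_with n (decr i \<mu>)" "W \<in> tableaux_with n (decr i \<mu>)"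
      "add_box (Suc n) i V = add_box (Suc n) i W"
    then show "V = W"
      using standard_add_box(2)[OF U(2,1)[OF _ that]] by metis
  qed
  ultimately show ?thesis by simp
qed

lemma tableaux_with_0: "\<mu> i \<noteq> 0 \<Longrightarrow> tableaux_with 0 \<mu> = {}"
  by (auto simp: tableaux_with_def standard_0_iff row_lengths_shape)

text \<open>Adding a box and removing a different one commute, while there is one more way to add and then
  remove the same box than to remove and then add it; this is Young's relation for the up and down
  operators on Young's lattice.\<close>

lemma sum_addable:
  assumes "diagram \<mu>"
  shows "(\<Sum>i\<in>{i. addable \<mu> i}. card (tableaux_with (Suc n) (incr i \<mu>))) = Suc n * card (tableaux_with n \<mu>)"
  using assms
proof (induction n arbitrary: \<mu> rule: less_induct)
  case (less n)
  note \<mu> = less.prems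
  have anti: "antimono \<mu>" using \<mu> by (simp add: diagram_def)
  let ?F = "\<lambda>\<nu>. card (tableaux_with n \<nu>)"
  let ?A = "{i. addable \<mu> i}" and ?R = "{j. removable \<mu> j}"
  let ?R' = "\<lambda>i. {j. removable (incr i \<mu>) j}" and ?A' = "\<lambda>j. {i. addable (decr j \<mu>) i}"
  have fin: "finite ?A" "finite ?R" using \<mu> by (simp_all add: finite_addable finite_removable)
  have finR': "finite (?R' i)" if "i \<in> ?A" for i
    using that by (intro finite_removable diagram_incr[OF \<mu>]) simp
  have finA': "finite (?A' j)" if "j \<in> ?R" for j
    using that by (intro finite_addable diagram_decr[OF \<mu>]) simp
  have up: "(\<Sum>j\<in>?R' i. ?F (decr j (incr i \<mu>))) = ?F \<mu> + (\<Sum>j\<in>?R' i - {i}. ?F (decr j (incr i \<mu>)))"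
    if "i \<in> ?A" for i
    using sum.remove[OF finR'[OF that], of i "\<lambda>j. ?F (decr j (incr i \<mu>))"] removable_incr[OF anti, of i] by simp
  have down: "(\<Sum>i\<in>?A' j. ?F (incr i (decr j \<mu>))) = ?F \<mu> + (\<Sum>i\<in>?A' j - {j}. ?F (incr i (decr j \<mu>)))"
    if "j \<in> ?R" for j
    using sum.remove[OF finA'[OF that], of j "\<lambda>i. ?F (incr i (decr j \<mu>))"] addable_decr[OF anti, of j]
      incr_decr[of \<mu> j] that by simp
  have "(\<Sum>i\<in>?A. \<Sum>j\<in>?R' i - {i}. ?F (decr j (incr i \<mu>))) =
      (\<Sum>(i, j)\<in>Sigma ?A (\<lambda>i. ?R' i - {i}). ?F (decr j (incr i \<mu>)))"
    using fin finR' by (subst sum.Sigma) auto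
  also have "\<dots> = (\<Sum>(j, i)\<in>Sigma ?R (\<lambda>j. ?A' j - {j}). ?F (incr i (decr j \<mu>)))"
  proof (rule sum.reindex_bij_witness[of _ prod.swap prod.swap])
    fix p assume "p \<in> Sigma ?A (\<lambda>i. ?R' i - {i})"
    then obtain i j where p: "p = (i, j)" "i \<noteq> j" "addable \<mu> i \<and> removable (incr i \<mu>) j" by auto
    then show "prod.swap p \<in> Sigma ?R (\<lambda>j. ?A' j - {j})"
      using add_remove_commute[OF p(2), of \<mu>] by simp
  next
    fix p assume "p \<in> Sigma ?R (\<lambda>j. ?A' j - {j})"
    then obtain j i where p: "p = (j, i)" "i \<noteq> j" "removable \<mu> j \<and> addable (decr j \<mu>) i" by auto
    then show "prod.swap p \<in> Sigma ?A (\<lambda>i. ?R' i - {i})"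
      using add_remove_commute[OF p(2), of \<mu>] by simp
  next
    fix p assume p: "p \<in> Sigma ?A (\<lambda>i. ?R' i - {i})"
    then have "decr (snd p) (incr (fst p) \<mu>) = incr (fst p) (decr (snd p) \<mu>)" by auto
    then show "(case prod.swap p of (j, i) \<Rightarrow> ?F (incr i (decr j \<mu>))) =
        (case p of (i, j) \<Rightarrow> ?F (decr j (incr i \<mu>)))" by (simp add: case_prod_beta)
  qed simp_all
  also have "\<dots> = (\<Sum>j\<in>?R. \<Sum>i\<in>?A' j - {j}. ?F (incr i (decr j \<mu>)))"
    using fin finA' by (subst sum.Sigma) auto
  finally have mixed: "(\<Sum>i\<in>?A. \<Sum>j\<in>?R' i - {i}. ?F (decr j (incr i \<mu>))) =
      (\<Sum>j\<in>?R. \<Sum>i\<in>?A' j - {j}. ?F (incr i (decr j \<mu>)))" .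
  have "(\<Sum>j\<in>?R. \<Sum>i\<in>?A' j. ?F (incr i (decr j \<mu>))) = n * ?F \<mu>"
  proof (cases n)
    case 0
    have "tableaux_with 0 (incr i \<nu>) = {}" for i \<nu> by (rule tableaux_with_0[of _ i]) simp
    then show ?thesis unfolding 0 by (simp only: card.empty sum.neutral_const mult_0)
  next
    case (Suc m)
    have "(\<Sum>j\<in>?R. \<Sum>i\<in>?A' j. ?F (incr i (decr j \<mu>))) = (\<Sum>j\<in>?R. Suc m * card (tableaux_with m (decr j \<mu>)))"
    proof (rule sum.cong[OF refl])
      fix j assume "j \<in> ?R"
      then have "diagram (decr j \<mu>)" by (intro diagram_decr[OF \<mu>]) simp
      from less.IH[OF _ this, of m] show "(\<Sum>i\<in>?A' j. ?F (incr i (decr j \<mu>))) = Suc m * card (tableaux_with m (decr j \<mu>))"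
        unfolding Suc by blast
    qed
    also have "\<dots> = n * ?F \<mu>"
      unfolding Suc tableaux_with_Suc[OF \<mu>] by (rule sum_distrib_left[symmetric])
    finally show ?thesis .
  qed
  moreover have "(\<Sum>j\<in>?R. \<Sum>i\<in>?A' j. ?F (incr i (decr j \<mu>))) =
      card ?R * ?F \<mu> + (\<Sum>j\<in>?R. \<Sum>i\<in>?A' j - {j}. ?F (incr i (decr j \<mu>)))"
    by (simp only: sum.cong[OF refl down] sum.distrib sum_constant of_nat_id)
  moreover have "(\<Sum>i\<in>?A. card (tableaux_with (Suc n) (incr i \<mu>))) =
      card ?A * ?F \<mu> + (\<Sum>i\<in>?A. \<Sum>j\<in>?R' i - {i}. ?F (decr j (incr i \<mu>)))"
  proof -
    have "(\<Sum>i\<in>?A. card (tableaux_with (Suc n) (incr i \<mu>))) = (\<Sum>i\<in>?A. \<Sum>j\<in>?R' i. ?F (decr j (incr i \<mu>)))"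
      by (intro sum.cong refl tableaux_with_Suc diagram_incr[OF \<mu>]) simp
    then show ?thesis by (simp only: sum.cong[OF refl up] sum.distrib sum_constant of_nat_id)
  qed
  moreover have "L = Suc n * F" if "D = n * F" "D = R * F + P" "L = A * F + Q" "Q = P" "A = Suc R"
    for L D R P A Q F :: nat
    using that by simp
  ultimately show ?case using mixed card_addable[OF \<mu>] by blast
qed

text \<open>Summing over the tableaux of size \<open>n\<close> in place of the shapes, \<open>sum_addable\<close> multiplies the number of
  pairs by \<open>Suc n\<close> when the size grows from \<open>n\<close> to \<open>Suc n\<close>.\<close>

lemma card_same_shape_pairs:
  "card {(S, T). standard n S \<and> standard n T \<and> shape S = shape T} = fact n"
proof -
  have pairs: "card {(S, T). standard n S \<and> standard n T \<and> shape S = shape T} =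
      (\<Sum>T\<in>{T. standard n T}. card (tableaux_with n (row_lengths (shape T))))" for n
  proof -
    have inj: "shape S = shape T \<longleftrightarrow> row_lengths (shape S) = row_lengths (shape T)"
      if "standard n S" "standard n T" for S T
    proof
      have "0 \<notin> set (shape S)" "0 \<notin> set (shape T)"
        using that[THEN standard_tableau] unfolding is_tableau_def partition_of_def by blast+
      then show "row_lengths (shape S) = row_lengths (shape T) \<Longrightarrow> shape S = shape T"
        by (rule row_lengths_inject)
    qed simp
    have "{(S, T). standard n S \<and> standard n T \<and> shape S = shape T} =
        prod.swap ` (SIGMA T:{T. standard n T}. tableaux_with n (row_lengths (shape T)))"
    proof (intro equalityI subsetI)
      fix p assume "p \<in> {(S, T). standard n S \<and> standard n T \<and> shape S = shape T}"
      then obtain S T where p: "p = prod.swap (T, S)" "standard n S" "standard n T" "shape S = shape T" by auto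
      have "(T, S) \<in> (SIGMA T:{T. standard n T}. tableaux_with n (row_lengths (shape T)))"
        using p by (simp add: tableaux_with_def)
      with p(1) show "p \<in> prod.swap ` (SIGMA T:{T. standard n T}. tableaux_with n (row_lengths (shape T)))"
        by (rule image_eqI)
    next
      fix p assume "p \<in> prod.swap ` (SIGMA T:{T. standard n T}. tableaux_with n (row_lengths (shape T)))"
      then obtain S T where p: "p = (S, T)" "standard n T" "S \<in> tableaux_with n (row_lengths (shape T))" by auto
      then show "p \<in> {(S, T). standard n S \<and> standard n T \<and> shape S = shape T}"
        using inj[of S T] by (simp add: tableaux_with_def)
    qed
    then show ?thesis by (simp add: card_image)
  qed
  have "(\<Sum>T\<in>{T. standard n T}. card (tableaux_with n (row_lengths (shape T)))) = fact n"
  proof (induction n)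
    case 0
    have "tableaux_with 0 (row_lengths (shape [])) = {[]}"
      by (auto simp: tableaux_with_def standard_0_iff)
    then show ?case by (simp add: standard_0_iff)
  next
    case (Suc n)
    let ?B = "SIGMA U:{U. standard n U}. {i. addable (row_lengths (shape U)) i}"
    let ?add = "\<lambda>(U, i). add_box (Suc n) i U"
    have img: "{T. standard (Suc n) T} = ?add ` ?B"
    proof (intro equalityI subsetI)
      fix T assume "T \<in> {T. standard (Suc n) T}"
      then have T: "standard (Suc n) T" by simp
      from standard_remove_box[OF T] obtain i where "standard n (remove_box (Suc n) T)"
        "addable (row_lengths (shape (remove_box (Suc n) T))) i"
        "T = add_box (Suc n) i (remove_box (Suc n) T)" by blast
      then show "T \<in> ?add ` ?B" by (intro image_eqI[of _ _ "(remove_box (Suc n) T, i)"]) auto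
    qed (auto intro: standard_add_box(1))
    have inj: "inj_on ?add ?B"
    proof (rule inj_onI)
      fix p q assume p: "p \<in> ?B" and q: "q \<in> ?B" and eq: "?add p = ?add q"
      obtain U i V j where pq: "p = (U, i)" "q = (V, j)" by (metis surj_pair)
      have U: "standard n U" "addable (row_lengths (shape U)) i" "standard n V" "addable (row_lengths (shape V)) j"
        using p q pq by auto
      have e: "add_box (Suc n) i U = add_box (Suc n) j V" using eq pq by simp
      then have UV: "U = V" using standard_add_box(2)[OF U(1,2)] standard_add_box(2)[OF U(3,4)] by metis
      have "incr i (row_lengths (shape U)) = incr j (row_lengths (shape U))"
        using row_lengths_add_box[OF addable_le_length[OF U(2)], of "Suc n"]
          row_lengths_add_box[OF addable_le_length[OF U(4)], of "Suc n"] e UV by metis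
      then have "i = j" by (metis fun_upd_apply n_not_Suc_n)
      then show "p = q" using pq UV by simp
    qed
    have dia: "diagram (row_lengths (shape U))" if "standard n U" for U
      using that by (intro tableau_diagram standard_tableau)
    have "(\<Sum>T\<in>{T. standard (Suc n) T}. card (tableaux_with (Suc n) (row_lengths (shape T)))) =
        (\<Sum>(U, i)\<in>?B. card (tableaux_with (Suc n) (incr i (row_lengths (shape U)))))"
      unfolding img
      by (subst sum.reindex[OF inj])
        (auto intro!: sum.cong simp: row_lengths_add_box[OF addable_le_length])
    also have "\<dots> = (\<Sum>U\<in>{U. standard n U}. \<Sum>i\<in>{i. addable (row_lengths (shape U)) i}.
        card (tableaux_with (Suc n) (incr i (row_lengths (shape U)))))"
      using dia by (subst sum.Sigma) (auto simp: finite_addable)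
    also have "\<dots> = (\<Sum>U\<in>{U. standard n U}. Suc n * card (tableaux_with n (row_lengths (shape U))))"
      by (intro sum.cong refl sum_addable dia) simp
    also have "\<dots> = Suc n * fact n" by (simp only: sum_distrib_left[symmetric] Suc.IH)
    finally show ?case by simp
  qed
  then show ?thesis by (simp only: pairs)
qed

section \<open>Normalised Young symmetrizers and the seminormal recursion\<close>

abbreviation rows :: "nat \<Rightarrow> tableau \<Rightarrow> 'k::field_char_0 group_alg" where
  "rows n T \<equiv> row_sum n (row_of T)"

abbreviation cols :: "nat \<Rightarrow> tableau \<Rightarrow> 'k::field_char_0 group_alg" where
  "cols n T \<equiv> col_sum n (col_of T)"

abbreviation tab_kappa :: "nat \<Rightarrow> tableau \<Rightarrow> 'k::field_char_0" where
  "tab_kappa n T \<equiv> kappa n (row_of T) (col_of T)"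

definition young_idem :: "nat \<Rightarrow> tableau \<Rightarrow> 'k::field_char_0 group_alg" where
  "young_idem n T = scalar (1 / tab_kappa n T) * tab_elem n T"

text \<open>Normalising by the scalar of \<open>young_elem_square\<close> makes the Young symmetrizers idempotent from the start, and
  the recursion can begin with the empty tableau.\<close>

fun path_idem :: "nat \<Rightarrow> tableau \<Rightarrow> 'k::field_char_0 group_alg" where
  "path_idem 0 T = 1"
| "path_idem (Suc n) T =
     path_idem n (remove_box (Suc n) T) * young_idem (Suc n) T * path_idem n (remove_box (Suc n) T)"

lemma young_idem_sym_alg [simp]: "young_idem n T \<in> sym_alg n"
  unfolding young_idem_def by (intro sym_alg_mult) auto

lemma path_idem_sym_alg [simp]: "(path_idem n T :: 'k::field_char_0 group_alg) \<in> sym_alg n"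
proof (induction n arbitrary: T)
  case (Suc n)
  have "(path_idem n (remove_box (Suc n) T) :: 'k group_alg) \<in> sym_alg (Suc n)"
    by (rule sym_alg_mono[OF _ Suc]) simp
  then show ?case by (simp add: sym_alg_mult)
qed simp

lemma young_idem_tau:
  assumes "is_tableau n T"
  shows "tau (young_idem n T) = 1 / (tab_kappa n T :: 'k::field_char_0)"
  by (simp only: young_idem_def lookup_scalar_mult tau_young_elem[OF tableau_filling[OF assms]] mult_1_right)

lemma scalar_mult_scalar: "(scalar c * x) * (scalar d * y) = scalar (c * d) * (x * y)"
  by (simp only: mult.assoc[of "scalar c"] scalar_left_commute[of x] scalar_mult_assoc)

lemma young_idem_idem:
  assumes "is_tableau n T"
  shows "young_idem n T * young_idem n T = (young_idem n T :: 'k::field_char_0 group_alg)"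
proof -
  have "tab_kappa n T \<noteq> (0 :: 'k)" by (rule kappa_nonzero[OF tableau_filling[OF assms]])
  then show ?thesis
    by (simp only: young_idem_def scalar_mult_scalar young_elem_square[OF tableau_filling[OF assms]]
      scalar_mult_assoc mult.assoc[of "1 / tab_kappa n T :: 'k"]) simp
qed

lemma young_idem_sandwich_expand:
  "young_idem n S * x * young_idem n T =
    scalar (1 / tab_kappa n S * (1 / tab_kappa n T)) * (tab_elem n S * x * tab_elem n T)"
  unfolding young_idem_def mult.assoc[of "scalar (1 / tab_kappa n S)" "tab_elem n S" x]
  by (rule scalar_mult_scalar)

text \<open>The subalgebra \<open>y * A * y\<close> is a line, because \<open>a * A * b\<close> is one.\<close>

lemma young_idem_sandwich:
  assumes T: "is_tableau n T" and x: "x \<in> sym_alg n"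
  shows "young_idem n T * x * young_idem n T =
    scalar (tab_kappa n T * tau (young_idem n T * x)) * (young_idem n T :: 'k::field_char_0 group_alg)"
proof -
  let ?y = "young_idem n T :: 'k group_alg" and ?\<kappa> = "tab_kappa n T :: 'k"
  have \<kappa>: "?\<kappa> \<noteq> 0" by (rule kappa_nonzero[OF tableau_filling[OF T]])
  have mem: "cols n T * x * rows n T \<in> sym_alg n" by (intro sym_alg_mult twisted_sum_sym_alg x)
  have "tab_elem n T * x * tab_elem n T = rows n T * (cols n T * x * rows n T) * cols n T"
    by (simp only: young_elem_def mult.assoc)
  also have "\<dots> = scalar (tau (cols n T * rows n T * (cols n T * x * rows n T))) * tab_elem n T"
    by (rule sandwich_young[OF tableau_filling[OF T] mem])
  finally obtain t where t: "tab_elem n T * x * tab_elem n T = scalar t * tab_elem n T" by blast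
  have y: "?y * x * ?y = scalar (1 / ?\<kappa> * t) * ?y"
    unfolding young_idem_sandwich_expand t
    by (simp only: young_idem_def scalar_mult_assoc mult.assoc mult.commute[of t])
  have "tau (?y * x) = tau (?y * ?y * x)" by (simp only: young_idem_idem[OF T])
  also have "\<dots> = tau (?y * x * ?y)" by (simp only: mult.assoc tau_commute[of ?y])
  also have "\<dots> = 1 / ?\<kappa> * t * (1 / ?\<kappa>)"
    unfolding y lookup_scalar_mult young_idem_tau[OF T] ..
  finally have "1 / ?\<kappa> * t = ?\<kappa> * tau (?y * x)" using \<kappa> by simp
  then show ?thesis using y by simp
qed

lemma standard_shapes_differ:
  assumes S: "standard n S" and T: "standard n T" and ne: "shape S \<noteq> shape T"
  shows "(\<forall>x\<in>sym_alg n. rows n S * x * cols n T = (0 :: 'k::field_char_0 group_alg) \<and>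
            cols n T * x * rows n S = (0 :: 'k group_alg)) \<or>
         (\<forall>x\<in>sym_alg n. rows n T * x * cols n S = (0 :: 'k group_alg) \<and>
            cols n S * x * rows n T = (0 :: 'k group_alg))"
proof -
  note tab = standard_tableau[OF S] standard_tableau[OF T]
  have "0 \<notin> set (shape S)" "0 \<notin> set (shape T)"
    using tab unfolding is_tableau_def partition_of_def by blast+
  then have "row_lengths (shape S) \<noteq> row_lengths (shape T)" using ne row_lengths_inject by blast
  then show ?thesis
    by (rule shapes_differ[OF tableau_filling tableau_filling is_tableau_antimono is_tableau_antimono,
        OF tab tab])
qed

lemma young_idem_orthogonal:
  assumes S: "standard n S" and T: "standard n T" and ne: "shape S \<noteq> shape T" and x: "x \<in> sym_alg n"
  shows "young_idem n S * x * young_idem n T = (0 :: 'k::field_char_0 group_alg)"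
proof -
  have "tab_elem n S * x * tab_elem n T = (0 :: 'k group_alg)"
    using standard_shapes_differ[OF S T ne, where ?'k = 'k]
  proof
    assume *: "\<forall>x\<in>sym_alg n. rows n S * x * cols n T = (0 :: 'k group_alg) \<and> cols n T * x * rows n S = 0"
    have "tab_elem n S * x * tab_elem n T = rows n S * (cols n S * x * rows n T) * cols n T"
      by (simp only: young_elem_def mult.assoc)
    moreover have "cols n S * x * rows n T \<in> sym_alg n" by (intro sym_alg_mult twisted_sum_sym_alg x)
    ultimately show ?thesis using * by simp
  next
    assume *: "\<forall>x\<in>sym_alg n. rows n T * x * cols n S = (0 :: 'k group_alg) \<and> cols n S * x * rows n T = 0"
    have "tab_elem n S * x * tab_elem n T = rows n S * (cols n S * x * rows n T) * cols n T"
      by (simp only: young_elem_def mult.assoc)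
    then show ?thesis using * x by simp
  qed
  then show ?thesis by (simp only: young_idem_sandwich_expand mult_zero_right)
qed

lemma fiber_stab_remove_box:
  assumes T: "standard (Suc n) T"
  shows "fiber_stab n (row_of (remove_box (Suc n) T)) \<subseteq> fiber_stab (Suc n) (row_of T)"
    and "fiber_stab n (col_of (remove_box (Suc n) T)) \<subseteq> fiber_stab (Suc n) (col_of T)"
proof -
  have *: "fiber_stab n f' \<subseteq> fiber_stab (Suc n) f" if f: "\<And>x. x \<in> {1..n} \<Longrightarrow> f x = f' x" for f f' :: "nat \<Rightarrow> nat"
  proof
    fix \<sigma> assume \<sigma>: "\<sigma> \<in> fiber_stab n f'"
    then have n: "\<sigma> \<in> sym_group n" by (simp add: fiber_stab_def)
    have "f (app_perm \<sigma> x) = f x" if x: "x \<in> {1..Suc n}" for x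
    proof (cases "x \<in> {1..n}")
      case True
      then have "app_perm \<sigma> x \<in> {1..n}" using sym_group_app_mem[OF n] by blast
      then show ?thesis using f True \<sigma> unfolding fiber_stab_def by simp
    next
      case False
      then have "app_perm \<sigma> x = x" using n unfolding sym_group_def permutes_def by blast
      then show ?thesis by simp
    qed
    moreover have "\<sigma> \<in> sym_group (Suc n)" using n sym_group_mono[of n "Suc n"] by auto
    ultimately show "\<sigma> \<in> fiber_stab (Suc n) f" by (simp add: fiber_stab_def)
  qed
  show "fiber_stab n (row_of (remove_box (Suc n) T)) \<subseteq> fiber_stab (Suc n) (row_of T)"
    by (rule *) (rule position_remove_box(1)[OF T])
  show "fiber_stab n (col_of (remove_box (Suc n) T)) \<subseteq> fiber_stab (Suc n) (col_of T)"
    by (rule *) (rule position_remove_box(2)[OF T])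
qed

text \<open>The stabilizers of the smaller tableau are contained in those of \<open>T\<close>, so the row and column sums of \<open>T\<close> are
  multiples of the smaller ones.\<close>

lemma absorb_remove_box:
  assumes T: "standard (Suc n) T"
  shows "cols n (remove_box (Suc n) T) * x = 0 \<Longrightarrow> cols (Suc n) T * x = (0 :: 'k::field_char_0 group_alg)"
    and "x * rows n (remove_box (Suc n) T) = 0 \<Longrightarrow> x * rows (Suc n) T = (0 :: 'k group_alg)"
proof -
  let ?c = "of_nat (card (fiber_stab n (col_of (remove_box (Suc n) T)))) :: 'k"
  have nz: "?c \<noteq> 0"
    using fiber_stab_zero[of n "col_of (remove_box (Suc n) T)"] by (auto simp del: fiber_stab_zero)
  assume "cols n (remove_box (Suc n) T) * x = 0"
  then have "scalar ?c * cols (Suc n) T * x = 0"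
    by (simp only: twisted_sum_absorb(1)[OF sign_character_perm_sign fiber_stab_remove_box(2)[OF T], symmetric]
        mult.assoc mult_zero_right)
  then show "cols (Suc n) T * x = 0"
    using scalar_cancel_left[OF nz, of "cols (Suc n) T * x" 0] by (simp only: mult.assoc mult_zero_right)
next
  let ?r = "of_nat (card (fiber_stab n (row_of (remove_box (Suc n) T)))) :: 'k"
  have nz: "?r \<noteq> 0"
    using fiber_stab_zero[of n "row_of (remove_box (Suc n) T)"] by (auto simp del: fiber_stab_zero)
  assume 0: "x * rows n (remove_box (Suc n) T) = 0"
  have "scalar ?r * (x * rows (Suc n) T) = x * (rows n (remove_box (Suc n) T) * rows (Suc n) T)"
    by (simp only: twisted_sum_absorb(2)[OF sign_character_one fiber_stab_remove_box(1)[OF T]] scalar_left_commute)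
  also have "\<dots> = 0" using 0 by (simp only: mult.assoc[symmetric] mult_zero_left)
  finally show "x * rows (Suc n) T = 0"
    using scalar_cancel_left[OF nz, of "x * rows (Suc n) T" 0] by (simp only: mult_zero_right)
qed

text \<open>At the size where the paths of \<open>S\<close> and \<open>T\<close> part, their shapes differ and \<open>shapes_differ\<close> applies.  Either kind
  of vanishing is then inherited by all larger tableaux.\<close>

lemma path_idem_triangular:
  assumes "standard n S" "standard n T" "S \<noteq> T"
  shows "cols n T * path_idem n S = (0 :: 'k::field_char_0 group_alg) \<or>
    path_idem n S * rows n T = (0 :: 'k group_alg)"
  using assms
proof (induction n arbitrary: S T)
  case 0
  then show ?case by (simp add: standard_0_iff)
next
  case (Suc n)
  note S = Suc.prems(1) and T = Suc.prems(2)
  let ?S = "remove_box (Suc n) S" and ?T = "remove_box (Suc n) T"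
  let ?e = "path_idem n ?S :: 'k group_alg" and ?y = "young_idem (Suc n) S :: 'k group_alg"
  have S': "standard n ?S" using standard_remove_box[OF S] by blast
  have T': "standard n ?T" using standard_remove_box[OF T] by blast
  have e: "?e \<in> sym_alg (Suc n)" by (rule sym_alg_mono[OF _ path_idem_sym_alg]) simp
  show ?case
  proof (cases "?S = ?T")
    case False
    from Suc.IH[OF S' T' False] show ?thesis
    proof
      assume "cols n ?T * path_idem n ?S = (0 :: 'k group_alg)"
      then have "cols (Suc n) T * ?e = 0" by (rule absorb_remove_box(1)[OF T])
      then show ?thesis by (simp add: mult.assoc[symmetric])
    next
      assume "path_idem n ?S * rows n ?T = (0 :: 'k group_alg)"
      then have "?e * rows (Suc n) T = 0" by (rule absorb_remove_box(2)[OF T])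
      then show ?thesis by (simp add: mult.assoc)
    qed
  next
    case True
    then have "shape S \<noteq> shape T" using Suc.prems(3) standard_Suc_eq[OF S T] by blast
    from standard_shapes_differ[OF S T this, where ?'k = 'k] show ?thesis
    proof
      assume *: "\<forall>x\<in>sym_alg (Suc n). rows (Suc n) S * x * cols (Suc n) T = (0 :: 'k group_alg) \<and>
        cols (Suc n) T * x * rows (Suc n) S = 0"
      have "cols (Suc n) T * path_idem (Suc n) S = scalar (1 / tab_kappa (Suc n) S) *
          ((cols (Suc n) T * ?e * rows (Suc n) S) * cols (Suc n) S * ?e)"
        by (simp only: path_idem.simps young_idem_def young_elem_def mult.assoc scalar_left_commute)
      then show ?thesis using * e by simp
    next
      assume *: "\<forall>x\<in>sym_alg (Suc n). rows (Suc n) T * x * cols (Suc n) S = (0 :: 'k group_alg) \<and>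
        cols (Suc n) S * x * rows (Suc n) T = 0"
      have "path_idem (Suc n) S * rows (Suc n) T = scalar (1 / tab_kappa (Suc n) S) *
          (?e * rows (Suc n) S * (cols (Suc n) S * ?e * rows (Suc n) T))"
        by (simp only: path_idem.simps young_idem_def young_elem_def mult.assoc scalar_left_commute)
      then show ?thesis using * e by simp
    qed
  qed
qed

text \<open>The induction hypothesis for the passage from size \<open>n\<close> to size \<open>Suc n\<close>.  The type argument names the field,
  which the other argument does not determine.\<close>

definition path_system :: "'k::field_char_0 itself \<Rightarrow> nat \<Rightarrow> bool" where
  "path_system k n \<longleftrightarrow>
     (\<forall>S T. standard n S \<longrightarrow> standard n T \<longrightarrow>
        path_idem n S * path_idem n T = (if S = T then path_idem n S else (0 :: 'k group_alg))) \<and>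
     (\<Sum>T\<in>{T. standard n T}. path_idem n T) = (1 :: 'k group_alg)"

lemma path_system_mult:
  "path_system TYPE('k::field_char_0) n \<Longrightarrow> standard n S \<Longrightarrow> standard n T \<Longrightarrow>
    path_idem n S * path_idem n T = (if S = T then path_idem n S else (0 :: 'k group_alg))"
  unfolding path_system_def by blast

lemma path_system_sum:
  "path_system TYPE('k::field_char_0) n \<Longrightarrow> (\<Sum>T\<in>{T. standard n T}. path_idem n T) = (1 :: 'k group_alg)"
  unfolding path_system_def by blast

lemma path_system_0: "path_system TYPE('k::field_char_0) 0"
  by (simp add: path_system_def standard_0_iff)

text \<open>Expanding the middle of \<open>y * 1 * y\<close> by a complete path system one size below, triangularity leaves
  the single term of the path through \<open>T\<close>.\<close>

lemma young_idem_absorb: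
  assumes sys: "path_system TYPE('k::field_char_0) n" and T: "standard (Suc n) T"
  shows "young_idem (Suc n) T * path_idem n (remove_box (Suc n) T) * young_idem (Suc n) T =
    (young_idem (Suc n) T :: 'k group_alg)"
proof -
  let ?y = "young_idem (Suc n) T :: 'k group_alg" and ?T = "remove_box (Suc n) T"
  have T': "standard n ?T" using standard_remove_box[OF T] by blast
  have zero: "?y * path_idem n U * ?y = 0" if U: "standard n U" "U \<noteq> ?T" for U
    using path_idem_triangular[OF U(1) T' U(2), where ?'k = 'k]
  proof
    assume "cols n ?T * path_idem n U = (0 :: 'k group_alg)"
    then have "cols (Suc n) T * path_idem n U = (0 :: 'k group_alg)" by (rule absorb_remove_box(1)[OF T])
    then have "?y * path_idem n U = 0"
      by (simp only: young_idem_def young_elem_def mult.assoc mult_zero_right)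
    then show ?thesis by simp
  next
    assume "path_idem n U * rows n ?T = (0 :: 'k group_alg)"
    then have "path_idem n U * rows (Suc n) T = (0 :: 'k group_alg)" by (rule absorb_remove_box(2)[OF T])
    then have "scalar (1 / tab_kappa (Suc n) T) * ((path_idem n U * rows (Suc n) T) * cols (Suc n) T) = (0 :: 'k group_alg)"
      by (simp only: mult_zero_left mult_zero_right)
    then have "path_idem n U * ?y = 0"
      by (simp only: young_idem_def young_elem_def scalar_left_commute mult.assoc)
    then show ?thesis by (simp only: mult.assoc mult_zero_right)
  qed
  have "?y = ?y * (\<Sum>U\<in>{U. standard n U}. path_idem n U) * ?y"
    by (simp only: path_system_sum[OF sys] mult_1_right young_idem_idem[OF standard_tableau[OF T]])
  also have "\<dots> = (\<Sum>U\<in>{U. standard n U}. ?y * path_idem n U * ?y)"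
    by (simp only: sum_distrib_left sum_distrib_right)
  also have "\<dots> = (\<Sum>U\<in>{?T}. ?y * path_idem n U * ?y)"
    by (rule sum.mono_neutral_right) (use T' zero in auto)
  finally show ?thesis by simp
qed

lemma sandwich_idem:
  fixes e y :: "'a::semigroup_mult"
  assumes "e * e = e" "y * e * y = y"
  shows "(e * y * e) * (e * y * e) = e * y * e"
proof -
  have "(e * y * e) * (e * y * e) = e * y * (e * e) * y * e" by (simp only: mult.assoc)
  also have "\<dots> = e * (y * e * y) * e" by (simp only: assms(1) mult.assoc)
  finally show ?thesis by (simp only: assms(2))
qed

lemma path_idem_mult:
  assumes sys: "path_system TYPE('k::field_char_0) n" and S: "standard (Suc n) S" and T: "standard (Suc n) T"
  shows "path_idem (Suc n) S * path_idem (Suc n) T = (if S = T then path_idem (Suc n) S else (0 :: 'k group_alg))"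
proof -
  let ?S = "remove_box (Suc n) S" and ?T = "remove_box (Suc n) T"
  let ?e = "path_idem n ?S :: 'k group_alg" and ?f = "path_idem n ?T :: 'k group_alg"
  let ?y = "young_idem (Suc n) S :: 'k group_alg" and ?z = "young_idem (Suc n) T :: 'k group_alg"
  have S': "standard n ?S" using standard_remove_box[OF S] by blast
  have T': "standard n ?T" using standard_remove_box[OF T] by blast
  show ?thesis
  proof (cases "S = T")
    case True
    have "?e * ?e = ?e" using path_system_mult[OF sys S' S'] by simp
    from sandwich_idem[OF this young_idem_absorb[OF sys S]] show ?thesis
      using True by (simp only: path_idem.simps if_True simp_thms)
  next
    case False
    have "?y * (?e * ?f) * ?z = 0"
    proof (cases "?S = ?T")
      case True
      then have "shape S \<noteq> shape T" using False standard_Suc_eq[OF S T] by blast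
      moreover have "?e * ?f \<in> sym_alg (Suc n)"
        by (intro sym_alg_mult sym_alg_mono[OF _ path_idem_sym_alg]) simp_all
      ultimately show ?thesis by (intro young_idem_orthogonal[OF S T])
    next
      case False
      then show ?thesis using path_system_mult[OF sys S' T'] by simp
    qed
    moreover have "path_idem (Suc n) S * path_idem (Suc n) T = ?e * (?y * (?e * ?f) * ?z) * ?f"
      by (simp only: path_idem.simps mult.assoc)
    ultimately show ?thesis using False by simp
  qed
qed

lemma path_idem_orthogonal:
  assumes S: "standard n S" and T: "standard n T" and ne: "shape S \<noteq> shape T" and x: "x \<in> sym_alg n"
  shows "path_idem n S * x * path_idem n T = (0 :: 'k::field_char_0 group_alg)"
proof (cases n)
  case 0
  then show ?thesis using S T ne by (simp add: standard_0_iff)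
next
  case (Suc m)
  let ?e = "path_idem m (remove_box n S) :: 'k group_alg" and ?f = "path_idem m (remove_box n T) :: 'k group_alg"
  have "path_idem n S * x * path_idem n T = ?e * (young_idem n S * (?e * x * ?f) * young_idem n T) * ?f"
    unfolding Suc by (simp only: path_idem.simps mult.assoc)
  moreover have "?e * x * ?f \<in> sym_alg n"
    using Suc by (intro sym_alg_mult x sym_alg_mono[OF _ path_idem_sym_alg]) simp_all
  ultimately show ?thesis
    by (simp only: young_idem_orthogonal[OF S T ne] mult_zero_left mult_zero_right)
qed

lemma tau_path_idem:
  assumes sys: "path_system TYPE('k::field_char_0) n" and T: "standard (Suc n) T"
  shows "tau (path_idem (Suc n) T) = 1 / (tab_kappa (Suc n) T :: 'k)"
proof -
  let ?e = "path_idem n (remove_box (Suc n) T) :: 'k group_alg" and ?y = "young_idem (Suc n) T :: 'k group_alg"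
  have T': "standard n (remove_box (Suc n) T)" using standard_remove_box[OF T] by blast
  have ee: "?e * ?e = ?e" using path_system_mult[OF sys T' T'] by simp
  have yy: "?y * ?y = ?y" by (rule young_idem_idem[OF standard_tableau[OF T]])
  have "tau (path_idem (Suc n) T) = tau (?e * (?e * ?y))"
    by (simp only: path_idem.simps tau_commute[of "?e * ?y" ?e])
  also have "\<dots> = tau (?e * (?y * ?y))" by (simp only: mult.assoc[symmetric, of ?e ?e ?y] ee yy)
  also have "\<dots> = tau (?y * ?e * ?y)" by (simp only: mult.assoc[symmetric] tau_commute[of "?e * ?y" ?y])
  also have "\<dots> = tau ?y" by (simp only: young_idem_absorb[OF sys T])
  finally show ?thesis by (simp only: young_idem_tau[OF standard_tableau[OF T]])
qed

lemma path_idem_nonzero: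
  assumes sys: "path_system TYPE('k::field_char_0) n" and T: "standard (Suc n) T"
  shows "path_idem (Suc n) T \<noteq> (0 :: 'k group_alg)"
proof
  assume "path_idem (Suc n) T = (0 :: 'k group_alg)"
  then have "1 / (tab_kappa (Suc n) T :: 'k) = 0" using tau_path_idem[OF sys T] by simp
  then show False using kappa_nonzero[OF tableau_filling[OF standard_tableau[OF T]], where ?'k = 'k] by simp
qed

section \<open>Matrix units\<close>

text \<open>A relabelling \<open>s\<close> conjugates the Young symmetrizers \<open>y\<close> of \<open>S\<close> and \<open>z\<close> of \<open>T\<close> into each other, and cutting \<open>y * s\<close>
  down by the shorter paths gives a matrix unit \<open>u\<close>.  It is an isomorphism between the right ideals because
  \<open>z * f * z = z\<close>, and it spans its corner because \<open>y * A * y\<close> is a line.  The functional with coefficient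
  element \<open>r\<close> reads off the multiple of \<open>u\<close>.\<close>

lemma path_idem_corner:
  assumes sys: "path_system TYPE('k::field_char_0) n"
    and S: "standard (Suc n) S" and T: "standard (Suc n) T" and sh: "shape S = shape T"
  obtains u v r :: "'k::field_char_0 group_alg" where
    "u \<in> sym_alg (Suc n)" "v \<in> sym_alg (Suc n)"
    "path_idem (Suc n) S * u * path_idem (Suc n) T = u"
    "path_idem (Suc n) S = u * path_idem (Suc n) T * v"
    "\<And>x. x \<in> sym_alg (Suc n) \<Longrightarrow> path_idem (Suc n) S * x * path_idem (Suc n) T = scalar (tau (r * x)) * u"
    "tau (r * u) = 1"
proof -
  let ?S = "remove_box (Suc n) S" and ?T = "remove_box (Suc n) T"
  let ?e = "path_idem n ?S :: 'k group_alg" and ?f = "path_idem n ?T :: 'k group_alg"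
  let ?y = "young_idem (Suc n) S :: 'k group_alg" and ?z = "young_idem (Suc n) T :: 'k group_alg"
  let ?E = "path_idem (Suc n) S :: 'k group_alg" and ?F = "path_idem (Suc n) T :: 'k group_alg"
  note tabS = standard_tableau[OF S] and tabT = standard_tableau[OF T]
  have S': "standard n ?S" using standard_remove_box[OF S] by blast
  have T': "standard n ?T" using standard_remove_box[OF T] by blast
  have ee: "?e * ?e = ?e" using path_system_mult[OF sys S' S'] by simp
  have ff: "?f * ?f = ?f" using path_system_mult[OF sys T' T'] by simp
  have yey: "?y * ?e * ?y = ?y" by (rule young_idem_absorb[OF sys S])
  have zfz: "?z * ?f * ?z = ?z" by (rule young_idem_absorb[OF sys T])
  have yy: "?y * ?y = ?y" by (rule young_idem_idem[OF tabS])
  have e_mem: "?e \<in> sym_alg (Suc n)" "?f \<in> sym_alg (Suc n)"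
    by (simp_all add: sym_alg_mono[OF _ path_idem_sym_alg])
  have fillS: "filling (Suc n) (row_of S) (col_of S) (row_lengths (shape T))"
    using tableau_filling[OF tabS] unfolding sh .
  from fillings_conjugate[OF tableau_filling[OF tabT] fillS] obtain \<sigma> where
    \<sigma>: "\<sigma> \<in> sym_group (Suc n)" "\<And>x. x \<in> {1..Suc n} \<Longrightarrow> row_of T (app_perm \<sigma> x) = row_of S x"
      "\<And>x. x \<in> {1..Suc n} \<Longrightarrow> col_of T (app_perm \<sigma> x) = col_of S x" by blast
  define s where "s = (basis_elem \<sigma> :: 'k group_alg)"
  define s' where "s' = (basis_elem (- \<sigma>) :: 'k group_alg)"
  have s_mem: "s \<in> sym_alg (Suc n)" "s' \<in> sym_alg (Suc n)" using \<sigma>(1) by (auto simp: s_def s'_def)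
  have ss: "s * s' = 1" "s' * s = 1" by (simp_all add: s_def s'_def basis_mult)
  have conj0: "tab_elem (Suc n) S * s = s * tab_elem (Suc n) T"
    unfolding s_def by (rule young_elem_conjugate[OF \<sigma>(1)]) (simp_all add: \<sigma>(2,3))
  have \<kappa>: "tab_kappa (Suc n) S = (tab_kappa (Suc n) T :: 'k)"
  proof -
    let ?a = "tab_elem (Suc n) S :: 'k group_alg" and ?b = "tab_elem (Suc n) T :: 'k group_alg"
    have "?a * ?a = ?a * s * s' * (?a * s) * s'" using ss by (simp add: mult.assoc)
    also have "\<dots> = s * (?b * (s' * s) * ?b) * s'" by (simp only: conj0 mult.assoc)
    also have "\<dots> = s * (?b * ?b * s')" by (simp only: ss mult_1_right mult.assoc)
    finally have "tau (?a * ?a) = tau (?b * ?b * s' * s)" by (simp only: tau_commute[of s])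
    then show ?thesis unfolding kappa_def by (simp only: mult.assoc ss mult_1_right)
  qed
  have conj: "?y * s = s * ?z"
    unfolding young_idem_def \<kappa> scalar_left_commute mult.assoc conj0 ..
  have z: "?z = s' * ?y * s"
    by (simp only: mult.assoc conj) (simp only: mult.assoc[symmetric] ss mult_1_left)
  define u where "u = ?e * ?y * s * ?f"
  define v where "v = ?z * s' * ?e"
  have u_mem: "u \<in> sym_alg (Suc n)" and v_mem: "v \<in> sym_alg (Suc n)"
    unfolding u_def v_def by (intro sym_alg_mult e_mem s_mem young_idem_sym_alg)+
  have Eu: "?E * u = u"
  proof -
    have "?E * u = ?e * (?y * (?e * ?e) * ?y) * s * ?f" by (simp only: path_idem.simps u_def mult.assoc)
    then show ?thesis by (simp only: ee yey u_def)
  qed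
  have uF: "u * ?F = u"
  proof -
    have "u * ?F = ?e * (?y * s) * (?f * ?f) * ?z * ?f" by (simp only: path_idem.simps u_def mult.assoc)
    also have "\<dots> = ?e * s * (?z * ?f * ?z) * ?f" by (simp only: ff conj mult.assoc)
    also have "\<dots> = ?e * s * ?z * ?f" by (simp only: zfz)
    also have "\<dots> = ?e * (?y * s) * ?f" by (simp only: conj mult.assoc)
    finally show ?thesis by (simp only: u_def mult.assoc)
  qed
  have "u * ?F * v = ?e * (?y * s) * ?f * ?z * s' * ?e"
    by (simp only: uF) (simp only: u_def v_def mult.assoc)
  also have "\<dots> = ?e * s * (?z * ?f * ?z) * s' * ?e" by (simp only: conj mult.assoc)
  also have "\<dots> = ?e * s * ?z * s' * ?e" by (simp only: zfz)
  also have "\<dots> = ?e * (s * ?z) * s' * ?e" by (simp only: mult.assoc)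
  also have "\<dots> = ?e * ?y * (s * s') * ?e" by (simp only: conj[symmetric] mult.assoc)
  finally have E: "?E = u * ?F * v" by (simp only: ss mult_1_right path_idem.simps)
  \<comment> \<open>The coefficient in \<open>young_idem_sandwich\<close>, with the cyclic invariance of \<open>tau\<close> used to isolate \<open>x\<close>.\<close>
  define r where "r = scalar (tab_kappa (Suc n) S) * (?f * s' * ?y * ?e)"
  have corner: "?E * x * ?F = scalar (tau (r * x)) * u" if x: "x \<in> sym_alg (Suc n)" for x
  proof -
    let ?w = "?e * x * ?f * s'"
    have w: "?w \<in> sym_alg (Suc n)" by (intro sym_alg_mult e_mem s_mem x)
    have "?E * x * ?F = ?e * (?y * ?w * ?y) * s * ?f"
      by (simp only: path_idem.simps z mult.assoc)
    also have "\<dots> = ?e * (scalar (tab_kappa (Suc n) S * tau (?y * ?w)) * ?y) * s * ?f"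
      by (simp only: young_idem_sandwich[OF tabS w])
    also have "\<dots> = scalar (tab_kappa (Suc n) S * tau (?y * ?w)) * u"
      by (simp only: scalar_left_commute[of ?e] mult.assoc u_def)
    also have "tau (?y * ?w) = tau ((?y * ?e * x) * (?f * s'))" by (simp only: mult.assoc)
    also have "\<dots> = tau ((?f * s') * (?y * ?e * x))" by (rule tau_commute)
    also have "tab_kappa (Suc n) S * \<dots> = tau (r * x)"
      unfolding r_def mult.assoc[of "scalar _"] lookup_scalar_mult by (simp only: mult.assoc)
    finally show ?thesis .
  qed
  have u: "?E * u * ?F = u" by (simp only: Eu uF)
  have "tau (r * u) = 1"
  proof (rule ccontr)
    assume ne: "tau (r * u) \<noteq> 1"
    have eq: "u = scalar (tau (r * u)) * u" using corner[OF u_mem] u by simp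
    have "Poly_Mapping.lookup u g = 0" for g
    proof -
      have "Poly_Mapping.lookup u g = tau (r * u) * Poly_Mapping.lookup u g"
        by (subst eq) (rule lookup_scalar_mult)
      then have "(1 - tau (r * u)) * Poly_Mapping.lookup u g = 0" by (simp add: left_diff_distrib)
      then show ?thesis using ne by simp
    qed
    then have "u = 0" by (intro poly_mapping_eqI) simp
    then show False using E path_idem_nonzero[OF sys S] by simp
  qed
  from that[OF u_mem v_mem u E corner this] show ?thesis .
qed

section \<open>Completeness of the path idempotents\<close>

declare path_idem.simps(2) [simp del]

interpretation group_alg: vector_space "\<lambda>(c :: 'k::field_char_0) (x :: 'k group_alg). scalar c * x"
  by standard (simp_all add: distrib_left distrib_right single_add scalar_mult_assoc)

text \<open>The matrix units are linearly independent, since two-sided multiplication by path idempotents separates them,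
  and there are as many of them as permutations, so they span the group algebra.  The sum of all path
  idempotents is a two-sided identity for each of them, hence for \<open>1\<close>.\<close>

lemma path_system_Suc:
  assumes sys: "path_system TYPE('k::field_char_0) n"
  shows "path_system TYPE('k) (Suc n)"
proof -
  let ?E = "\<lambda>T. path_idem (Suc n) T :: 'k group_alg"
  let ?P = "{(S, T). standard (Suc n) S \<and> standard (Suc n) T \<and> shape S = shape T}"
  have mult: "?E S * ?E T = (if S = T then ?E S else 0)" if "standard (Suc n) S" "standard (Suc n) T" for S T
    by (rule path_idem_mult[OF sys that])
  have "\<forall>p\<in>?P. \<exists>u. u \<in> sym_alg (Suc n) \<and> u \<noteq> 0 \<and> ?E (fst p) * u = u \<and> u * ?E (snd p) = u"
  proof
    fix p assume "p \<in> ?P"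
    then obtain S T where p: "p = (S, T)" "standard (Suc n) S" "standard (Suc n) T" "shape S = shape T" by auto
    from path_idem_corner[OF sys p(2-4)] obtain u v r :: "'k group_alg" where
      u: "u \<in> sym_alg (Suc n)" "?E S * u * ?E T = u" "tau (r * u) = 1" by metis
    have "?E S * u = ?E S * (?E S * u * ?E T)" by (simp only: u(2))
    also have "\<dots> = ?E S * ?E S * u * ?E T" by (simp only: mult.assoc)
    also have "\<dots> = u" using mult[OF p(2,2)] u(2) by simp
    finally have 1: "?E S * u = u" .
    have "u * ?E T = ?E S * u * ?E T * ?E T" by (simp only: u(2))
    also have "\<dots> = ?E S * u * (?E T * ?E T)" by (simp only: mult.assoc)
    also have "\<dots> = u" using mult[OF p(3,3)] u(2) by simp
    finally have 2: "u * ?E T = u" .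
    have "u \<noteq> 0" using u(3) by auto
    then show "\<exists>u. u \<in> sym_alg (Suc n) \<and> u \<noteq> 0 \<and> ?E (fst p) * u = u \<and> u * ?E (snd p) = u"
      using u(1) 1 2 p(1) by auto
  qed
  from bchoice[OF this] obtain u where u_all:
    "\<forall>p\<in>?P. u p \<in> sym_alg (Suc n) \<and> u p \<noteq> 0 \<and> ?E (fst p) * u p = u p \<and> u p * ?E (snd p) = u p" ..
  have u: "u p \<in> sym_alg (Suc n)" "u p \<noteq> 0" "?E (fst p) * u p = u p" "u p * ?E (snd p) = u p"
    if "p \<in> ?P" for p
    using bspec[OF u_all that] by simp_all
  have sel: "?E (fst p) * u q * ?E (snd p) = (if p = q then u p else 0)" if p: "p \<in> ?P" and q: "q \<in> ?P" for p q
  proof -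
    have std: "standard (Suc n) (fst p)" "standard (Suc n) (snd p)" "standard (Suc n) (fst q)" "standard (Suc n) (snd q)"
      using p q by auto
    have "?E (fst p) * u q * ?E (snd p) = ?E (fst p) * (?E (fst q) * u q * ?E (snd q)) * ?E (snd p)"
      by (simp only: u(3)[OF q] u(4)[OF q])
    also have "\<dots> = (?E (fst p) * ?E (fst q)) * u q * (?E (snd q) * ?E (snd p))"
      by (simp only: mult.assoc)
    also have "\<dots> = (if p = q then u p else 0)"
    proof (cases "p = q")
      case True
      then show ?thesis
        by (simp only: mult[OF std(3,3)] mult[OF std(4,4)] simp_thms if_True u(3)[OF q] u(4)[OF q])
    next
      case False
      then have "fst p \<noteq> fst q \<or> snd q \<noteq> snd p" by (metis prod_eqI)
      then show ?thesis
        using False by (elim disjE) (simp_all only: mult[OF std(1,3)] mult[OF std(4,2)] simp_thms if_False mult_zero_left mult_zero_right)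
    qed
    finally show ?thesis .
  qed
  have inj: "inj_on u ?P"
  proof (rule inj_onI)
    fix p q assume p: "p \<in> ?P" and q: "q \<in> ?P" and eq: "u p = u q"
    then show "p = q" using sel[OF p p] sel[OF p q] u(2)[OF p] by (metis (no_types, lifting))
  qed
  have finP: "finite ?P"
    using card_same_shape_pairs[of "Suc n"] by (metis (no_types, lifting) card.infinite fact_nonzero)
  let ?B = "u ` ?P" and ?G = "(basis_elem :: finperm \<Rightarrow> 'k group_alg) ` sym_group (Suc n)"
  have cardB: "card ?B = fact (Suc n)" using card_image[OF inj] card_same_shape_pairs by simp
  have indep: "group_alg.independent ?B"
    unfolding group_alg.independent_explicit_finite_subsets
  proof (intro allI impI ballI)
    fix A f v assume A: "A \<subseteq> ?B" "finite A" and sum: "(\<Sum>v\<in>A. scalar (f v) * v) = 0" and v: "v \<in> A"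
    from v A(1) obtain p where p: "p \<in> ?P" "v = u p" by blast
    have coeff: "?E (fst p) * w * ?E (snd p) = (if w = v then v else 0)" if "w \<in> A" for w
    proof -
      from that A(1) obtain q where q: "q \<in> ?P" "w = u q" by blast
      show ?thesis
        using sel[OF p(1) q(1)] inj_on_eq_iff[OF inj p(1) q(1)] p(2) q(2) by auto
    qed
    have "0 = ?E (fst p) * (\<Sum>w\<in>A. scalar (f w) * w) * ?E (snd p)" by (simp add: sum)
    also have "\<dots> = (\<Sum>w\<in>A. scalar (f w) * (?E (fst p) * w * ?E (snd p)))"
      by (simp only: sum_distrib_left sum_distrib_right scalar_left_commute[of "path_idem _ _"] mult.assoc)
    also have "\<dots> = (\<Sum>w\<in>A. if w = v then scalar (f v) * v else 0)"
      by (intro sum.cong refl) (auto simp: coeff)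
    also have "\<dots> = scalar (f v) * v" using A(2) v by simp
    finally have "scalar (f v) * v = 0" by simp
    then show "f v = 0"
      using scalar_cancel_left[of "f v" v 0] u(2)[OF p(1)] p(2) by auto
  qed
  have G: "sym_alg (Suc n) \<subseteq> group_alg.span ?G"
  proof
    fix x :: "'k group_alg" assume x: "x \<in> sym_alg (Suc n)"
    show "x \<in> group_alg.span ?G"
      by (subst sym_alg_expand[OF x]) (intro group_alg.span_sum group_alg.span_scale group_alg.span_base imageI)
  qed
  have span: "x \<in> group_alg.span ?B" if x: "x \<in> sym_alg (Suc n)" for x
  proof (rule ccontr)
    assume "x \<notin> group_alg.span ?B"
    then have ind: "group_alg.independent (insert x ?B)" by (rule group_alg.independent_insertI[OF _ indep])
    have x_new: "x \<notin> ?B" using \<open>x \<notin> group_alg.span ?B\<close> group_alg.span_base[of x ?B] by (rule contrapos_nn)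
    have "u p \<in> group_alg.span ?G" if "p \<in> ?P" for p using G u(1)[OF that] by (rule subsetD)
    then have "insert x ?B \<subseteq> group_alg.span ?G" using subsetD[OF G x] by blast
    from group_alg.independent_span_bound[OF _ ind this] have "card (insert x ?B) \<le> card ?G" by simp
    also have "\<dots> \<le> fact (Suc n)" using card_image_le[of "sym_group (Suc n)" "basis_elem :: finperm \<Rightarrow> 'k group_alg"]
      by (simp only: card_sym_group finite_sym_group)
    finally show False using x_new finP cardB by simp
  qed
  define s where "s = (\<Sum>T\<in>{T. standard (Suc n) T}. ?E T)"
  have sE: "s * ?E T = ?E T" "?E T * s = ?E T" if T: "standard (Suc n) T" for T
  proof -
    have "s * ?E T = (\<Sum>S\<in>{S. standard (Suc n) S}. if S = T then ?E T else 0)"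
      unfolding s_def sum_distrib_right by (intro sum.cong refl) (use mult T in auto)
    then show "s * ?E T = ?E T" using T by simp
    have "?E T * s = (\<Sum>S\<in>{S. standard (Suc n) S}. if S = T then ?E T else 0)"
      unfolding s_def sum_distrib_left by (intro sum.cong refl) (use mult T in auto)
    then show "?E T * s = ?E T" using T by simp
  qed
  have "?B \<subseteq> {x. s * x * s = x}"
  proof
    fix x assume "x \<in> ?B"
    then obtain p where p: "p \<in> ?P" "x = u p" by blast
    have "s * u p * s = s * (?E (fst p) * u p * ?E (snd p)) * s"
      by (simp only: u(3)[OF p(1)] u(4)[OF p(1)])
    also have "\<dots> = (s * ?E (fst p)) * u p * (?E (snd p) * s)" by (simp only: mult.assoc)
    also have "\<dots> = u p" using p(1) sE u(3,4)[OF p(1)] by auto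
    finally show "x \<in> {x. s * x * s = x}" using p(2) by simp
  qed
  moreover have "group_alg.subspace {x. s * x * s = x}"
    by (rule group_alg.subspaceI)
      (simp_all add: distrib_left distrib_right scalar_left_commute[of s] mult.assoc)
  ultimately have "group_alg.span ?B \<subseteq> {x. s * x * s = x}" by (rule group_alg.span_minimal)
  then have "s * 1 * s = 1" using span[OF sym_alg_1] by blast
  moreover have "s * s = s"
  proof -
    have "s * s = (\<Sum>T\<in>{T. standard (Suc n) T}. s * ?E T)" by (subst (2) s_def) (rule sum_distrib_left)
    also have "\<dots> = s" unfolding s_def by (intro sum.cong refl) (use sE(1) in \<open>simp add: s_def\<close>)
    finally show ?thesis .
  qed
  ultimately have "s = 1" by simp
  then show ?thesis unfolding path_system_def s_def using mult by blast
qed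

lemma path_system: "path_system TYPE('k::field_char_0) n"
  by (induction n) (rule path_system_0, rule path_system_Suc)

section \<open>The hook constant\<close>

text \<open>The trace of left multiplication by the path idempotent of \<open>T\<close> is \<open>fact (Suc n)\<close> times its identity
  coefficient.  Splitting the right factor along all path idempotents, each tableau of the same shape
  contributes a rank-one idempotent map, of trace \<open>1\<close>, and every other tableau contributes zero.\<close>

lemma kappa_eq_h_const:
  assumes T: "standard (Suc n) T"
  shows "tab_kappa (Suc n) T = (h_const (Suc n) (shape T) :: 'k::field_char_0)"
proof -
  let ?E = "\<lambda>S. path_idem (Suc n) S :: 'k group_alg" and ?G = "sym_group (Suc n)"
  let ?tr = "\<lambda>S. \<Sum>g\<in>?G. Poly_Mapping.lookup (?E T * basis_elem g * ?E S) g"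
  have tr: "?tr S = (if shape S = shape T then 1 else 0)" if S: "standard (Suc n) S" for S
  proof (cases "shape S = shape T")
    case True
    from path_idem_corner[OF path_system T S True[symmetric]] obtain u v r :: "'k group_alg" where
      u: "u \<in> sym_alg (Suc n)" "tau (r * u) = 1"
        "\<And>x. x \<in> sym_alg (Suc n) \<Longrightarrow> ?E T * x * ?E S = scalar (tau (r * x)) * u" by metis
    have "?tr S = (\<Sum>g\<in>?G. tau (r * basis_elem g) * Poly_Mapping.lookup u g)"
      by (intro sum.cong refl) (simp only: u(3)[OF sym_alg_basis] lookup_scalar_mult)
    also have "\<dots> = tau (r * u)" by (rule tau_sum_basis[OF u(1), symmetric])
    finally show ?thesis using u(2) True by simp
  next
    case False
    have "?tr S = (\<Sum>g\<in>?G. 0)"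
      by (intro sum.cong refl) (simp add: path_idem_orthogonal[OF T S] False[symmetric] sym_alg_basis)
    then show ?thesis using False by simp
  qed
  have "(\<Sum>g\<in>?G. Poly_Mapping.lookup (?E T * basis_elem g) g) = of_nat (fact (Suc n)) * tau (?E T)"
    by (simp only: lookup_mult_single diff_self mult_1_right sum_constant card_sym_group)
  moreover have "(\<Sum>g\<in>?G. Poly_Mapping.lookup (?E T * basis_elem g) g) = (\<Sum>S\<in>{S. standard (Suc n) S}. ?tr S)"
  proof -
    have "Poly_Mapping.lookup (?E T * basis_elem g) g =
        (\<Sum>S\<in>{S. standard (Suc n) S}. Poly_Mapping.lookup (?E T * basis_elem g * ?E S) g)" for g
    proof -
      have "?E T * basis_elem g = ?E T * basis_elem g * (\<Sum>S\<in>{S. standard (Suc n) S}. ?E S)"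
        by (simp only: path_system_sum[OF path_system] mult_1_right)
      then show ?thesis by (simp only: sum_distrib_left lookup_sum[symmetric])
    qed
    then show ?thesis by (simp only: sum.swap[of _ ?G])
  qed
  moreover have "(\<Sum>S\<in>{S. standard (Suc n) S}. ?tr S) = of_nat (num_standard (shape T))"
  proof -
    have "sum_list (shape T) = Suc n"
      using standard_tableau[OF T] by (simp add: is_tableau_def partition_of_def)
    then have "num_standard (shape T) = card {S \<in> {S. standard (Suc n) S}. shape S = shape T}"
      by (simp add: num_standard_def)
    moreover have "(\<Sum>S\<in>{S. standard (Suc n) S}. ?tr S) =
        (\<Sum>S\<in>{S. standard (Suc n) S}. if shape S = shape T then 1 else 0)"
      by (intro sum.cong refl tr) simp
    ultimately show ?thesis by (simp add: sum.If_cases Int_def)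
  qed
  ultimately have *: "of_nat (fact (Suc n)) * (1 / tab_kappa (Suc n) T) = (of_nat (num_standard (shape T)) :: 'k)"
    by (simp only: tau_path_idem[OF path_system T])
  have \<kappa>: "tab_kappa (Suc n) T \<noteq> (0 :: 'k)"
    by (rule kappa_nonzero[OF tableau_filling[OF standard_tableau[OF T]]])
  have f: "(of_nat (fact (Suc n)) :: 'k) = fact (Suc n)" "(fact (Suc n) :: 'k) \<noteq> 0"
    by (rule of_nat_fact) (rule fact_nonzero)
  let ?N = "of_nat (num_standard (shape T)) :: 'k"
  have "fact (Suc n) / tab_kappa (Suc n) T = ?N"
    using * by (simp only: f(1) times_divide_eq_right mult_1_right)
  then have "fact (Suc n) = ?N * tab_kappa (Suc n) T"
    by (simp only: divide_eq_eq \<kappa> simp_thms if_False)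
  then have "tab_kappa (Suc n) T = fact (Suc n) / ?N"
    using f(2) by (intro eq_divide_imp) (auto simp del: fact_Suc simp: mult.commute)
  then show ?thesis by (simp only: h_const_def)
qed

lemma young_idem_eq: "standard (Suc n) T \<Longrightarrow> young_idem (Suc n) T = young_symmetrizer (Suc n) T"
  by (simp only: young_idem_def kappa_eq_h_const young_symmetrizer_eq standard_tableau)

text \<open>Size \<open>1\<close> has to be compared separately, because there the seminormal recursion starts with \<open>1\<close>.\<close>

lemma young_idem_one: "young_idem (Suc 0) T = (1 :: 'k::field_char_0 group_alg)"
proof -
  have "\<sigma> = 0" if "\<sigma> \<in> sym_group (Suc 0)" for \<sigma>
    using that sym_group_app_mem[OF that] by (intro finperm_eq_zeroI[OF that]) auto
  then have "fiber_stab (Suc 0) f = {0}" for f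
    using fiber_stab_subset[of "Suc 0" f] fiber_stab_zero[of "Suc 0" f] by blast
  then have "young_elem (Suc 0) r c = (1 :: 'k group_alg)" for r c
    by (simp add: young_elem_def twisted_sum_def sign_character_zero[OF sign_character_perm_sign])
  then show ?thesis by (simp add: young_idem_def kappa_def)
qed

lemma path_idem_eq_seminormal: "standard n T \<Longrightarrow> path_idem n T = seminormal n T"
proof (induction n T rule: seminormal.induct)
  case (2 T)
  then show ?case by (simp add: path_idem.simps young_idem_one)
next
  case (3 m T)
  have "standard (Suc m) (remove_box (Suc (Suc m)) T)" using standard_remove_box[OF 3(2)] by blast
  then show ?case
    using 3(1) by (simp only: path_idem.simps(2)[of "Suc m"] seminormal.simps Let_def young_idem_eq[OF 3(2)])
qed simp

section \<open>The canonical central idempotents\<close>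

definition shape_idem :: "nat \<Rightarrow> nat list \<Rightarrow> 'k::field_char_0 group_alg" where
  "shape_idem n lam = (\<Sum>T\<in>{T. standard n T \<and> shape T = lam}. path_idem n T)"

lemma finite_standard_shape [simp]: "finite {T. standard n T \<and> shape T = lam}"
  by (rule finite_subset[OF _ finite_standard[of n]]) blast

lemma shape_idem_sym_alg [simp]: "shape_idem n lam \<in> sym_alg n"
  unfolding shape_idem_def by (intro sym_alg_sum path_idem_sym_alg)

lemma sum_standard_shape:
  assumes "\<And>T. standard n T \<Longrightarrow> shape T \<noteq> lam \<Longrightarrow> f T = 0"
  shows "(\<Sum>T\<in>{T. standard n T}. f T) = (\<Sum>T\<in>{T. standard n T \<and> shape T = lam}. f T)"
  by (rule sum.mono_neutral_right) (use assms in auto)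

text \<open>Corners between different shapes vanish, so both sides equal \<open>shape_idem n lam * x * shape_idem n lam\<close>.\<close>

lemma shape_idem_commute:
  assumes x: "x \<in> sym_alg n"
  shows "shape_idem n lam * x = x * (shape_idem n lam :: 'k::field_char_0 group_alg)"
proof -
  let ?E = "shape_idem n lam :: 'k group_alg"
  note one = path_system_sum[OF path_system, where ?'k = 'k and n = n]
  have "?E * x = (\<Sum>T\<in>{T. standard n T}. ?E * x * path_idem n T)"
    by (simp only: sum_distrib_left[symmetric] one mult_1_right)
  also have "\<dots> = (\<Sum>T\<in>{T. standard n T \<and> shape T = lam}. ?E * x * path_idem n T)"
    by (rule sum_standard_shape)
      (auto simp: shape_idem_def sum_distrib_right path_idem_orthogonal[OF _ _ _ x] intro!: sum.neutral)
  finally have 1: "?E * x = ?E * x * ?E" by (simp only: shape_idem_def sum_distrib_left)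
  have "x * ?E = (\<Sum>T\<in>{T. standard n T}. path_idem n T * (x * ?E))"
    by (simp only: sum_distrib_right[symmetric] one mult_1_left)
  also have "\<dots> = (\<Sum>T\<in>{T. standard n T \<and> shape T = lam}. path_idem n T * (x * ?E))"
    by (rule sum_standard_shape)
      (auto simp: shape_idem_def sum_distrib_left path_idem_orthogonal[OF _ _ _ x] mult.assoc[symmetric]
        intro!: sum.neutral)
  finally have 2: "x * ?E = ?E * (x * ?E)" by (simp only: shape_idem_def sum_distrib_right)
  show ?thesis using 1 2 by (simp only: mult.assoc)
qed

lemma path_idem_shape_idem:
  assumes T: "standard n T"
  shows "path_idem n T * shape_idem n lam = (if shape T = lam then path_idem n T else (0 :: 'k::field_char_0 group_alg))"
proof -
  have "path_idem n T * shape_idem n lam =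
      (\<Sum>S\<in>{S. standard n S \<and> shape S = lam}. if S = T then path_idem n T else (0 :: 'k group_alg))"
    unfolding shape_idem_def sum_distrib_left
    by (intro sum.cong refl) (use path_system_mult[OF path_system T, where ?'k = 'k] in auto)
  then show ?thesis using T by simp
qed

lemma shape_idem_idem: "shape_idem n lam * shape_idem n lam = (shape_idem n lam :: 'k::field_char_0 group_alg)"
proof -
  have "shape_idem n lam * shape_idem n lam =
      (\<Sum>T\<in>{T. standard n T \<and> shape T = lam}. path_idem n T * (shape_idem n lam :: 'k group_alg))"
    by (subst (1) shape_idem_def) (rule sum_distrib_right)
  also have "\<dots> = shape_idem n lam"
    by (subst (2) shape_idem_def) (intro sum.cong refl, simp add: path_idem_shape_idem)
  finally show ?thesis .
qed

lemma shape_idem_center: "shape_idem n lam \<in> sym_alg_center n"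
  by (simp add: sym_alg_center_def shape_idem_commute)

text \<open>Inserting \<open>1\<close> as the sum of all path idempotents to the right of a Young symmetrizer, only those of its own shape
  survive; this is the action on Specht modules.\<close>

lemma young_idem_shape_idem:
  assumes S: "standard (Suc n) S"
  shows "young_idem (Suc n) S * shape_idem (Suc n) lam =
    (if shape S = lam then young_idem (Suc n) S else (0 :: 'k::field_char_0 group_alg))"
proof -
  let ?y = "young_idem (Suc n) S :: 'k group_alg"
  have zero: "?y * path_idem (Suc n) T = 0" if T: "standard (Suc n) T" "shape T \<noteq> shape S" for T
  proof -
    let ?f = "path_idem n (remove_box (Suc n) T) :: 'k group_alg"
    have "?f \<in> sym_alg (Suc n)" by (rule sym_alg_mono[OF _ path_idem_sym_alg]) simp
    then have "?y * ?f * young_idem (Suc n) T = 0"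
      using that by (intro young_idem_orthogonal[OF S T(1)]) auto
    then have "?y * ?f * young_idem (Suc n) T * ?f = 0" by simp
    then show ?thesis by (simp only: path_idem.simps mult.assoc)
  qed
  show ?thesis
  proof (cases "shape S = lam")
    case True
    have "?y = (\<Sum>T\<in>{T. standard (Suc n) T}. ?y * path_idem (Suc n) T)"
      by (simp only: sum_distrib_left[symmetric] path_system_sum[OF path_system] mult_1_right)
    also have "\<dots> = (\<Sum>T\<in>{T. standard (Suc n) T \<and> shape T = lam}. ?y * path_idem (Suc n) T)"
      by (rule sum_standard_shape) (use zero True in auto)
    finally show ?thesis using True by (simp only: shape_idem_def sum_distrib_left if_True simp_thms)
  next
    case False
    have "?y * shape_idem (Suc n) lam = 0"
      unfolding shape_idem_def sum_distrib_left by (rule sum.neutral) (use zero False in auto)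
    then show ?thesis using False by simp
  qed
qed

text \<open>The corner of a path idempotent is a line.  Together with \<open>central_vanish\<close>, this shows that a shape
  idempotent does not split.\<close>

lemma central_scalar:
  assumes T: "standard (Suc n) T" and x: "x \<in> sym_alg_center (Suc n)"
  obtains c where "x * path_idem (Suc n) T = scalar c * (path_idem (Suc n) T :: 'k::field_char_0 group_alg)"
proof -
  let ?E = "path_idem (Suc n) T :: 'k group_alg"
  from path_idem_corner[OF path_system T T refl] obtain u v r :: "'k group_alg" where
    u: "\<And>x. x \<in> sym_alg (Suc n) \<Longrightarrow> ?E * x * ?E = scalar (tau (r * x)) * u" by metis
  have x': "x \<in> sym_alg (Suc n)" and com: "x * ?E = ?E * x" using x by (auto simp: sym_alg_center_def)
  have EE: "?E * ?E = ?E" using path_system_mult[OF path_system T T, where ?'k = 'k] by simp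
  have E: "?E = scalar (tau r) * u" using u[of 1] EE by simp
  have "tau r \<noteq> 0"
  proof
    assume "tau r = 0"
    then have "?E = 0" using E by simp
    then show False using path_idem_nonzero[OF path_system T, where ?'k = 'k] by simp
  qed
  then have ru: "u = scalar (1 / tau r) * ?E" by (subst E) (simp add: scalar_mult_assoc)
  have "x * ?E = x * ?E * ?E" by (simp only: mult.assoc EE)
  also have "\<dots> = scalar (tau (r * x)) * u" using u[OF x'] com by simp
  also have "\<dots> = scalar (tau (r * x) * (1 / tau r)) * ?E" by (subst ru) (rule scalar_mult_assoc)
  finally show ?thesis by (rule that)
qed

text \<open>Path idempotents of the same shape generate the same two-sided ideal.\<close>

lemma central_vanish:
  assumes T: "standard (Suc n) T" and x: "x \<in> sym_alg_center (Suc n)"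
    and zero: "x * path_idem (Suc n) T = (0 :: 'k::field_char_0 group_alg)"
  shows "x * shape_idem (Suc n) (shape T) = 0"
proof -
  have "x * path_idem (Suc n) S = 0" if S: "standard (Suc n) S" "shape S = shape T" for S
  proof -
    from path_idem_corner[OF path_system S(1) T S(2)] obtain u v r :: "'k group_alg" where
      u: "u \<in> sym_alg (Suc n)" "path_idem (Suc n) S = u * path_idem (Suc n) T * v" by metis
    have "x * path_idem (Suc n) S = (x * u) * path_idem (Suc n) T * v" by (simp only: u(2) mult.assoc)
    also have "x * u = u * x" using x u(1) by (auto simp: sym_alg_center_def)
    also have "u * x * path_idem (Suc n) T * v = u * (x * path_idem (Suc n) T) * v" by (simp only: mult.assoc)
    finally show ?thesis by (simp add: zero)
  qed
  then show ?thesis unfolding shape_idem_def sum_distrib_left by (intro sum.neutral) auto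
qed

lemma shape_idem_primitive:
  assumes T: "standard (Suc n) T"
  shows "primitive_central_idempotent (Suc n) (shape_idem (Suc n) (shape T) :: 'k::field_char_0 group_alg)"
  unfolding primitive_central_idempotent_def
proof (intro conjI allI impI)
  let ?E = "shape_idem (Suc n) (shape T) :: 'k group_alg" and ?e = "path_idem (Suc n) T :: 'k group_alg"
  show "central_idempotent (Suc n) ?E"
    by (simp add: central_idempotent_def shape_idem_center shape_idem_idem)
  show "?E \<noteq> 0"
    using path_idem_shape_idem[OF T, of "shape T", where ?'k = 'k] path_idem_nonzero[OF path_system T, where ?'k = 'k]
    by auto
  fix x y :: "'k group_alg"
  assume xy: "central_idempotent (Suc n) x \<and> central_idempotent (Suc n) y \<and> x * y = 0 \<and> ?E = x + y"
  then have cen: "x \<in> sym_alg_center (Suc n)" "y \<in> sym_alg_center (Suc n)" and sq: "x * x = x" "y * y = y"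
    and xy0: "x * y = 0" and E: "?E = x + y" unfolding central_idempotent_def by satx+
  have "y * x = x * y" using cen unfolding sym_alg_center_def by blast
  then have yx0: "y * x = 0" by (simp only: xy0)
  have xE: "x * ?E = x" and yE: "y * ?E = y" by (simp_all only: E distrib_left sq xy0 yx0 add_0_left add_0_right)
  from central_scalar[OF T cen(1)] obtain c where c: "x * ?e = scalar c * ?e" by blast
  from central_scalar[OF T cen(2)] obtain d where d: "y * ?e = scalar d * ?e" by blast
  have "scalar (d * c) * ?e = x * y * ?e"
    by (simp only: mult.assoc d scalar_left_commute[of x] c scalar_mult_assoc)
  then have "scalar (d * c) * ?e = 0" by (simp add: xy0)
  then have "d * c = 0"
    using scalar_cancel_left[of "d * c" ?e 0] path_idem_nonzero[OF path_system T, where ?'k = 'k] by auto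
  then have "x * ?e = 0 \<or> y * ?e = 0" using c d by auto
  then show "x = 0 \<or> y = 0"
    using central_vanish[OF T cen(1)] central_vanish[OF T cen(2)] xE yE by auto
qed

lemma specht_eq:
  "standard (Suc n) S \<Longrightarrow> specht (Suc n) S = {young_idem (Suc n) S * a | a. a \<in> sym_alg (Suc n)}"
  unfolding specht_def by (simp only: young_idem_eq)

lemma shape_idem_canonical:
  assumes T: "standard (Suc n) T"
  shows "is_canonical_central (Suc n) (shape T) (shape_idem (Suc n) (shape T) :: 'k::field_char_0 group_alg)"
proof -
  let ?E = "shape_idem (Suc n) (shape T) :: 'k group_alg"
  have act: "x * ?E = (if shape S = shape T then x else 0)" if S: "standard (Suc n) S" "x \<in> specht (Suc n) S" for x S
  proof -
    from S obtain a where a: "x = young_idem (Suc n) S * a" "a \<in> sym_alg (Suc n)" unfolding specht_eq[OF S(1)] by blast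
    have "x * ?E = young_idem (Suc n) S * ?E * a"
      by (simp only: a(1) mult.assoc shape_idem_commute[OF a(2)])
    then show ?thesis by (simp add: young_idem_shape_idem[OF S(1)] a(1))
  qed
  then show ?thesis
    unfolding is_canonical_central_def using shape_idem_primitive[OF T, where ?'k = 'k] by auto
qed

text \<open>The action on the Specht modules determines a canonical idempotent: \<open>path_idem (Suc n) S\<close> is a left
  multiple of an element of the Specht module of \<open>S\<close>, and the path idempotents sum to \<open>1\<close>.\<close>

lemma canonical_central_unique:
  assumes z: "is_canonical_central (Suc n) lam z"
  shows "z = (shape_idem (Suc n) lam :: 'k::field_char_0 group_alg)"
proof -
  have act: "path_idem (Suc n) S * z = (if shape S = lam then path_idem (Suc n) S else 0)" if S: "standard (Suc n) S" for S
  proof -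
    let ?e = "path_idem n (remove_box (Suc n) S) :: 'k group_alg" and ?y = "young_idem (Suc n) S :: 'k group_alg"
    have "?e \<in> sym_alg (Suc n)" by (rule sym_alg_mono[OF _ path_idem_sym_alg]) simp
    then have mem: "?y * ?e \<in> specht (Suc n) S" unfolding specht_eq[OF S] by auto
    have "shape S \<turnstile>p Suc n" using standard_tableau[OF S] by (simp add: is_tableau_def)
    then have "?y * ?e * z = (if shape S = lam then ?y * ?e else 0)"
      using z S mem unfolding is_canonical_central_def by auto
    moreover have "path_idem (Suc n) S * z = ?e * (?y * ?e * z)" by (simp only: path_idem.simps mult.assoc)
    ultimately show ?thesis by (simp add: path_idem.simps mult.assoc)
  qed
  have "z = (\<Sum>S\<in>{S. standard (Suc n) S}. path_idem (Suc n) S) * z"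
    by (simp only: path_system_sum[OF path_system] mult_1_left)
  also have "\<dots> = (\<Sum>S\<in>{S. standard (Suc n) S}. path_idem (Suc n) S * z)" by (rule sum_distrib_right)
  also have "\<dots> = (\<Sum>S\<in>{S. standard (Suc n) S \<and> shape S = lam}. path_idem (Suc n) S * z)"
    by (rule sum_standard_shape) (simp add: act)
  also have "\<dots> = shape_idem (Suc n) lam" unfolding shape_idem_def by (intro sum.cong refl) (simp add: act)
  finally show ?thesis .
qed

lemma canonical_central_eq:
  assumes T: "standard (Suc n) T"
  shows "canonical_central (Suc n) (shape T) = (shape_idem (Suc n) (shape T) :: 'k::field_char_0 group_alg)"
  unfolding canonical_central_def
  by (rule the_equality, rule shape_idem_canonical[OF T], rule canonical_central_unique)

text \<open>Multiplying \<open>path_idem n (remove_box (Suc n) T)\<close> by the sum of all path idempotents of the shape of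
  \<open>T\<close> leaves the paths that extend the shorter one, and there is only one of the right shape.\<close>

lemma path_idem_extend:
  assumes T: "standard (Suc n) T"
  shows "path_idem n (remove_box (Suc n) T) * shape_idem (Suc n) (shape T) =
    (path_idem (Suc n) T :: 'k::field_char_0 group_alg)"
proof -
  let ?e = "\<lambda>S. path_idem n (remove_box (Suc n) S) :: 'k group_alg"
  have bar: "standard n (remove_box (Suc n) S)" if "standard (Suc n) S" for S
    using standard_remove_box[OF that] by blast
  have "?e T * path_idem (Suc n) S = (if S = T then path_idem (Suc n) T else 0)"
    if S: "standard (Suc n) S" "shape S = shape T" for S
  proof -
    have eq: "?e T * path_idem (Suc n) S = (?e T * ?e S) * young_idem (Suc n) S * ?e S"
      by (simp only: path_idem.simps mult.assoc)
    show ?thesis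
    proof (cases "S = T")
      case True
      have "?e T * ?e T = ?e T" using path_system_mult[OF path_system bar[OF T] bar[OF T], where ?'k = 'k] by simp
      then show ?thesis using eq True by (simp add: path_idem.simps)
    next
      case False
      then have "remove_box (Suc n) T \<noteq> remove_box (Suc n) S" using standard_Suc_eq[OF S(1) T] S(2) by metis
      then have "?e T * ?e S = 0" using path_system_mult[OF path_system bar[OF T] bar[OF S(1)], where ?'k = 'k] by simp
      then show ?thesis using eq False by simp
    qed
  qed
  then have "?e T * shape_idem (Suc n) (shape T) =
      (\<Sum>S\<in>{S. standard (Suc n) S \<and> shape S = shape T}. if S = T then path_idem (Suc n) T else 0)"
    unfolding shape_idem_def sum_distrib_left by (intro sum.cong refl) simp
  then show ?thesis using T by simp
qed

lemma canonical_idempotent_eq_path_idem: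
  "standard n T \<Longrightarrow> canonical_idempotent n T = (path_idem n T :: 'k::field_char_0 group_alg)"
proof (induction n arbitrary: T)
  case 0
  then show ?case by (simp add: canonical_idempotent_def)
next
  case (Suc n)
  let ?U = "remove_box (Suc n) T"
  have U: "standard n ?U" using standard_remove_box[OF Suc.prems] by blast
  have map: "map (\<lambda>k. canonical_central k (shape (subtableau k T)) :: 'k group_alg) [1..<Suc n] =
      map (\<lambda>k. canonical_central k (shape (subtableau k ?U))) [1..<Suc n]"
  proof (rule map_cong[OF refl])
    fix k assume "k \<in> set [1..<Suc n]"
    then have "k \<le> n" by auto
    then show "canonical_central k (shape (subtableau k T)) =
        (canonical_central k (shape (subtableau k ?U)) :: 'k group_alg)"
      by (simp only: subtableau_remove_box)
  qed
  have upt: "[1..<Suc (Suc n)] = [1..<Suc n] @ [Suc n]" by simp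
  have "canonical_idempotent (Suc n) T =
      canonical_idempotent n ?U * (canonical_central (Suc n) (shape T) :: 'k group_alg)"
    unfolding canonical_idempotent_def upt map_append map prod_list.append
    by (simp only: list.map prod_list.Cons prod_list.Nil mult_1_right subtableau_self[OF Suc.prems])
  also have "\<dots> = path_idem n ?U * shape_idem (Suc n) (shape T)"
    by (simp only: Suc.IH[OF U] canonical_central_eq[OF Suc.prems])
  also have "\<dots> = path_idem (Suc n) T" by (rule path_idem_extend[OF Suc.prems])
  finally show ?case .
qed

theorem proposition4p7:
  fixes n :: nat and T :: tableau
  assumes "n \<ge> 1" and "standard n T"
  shows "(canonical_idempotent n T :: 'k::field_char_0 group_alg) = seminormal n T"
  by (rule trans[OF canonical_idempotent_eq_path_idem path_idem_eq_seminormal, OF assms(2) assms(2)])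

end
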